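(* Assume $\Box_{\omega_1}$ and let $\rho$ and $\mathbb{P}$ be as in the context. Suppose that $\langle (T^\alpha,F^\alpha) : \alpha < \omega_1 \rangle$ is a sequence of conditions in $\mathbb{P}$ and for each $\alpha < \omega_1$, $x^\alpha \in T^\alpha \setminus \alpha$ (i.e. $x^\alpha$ is an element of $T^\alpha$ which, as an ordinal, is $\ge \alpha$). Then there exists an uncountable set $Z \subseteq \omega_1$ such that for all $\alpha < \beta$ in $Z$ there exists a condition $(W,H) \in \mathbb{P}$ with $(W,H) \le (T^\alpha,F^\alpha)$, $(W,H) \le (T^\beta,F^\beta)$, and $x^\alpha <_W x^\beta$.
   Context: Heights: for a countable ordinal $\gamma$, $\mathrm{ht}(\gamma)$ is the unique $\alpha$ with $\omega\cdot\alpha \le \gamma < \omega\cdot(\alpha+1)$. Standard finite tree: a pair $(T,<_T)$ with (1) $T$ a finite subset of $\{0\}\cup(\omega_1\setminus\omega)$, $0 \in T$; (2) $<_T$ a strict partial order on $T$ such that $\{y : y <_T x\}$ is linearly ordered for each $x$; (3) $x <_T y$ implies $\mathrm{ht}(x) < \mathrm{ht}(y)$; (4) for all $x \in T$ and all $\alpha \in \{\mathrm{ht}(z): z \in T\} \cap \mathrm{ht}(x)$ there is $y <_T x$ with $\mathrm{ht}(y)=\alpha$. Let $\mathrm{ht}[T] = \{\mathrm{ht}(x) : x \in T\}\setminus\{0\}$, $T_\alpha = \{x \in T : \mathrm{ht}(x)=\alpha\}$; for $x \in T_\alpha$ and $\beta \in (\mathrm{ht}[T]\cup\{0\}) \cap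 \alpha$, $x \upharpoonright \beta$ is the unique $y \in T_\beta$ with $y <_T x$. $U$ extends $T$ if $T \subseteq U$ and $<_T \subseteq <_U$. Standard function on $T$: a partial function $f$ from $T$ to $T$ which is injective, strictly increasing ($x <_T y$ implies $f(x) <_T f(y)$), level preserving ($\mathrm{ht}(f(x)) = \mathrm{ht}(x)$), downwards closed ($x \in \mathrm{dom}(f)$ and $\beta \in \mathrm{ht}[T]\cap \mathrm{ht}(x)$ imply $x\upharpoonright\beta \in \mathrm{dom}(f)$), and has $f(x) \ne x$ for all $x \in \mathrm{dom}(f)\setminus\{0\}$. For $m \in \{-1,1\}$, $f^1 = f$ and $f^{-1}$ is the inverse partial function. $\rho$-separation: let $\{f_\xi : \xi \in A\}$ be a finite family of standard functions on $T$, $A \subseteq \omega_2$, $\alpha \in \mathrm{ht}[T]$. For distinct $a_0,\dots,a_{n-1} \in T_\alpha$, the family is $\rho$-separated on $(a_0,\dots,a_{n-1})$ if for all $i<n$, whenever $(j_0,m_0,\tau_0) \ne (j_1,m_1,\tau_1)$ satisfy $j_k < i$, $m_k \in\{-1,1\}$, $\tau_k \in A$, $f_{\tau_k}^{m_k}(a_i) = a_{j_k}$ ($k<2$), then $j_0 = j_1$ and $\rho(\tau_0,\tau_1) \ge \alpha$. It is $\rho$-separated on a set $X \subseteq T_\alpha$ if this holds for some injective enumeration of $X$. $\rho$: under $\Box_{\omega_1}$ there is a function $\rho: \omega_2\times\omega_2 \to \omega_1$ with $\rho(\alpha,\alpha)=0$, $\rho(\alpha,\beta)=\rho(\beta,\alpha)$,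 and the special property: for every uncountable family $\mathcal F$ of finite subsets of $\omega_2$ and every $\mu<\omega_1$ there is an uncountable $\mathcal F' \subseteq \mathcal F$ such that for distinct $x,y \in \mathcal F'$ and all $\tau \in x\setminus y$, $\zeta \in y \setminus x$, $\gamma \in x\cap y$: $\rho(\tau,\zeta) \ge \max\{\min\{\rho(\tau,\gamma),\rho(\zeta,\gamma)\},\mu\}$. Fix such $\rho$. The forcing $\mathbb{P}$: conditions are pairs $(T,F)$ where $T$ is a standard finite tree, $F$ is a function with domain a finite subset of $\omega_2$ and each $F(\gamma)$ a standard function on $T$, and for every $\alpha \in \mathrm{ht}[T]$ the family $\{F(\tau):\tau \in \mathrm{dom}(F)\}$ is $\rho$-separated on $T_\alpha$. $(U,G) \le (T,F)$ iff (a) $U$ extends $T$; (b) $\mathrm{dom}(F)\subseteq\mathrm{dom}(G)$ and $F(\gamma) \subseteq G(\gamma)$ for $\gamma \in \mathrm{dom}(F)$; (c) whenever $\gamma \ne \tau$ are in $\mathrm{dom}(F)$, $x \in \mathrm{dom}(G(\gamma))\cap\mathrm{dom}(G(\tau))$ and $G(\gamma)(x) = G(\tau)(x)$, there is $z \in T$ with $x \le_U z$ and $F(\gamma)(z) = F(\tau)(z)$. *)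

theory Defs
  imports Main "HOL-Library.Countable_Set"
begin

text \<open>The ordinals \<open>\<omega>\<^sub>1\<close> and \<open>\<omega>\<^sub>2\<close> are realised as the well-ordered types carried by the
  library's successor cardinals of \<open>natLeq\<close>.  A statement about all \<open>\<alpha> < \<omega>\<^sub>1\<close> is thus a
  statement about all elements of type \<open>omega1\<close>, and likewise for \<open>\<omega>\<^sub>2\<close>.\<close>

lemma Card_order_omega1: "Card_order (cardSuc natLeq)"
  by (rule cardSuc_Card_order[OF natLeq_Card_order])

lemma Card_order_omega2: "Card_order (cardSuc (cardSuc natLeq))"
  by (rule cardSuc_Card_order[OF Card_order_omega1])

lemma infinite_Field_omega1: "infinite (Field (cardSuc natLeq))"
  using cardSuc_finite[OF natLeq_Card_order] by (simp add: Field_natLeq)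

lemma infinite_Field_omega2: "infinite (Field (cardSuc (cardSuc natLeq)))"
  using cardSuc_finite[OF Card_order_omega1] infinite_Field_omega1 by simp

typedef omega1 = "Field (cardSuc natLeq)"
  using infinite_Field_omega1 by (metis all_not_in_conv finite.emptyI)

typedef omega2 = "Field (cardSuc (cardSuc natLeq))"
  using infinite_Field_omega2 by (metis all_not_in_conv finite.emptyI)

lemma Well_order_facts:
  assumes "Well_order r"
  shows "x \<in> Field r \<Longrightarrow> (x, x) \<in> r"
    and "(x, y) \<in> r \<Longrightarrow> (y, z) \<in> r \<Longrightarrow> (x, z) \<in> r"
    and "(x, y) \<in> r \<Longrightarrow> (y, x) \<in> r \<Longrightarrow> x = y"
    and "x \<in> Field r \<Longrightarrow> y \<in> Field r \<Longrightarrow> (x, y) \<in> r \<or> (y, x) \<in> r"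
    and "wf (r - Id)"
proof -
  have r: "refl_on (Field r) r" "trans r" "antisym r" "total_on (Field r) r" "wf (r - Id)"
    using assms unfolding well_order_on_def linear_order_on_def partial_order_on_def
      preorder_on_def by blast+
  show "x \<in> Field r \<Longrightarrow> (x, x) \<in> r" using r(1) by (rule refl_onD)
  show "(x, y) \<in> r \<Longrightarrow> (y, z) \<in> r \<Longrightarrow> (x, z) \<in> r" using r(2) by (rule transD)
  show "(x, y) \<in> r \<Longrightarrow> (y, x) \<in> r \<Longrightarrow> x = y" using r(3) by (rule antisymD)
  show "x \<in> Field r \<Longrightarrow> y \<in> Field r \<Longrightarrow> (x, y) \<in> r \<or> (y, x) \<in> r"
    using r(1,4) unfolding total_on_def by (metis refl_onD)
  show "wf (r - Id)" by (rule r(5))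
qed

lemmas omega1_order = Well_order_facts[OF card_order_on_well_order_on[OF Card_order_omega1]]
lemmas omega2_order = Well_order_facts[OF card_order_on_well_order_on[OF Card_order_omega2]]

instantiation omega1 :: wellorder
begin

definition less_eq_omega1 :: "omega1 \<Rightarrow> omega1 \<Rightarrow> bool"
  where "x \<le> y \<longleftrightarrow> (Rep_omega1 x, Rep_omega1 y) \<in> cardSuc natLeq"

definition less_omega1 :: "omega1 \<Rightarrow> omega1 \<Rightarrow> bool"
  where "x < y \<longleftrightarrow> x \<le> y \<and> \<not> y \<le> (x :: omega1)"

instance
proof
  fix x y z :: omega1
  show "x < y \<longleftrightarrow> x \<le> y \<and> \<not> y \<le> x" by (rule less_omega1_def)
  show "x \<le> x" unfolding less_eq_omega1_def by (intro omega1_order(1) Rep_omega1)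
  show "x \<le> y \<Longrightarrow> y \<le> z \<Longrightarrow> x \<le> z" unfolding less_eq_omega1_def by (rule omega1_order(2))
  show "x \<le> y \<Longrightarrow> y \<le> x \<Longrightarrow> x = y"
    unfolding less_eq_omega1_def by (intro Rep_omega1_inject[THEN iffD1] omega1_order(3))
  show "x \<le> y \<or> y \<le> x" unfolding less_eq_omega1_def by (intro omega1_order(4) Rep_omega1)
next
  fix P :: "omega1 \<Rightarrow> bool" and a
  assume step: "\<And>x. (\<And>y. y < x \<Longrightarrow> P y) \<Longrightarrow> P x"
  have "wf (inv_image (cardSuc natLeq - Id) Rep_omega1)" by (intro wf_inv_image omega1_order(5))
  then show "P a"
  proof (induction a rule: wf_induct_rule)
    case (less x)
    show ?case
      by (rule step, rule less)
        (auto simp: less_omega1_def less_eq_omega1_def)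
  qed
qed

end

instantiation omega2 :: wellorder
begin

definition less_eq_omega2 :: "omega2 \<Rightarrow> omega2 \<Rightarrow> bool"
  where "x \<le> y \<longleftrightarrow> (Rep_omega2 x, Rep_omega2 y) \<in> cardSuc (cardSuc natLeq)"

definition less_omega2 :: "omega2 \<Rightarrow> omega2 \<Rightarrow> bool"
  where "x < y \<longleftrightarrow> x \<le> y \<and> \<not> y \<le> (x :: omega2)"

instance
proof
  fix x y z :: omega2
  show "x < y \<longleftrightarrow> x \<le> y \<and> \<not> y \<le> x" by (rule less_omega2_def)
  show "x \<le> x" unfolding less_eq_omega2_def by (intro omega2_order(1) Rep_omega2)
  show "x \<le> y \<Longrightarrow> y \<le> z \<Longrightarrow> x \<le> z" unfolding less_eq_omega2_def by (rule omega2_order(2))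
  show "x \<le> y \<Longrightarrow> y \<le> x \<Longrightarrow> x = y"
    unfolding less_eq_omega2_def by (intro Rep_omega2_inject[THEN iffD1] omega2_order(3))
  show "x \<le> y \<or> y \<le> x" unfolding less_eq_omega2_def by (intro omega2_order(4) Rep_omega2)
next
  fix P :: "omega2 \<Rightarrow> bool" and a
  assume step: "\<And>x. (\<And>y. y < x \<Longrightarrow> P y) \<Longrightarrow> P x"
  have "wf (inv_image (cardSuc (cardSuc natLeq) - Id) Rep_omega2)"
    by (intro wf_inv_image omega2_order(5))
  then show "P a"
  proof (induction a rule: wf_induct_rule)
    case (less x)
    show ?case
      by (rule step, rule less)
        (auto simp: less_omega2_def less_eq_omega2_def)
  qed
qed

end

definition le_rel_on :: "'a::wellorder set \<Rightarrow> 'a rel"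
  where "le_rel_on A = {(x, y). x \<in> A \<and> y \<in> A \<and> x \<le> y}"

definition limit_ord :: "'a::wellorder \<Rightarrow> bool"
  where "limit_ord a \<longleftrightarrow> (\<exists>b. b < a) \<and> (\<forall>b<a. \<exists>c. b < c \<and> c < a)"

text \<open>Ordinal addition and multiplication by the usual transfinite recursion:
  \<open>a + b = max a (sup {(a + b') + 1 | b' < b})\<close> and
  \<open>a \<cdot> b = sup {(a \<cdot> b' + x) + 1 | b' < b, x < a}\<close>; countable suprema exist in \<open>\<omega>\<^sub>1\<close>, so
  the \<open>LEAST\<close> is always attained.\<close>

function ord_add :: "omega1 \<Rightarrow> omega1 \<Rightarrow> omega1"
  where "ord_add a b = (LEAST c. a \<le> c \<and> (\<forall>b'. b' < b \<longrightarrow> ord_add a b' < c))"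
  by pat_completeness simp
termination
proof (relation "inv_image {(x, y). x < y} snd")
  show "wf (inv_image {(x, y). x < y} (snd :: omega1 \<times> omega1 \<Rightarrow> omega1))"
    by (rule wf_inv_image[OF wf])
qed simp

declare ord_add.simps [simp del]

function ord_mult :: "omega1 \<Rightarrow> omega1 \<Rightarrow> omega1"
  where "ord_mult a b = (LEAST c. \<forall>b'. b' < b \<longrightarrow> (\<forall>x<a. ord_add (ord_mult a b') x < c))"
  by pat_completeness simp
termination
proof (relation "inv_image {(x, y). x < y} snd")
  show "wf (inv_image {(x, y). x < y} (snd :: omega1 \<times> omega1 \<Rightarrow> omega1))"
    by (rule wf_inv_image[OF wf])
qed simp

declare ord_mult.simps [simp del]

instantiation omega1 :: "{zero, one, plus, times}"
begin

definition zero_omega1 :: omega1 where "0 = (LEAST x :: omega1. True)"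
definition one_omega1 :: omega1 where "1 = (LEAST x :: omega1. 0 < x)"
definition plus_omega1 :: "omega1 \<Rightarrow> omega1 \<Rightarrow> omega1" where "a + b = ord_add a b"
definition times_omega1 :: "omega1 \<Rightarrow> omega1 \<Rightarrow> omega1" where "a * b = ord_mult a b"

instance ..

end

definition omega :: omega1
  where "omega = (LEAST x. limit_ord x)"

definition ht :: "omega1 \<Rightarrow> omega1"
  where "ht \<gamma> = (THE \<alpha>. omega * \<alpha> \<le> \<gamma> \<and> \<gamma> < omega * (\<alpha> + 1))"

text \<open>A tree is a pair of its underlying set and its strict order.\<close>

type_synonym ftree = "omega1 set \<times> omega1 rel"
type_synonym pfun = "omega1 \<rightharpoonup> omega1"

definition standard_finite_tree :: "ftree \<Rightarrow> bool"
  where "standard_finite_tree = (\<lambda>(T, lt).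
    finite T \<and> T \<subseteq> {0} \<union> {x. omega \<le> x} \<and> 0 \<in> T \<and>
    lt \<subseteq> T \<times> T \<and> irrefl lt \<and> trans lt \<and>
    (\<forall>x\<in>T. total_on {y. (y, x) \<in> lt} lt) \<and>
    (\<forall>x y. (x, y) \<in> lt \<longrightarrow> ht x < ht y) \<and>
    (\<forall>x\<in>T. \<forall>\<alpha>\<in>ht ` T. \<alpha> < ht x \<longrightarrow> (\<exists>y. (y, x) \<in> lt \<and> ht y = \<alpha>)))"

definition heights :: "ftree \<Rightarrow> omega1 set"
  where "heights T = ht ` fst T - {0}"

definition level :: "ftree \<Rightarrow> omega1 \<Rightarrow> omega1 set"
  where "level T \<alpha> = {x \<in> fst T. ht x = \<alpha>}"

definition tree_restrict :: "ftree \<Rightarrow> omega1 \<Rightarrow> omega1 \<Rightarrow> omega1"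
  where "tree_restrict T x \<beta> = (THE y. y \<in> level T \<beta> \<and> (y, x) \<in> snd T)"

definition tree_extends :: "ftree \<Rightarrow> ftree \<Rightarrow> bool"
  where "tree_extends U T \<longleftrightarrow> fst T \<subseteq> fst U \<and> snd T \<subseteq> snd U"

definition standard_function :: "ftree \<Rightarrow> pfun \<Rightarrow> bool"
  where "standard_function T f \<longleftrightarrow>
    dom f \<subseteq> fst T \<and> ran f \<subseteq> fst T \<and>
    inj_on f (dom f) \<and>
    (\<forall>x\<in>dom f. \<forall>y\<in>dom f. (x, y) \<in> snd T \<longrightarrow> (the (f x), the (f y)) \<in> snd T) \<and>
    (\<forall>x\<in>dom f. ht (the (f x)) = ht x) \<and>
    (\<forall>x\<in>dom f. \<forall>\<beta>\<in>heights T. \<beta> < ht x \<longrightarrow> tree_restrict T x \<beta> \<in> dom f) \<and>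
    (\<forall>x\<in>dom f - {0}. the (f x) \<noteq> x)"

definition pfun_inverse :: "pfun \<Rightarrow> pfun"
  where "pfun_inverse f = (\<lambda>y. if y \<in> ran f then Some (THE x. f x = Some y) else None)"

text \<open>Only the exponents \<open>1\<close> and \<open>-1\<close> are ever used.\<close>

definition pfun_pow :: "pfun \<Rightarrow> int \<Rightarrow> pfun"
  where "pfun_pow f m = (if m = 1 then f else pfun_inverse f)"

text \<open>A family \<open>{f\<^sub>\<xi> : \<xi> \<in> A}\<close> is a partial map \<open>F\<close> with \<open>dom F = A\<close> and \<open>F \<xi> = Some f\<^sub>\<xi>\<close>.\<close>

definition rho_separated_tuple ::
    "(omega2 \<Rightarrow> omega2 \<Rightarrow> omega1) \<Rightarrow> (omega2 \<rightharpoonup> pfun) \<Rightarrow> omega1 \<Rightarrow> omega1 list \<Rightarrow> bool"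
  where "rho_separated_tuple \<rho> F \<alpha> a \<longleftrightarrow>
    (\<forall>i<length a. \<forall>j0 j1 m0 m1 \<tau>0 \<tau>1.
      (j0, m0, \<tau>0) \<noteq> (j1, m1, \<tau>1) \<and>
      j0 < i \<and> m0 \<in> {-1, 1} \<and> \<tau>0 \<in> dom F \<and> pfun_pow (the (F \<tau>0)) m0 (a ! i) = Some (a ! j0) \<and>
      j1 < i \<and> m1 \<in> {-1, 1} \<and> \<tau>1 \<in> dom F \<and> pfun_pow (the (F \<tau>1)) m1 (a ! i) = Some (a ! j1)
      \<longrightarrow> j0 = j1 \<and> \<alpha> \<le> \<rho> \<tau>0 \<tau>1)"

definition rho_separated ::
    "(omega2 \<Rightarrow> omega2 \<Rightarrow> omega1) \<Rightarrow> (omega2 \<rightharpoonup> pfun) \<Rightarrow> omega1 \<Rightarrow> omega1 set \<Rightarrow> bool"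
  where "rho_separated \<rho> F \<alpha> X \<longleftrightarrow>
    (\<exists>a. distinct a \<and> set a = X \<and> rho_separated_tuple \<rho> F \<alpha> a)"

definition rho_function :: "(omega2 \<Rightarrow> omega2 \<Rightarrow> omega1) \<Rightarrow> bool"
  where "rho_function \<rho> \<longleftrightarrow>
    (\<forall>\<alpha>. \<rho> \<alpha> \<alpha> = 0) \<and> (\<forall>\<alpha> \<beta>. \<rho> \<alpha> \<beta> = \<rho> \<beta> \<alpha>) \<and>
    (\<forall>\<F>. uncountable \<F> \<and> (\<forall>x\<in>\<F>. finite x) \<longrightarrow>
      (\<forall>\<mu>. \<exists>\<F>'\<subseteq>\<F>. uncountable \<F>' \<and>
        (\<forall>x\<in>\<F>'. \<forall>y\<in>\<F>'. x \<noteq> y \<longrightarrow>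
          (\<forall>\<tau>\<in>x - y. \<forall>\<zeta>\<in>y - x. \<forall>\<gamma>\<in>x \<inter> y.
            \<rho> \<tau> \<zeta> \<ge> max (min (\<rho> \<tau> \<gamma>) (\<rho> \<zeta> \<gamma>)) \<mu>))))"

text \<open>Jensen's principle: a coherent sequence \<open>\<langle>C\<^sub>\<alpha> : \<alpha> < \<omega>\<^sub>2 limit\<rangle>\<close> of closed unbounded sets
  \<open>C\<^sub>\<alpha> \<subseteq> \<alpha>\<close> of order type at most \<open>\<omega>\<^sub>1\<close>.\<close>

definition limit_point :: "'a::wellorder set \<Rightarrow> 'a \<Rightarrow> bool"
  where "limit_point C \<beta> \<longleftrightarrow> (\<exists>\<gamma>. \<gamma> < \<beta>) \<and> (\<forall>\<gamma><\<beta>. \<exists>\<delta>\<in>C. \<gamma> < \<delta> \<and> \<delta> < \<beta>)"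

definition club_in :: "'a::wellorder set \<Rightarrow> 'a \<Rightarrow> bool"
  where "club_in C \<alpha> \<longleftrightarrow> C \<subseteq> {..<\<alpha>} \<and> (\<forall>\<gamma><\<alpha>. \<exists>\<delta>\<in>C. \<gamma> \<le> \<delta>) \<and>
    (\<forall>\<beta><\<alpha>. limit_point C \<beta> \<longrightarrow> \<beta> \<in> C)"

definition square_omega1 :: bool
  where "square_omega1 \<longleftrightarrow> (\<exists>C :: omega2 \<Rightarrow> omega2 set. \<forall>\<alpha>. limit_ord \<alpha> \<longrightarrow>
    club_in (C \<alpha>) \<alpha> \<and>
    (le_rel_on (C \<alpha>), le_rel_on (UNIV :: omega1 set)) \<in> ordLeq \<and>
    (\<forall>\<beta><\<alpha>. limit_point (C \<alpha>) \<beta> \<longrightarrow> C \<beta> = C \<alpha> \<inter> {..<\<beta>}))"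

type_synonym condition = "ftree \<times> (omega2 \<rightharpoonup> pfun)"

definition forcing_P :: "(omega2 \<Rightarrow> omega2 \<Rightarrow> omega1) \<Rightarrow> condition set"
  where "forcing_P \<rho> = {(T, F).
    standard_finite_tree T \<and> finite (dom F) \<and>
    (\<forall>\<gamma>\<in>dom F. standard_function T (the (F \<gamma>))) \<and>
    (\<forall>\<alpha>\<in>heights T. rho_separated \<rho> F \<alpha> (level T \<alpha>))}"

text \<open>In the last clause an equation between values of partial functions asserts that both
  sides are defined.\<close>

definition stronger :: "condition \<Rightarrow> condition \<Rightarrow> bool"
  where "stronger = (\<lambda>(U, G) (T, F).
    tree_extends U T \<and>
    dom F \<subseteq> dom G \<and> (\<forall>\<gamma>\<in>dom F. the (F \<gamma>) \<subseteq>\<^sub>m the (G \<gamma>)) \<and>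
    (\<forall>\<gamma>\<in>dom F. \<forall>\<tau>\<in>dom F. \<gamma> \<noteq> \<tau> \<longrightarrow>
      (\<forall>x\<in>dom (the (G \<gamma>)) \<inter> dom (the (G \<tau>)). the (G \<gamma>) x = the (G \<tau>) x \<longrightarrow>
        (\<exists>z\<in>fst T. (x = z \<or> (x, z) \<in> snd U) \<and>
          z \<in> dom (the (F \<gamma>)) \<inter> dom (the (F \<tau>)) \<and> the (F \<gamma>) z = the (F \<tau>) z))))"

end

theory Submission
  imports Defs "HOL-Library.Countable_Set_Type"
begin

text \<open>
  Thin out so that the sets of heights and the domains of the \<open>F\<^sup>\<alpha>\<close> form \<open>\<Delta>\<close>-systems, the parts of
  the trees below the first non-root height agree, and the first non-root levels, with the
  functions indexed by the root \<open>A\<close> of the domains, are isomorphic. For \<open>\<alpha> < \<beta>\<close> write \<open>(T, F)\<close> and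
  \<open>(U, G)\<close> for the two conditions, \<open>p\<close> and \<open>q\<close> for their first non-root heights, and let \<open>B\<close> be the
  level of \<open>U\<close> at height \<open>q\<close>. All heights of \<open>T\<close> lie below \<open>q\<close>, so every \<open>b \<in> B\<close> has to be placed on
  top of a branch \<open>h \<mapsto> c h b\<close> through the non-root levels of \<open>T\<close>, along which the functions of \<open>G\<close>
  are copied. The branch of the node \<open>b0 \<in> B\<close> below \<open>x\<^sup>\<beta>\<close> must pass through \<open>x\<^sup>\<alpha>\<close>; this forces
  \<open>c h b \<in> T\<close> for those \<open>b\<close> that can be reached from \<open>b0\<close> along arrows in \<open>A\<close> which are also
  present in \<open>T\<close> at height \<open>h\<close>, and all other \<open>c h b\<close> are new nodes.

  A level is \<open>\<rho>\<close>-separated iff its graph of arrows is a forest in which parallel arrows have large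
  \<open>\<rho>\<close>-distance. Above the root, arrows labelled in \<open>A\<close> are never parallel, so a level of the
  amalgam is obtained by gluing two forests along a common subtree and is again a forest. New
  parallel arrows with labels \<open>\<tau>\<close> and \<open>\<zeta>\<close> on either side of \<open>A\<close> are parallel to a common arrow in \<open>A\<close>,
  and the special property of \<open>\<rho>\<close> bounds \<open>\<rho> \<tau> \<zeta>\<close> from below.
\<close>

section \<open>Heights of countable ordinals\<close>

lemma countable_atMost_omega1: "countable {..a::omega1}"
proof -
  let ?r = "cardSuc natLeq"
  have lt: "(card_of (underS ?r (Rep_omega1 a)), ?r) \<in> ordLess"
    by (rule card_of_underS[OF Card_order_omega1 Rep_omega1])
  have "(card_of (underS ?r (Rep_omega1 a)), natLeq) \<in> ordLeq"
    using lt cardSuc_ordLess_ordLeq[OF natLeq_Card_order card_of_Card_order]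
    by (metis cardSuc_ordLeq_ordLess card_of_Card_order natLeq_Card_order)
  then have c: "countable (underS ?r (Rep_omega1 a))"
    by (simp add: countable_card_le_natLeq)
  have "Rep_omega1 ` {..<a} \<subseteq> underS ?r (Rep_omega1 a)"
    by (auto simp: underS_def less_omega1_def less_eq_omega1_def)
  then have "countable (Rep_omega1 ` {..<a})"
    using c countable_subset by blast
  then have "countable {..<a}"
    by (rule countable_image_inj_on) (simp add: inj_on_def Rep_omega1_inject)
  then have "countable (insert a {..<a})" by simp
  then show ?thesis by (rule countable_subset[rotated]) auto
qed

lemma countable_lessThan_omega1: "countable {..<a::omega1}"
  using countable_atMost_omega1[of a] by (rule countable_subset[rotated]) auto

lemma uncountable_UNIV_omega1: "uncountable (UNIV :: omega1 set)"
proof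
  assume "countable (UNIV :: omega1 set)"
  then have "countable (range Rep_omega1)" by simp
  then have "countable (Field (cardSuc natLeq))"
    using type_definition.Rep_range[OF type_definition_omega1] by simp
  then have "(card_of (Field (cardSuc natLeq)), natLeq) \<in> ordLeq"
    by (simp add: countable_card_le_natLeq)
  then have "(cardSuc natLeq, natLeq :: nat rel) \<in> ordLeq"
    using card_of_Field_ordIso[OF Card_order_omega1] ordIso_ordLeq_trans ordIso_symmetric by blast
  then show False
    using cardSuc_greater[OF natLeq_Card_order] not_ordLess_ordLeq by blast
qed

text \<open>Regularity of the first uncountable cardinal: the initial segments up to the elements of
  \<open>S\<close> have a countable union, so some \<open>b\<close> lies outside all of
  them.\<close>

lemma countable_bounded_omega1:
  assumes "countable (S :: omega1 set)"
  shows "\<exists>b. \<forall>s\<in>S. s < b"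
proof -
  have "countable (\<Union>s\<in>S. {..s})" using assms countable_atMost_omega1 by blast
  then obtain b where "b \<notin> (\<Union>s\<in>S. {..s})"
    using uncountable_UNIV_omega1 by (metis UNIV_eq_I)
  then show ?thesis by (intro exI[of _ b]) (auto simp: not_le)
qed

section \<open>Ordinal arithmetic in \<open>omega1\<close>\<close>

lemma zero_le_omega1 [simp]: "(0 :: omega1) \<le> x"
  unfolding zero_omega1_def by (rule Least_le) simp

lemma not_less_zero_omega1 [simp]: "\<not> x < (0 :: omega1)"
  by (simp add: not_less)

lemma ord_add_bounds:
  shows "a \<le> ord_add a b" and "b' < b \<Longrightarrow> ord_add a b' < ord_add a b"
proof -
  have "countable {..<b}"
    by (rule countable_lessThan_omega1)
  then have "countable (insert a (ord_add a ` {..<b}))" by simp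
  then obtain c where "\<forall>s\<in>insert a (ord_add a ` {..<b}). s < c"
    using countable_bounded_omega1 by blast
  then have "a \<le> c \<and> (\<forall>b'. b' < b \<longrightarrow> ord_add a b' < c)" by auto
  then have "a \<le> (LEAST c. a \<le> c \<and> (\<forall>b'. b' < b \<longrightarrow> ord_add a b' < c)) \<and>
      (\<forall>b'. b' < b \<longrightarrow> ord_add a b' < (LEAST c. a \<le> c \<and> (\<forall>b'. b' < b \<longrightarrow> ord_add a b' < c)))"
    by (rule LeastI)
  then show "a \<le> ord_add a b" "b' < b \<Longrightarrow> ord_add a b' < ord_add a b"
    unfolding ord_add.simps[of a b] by blast+
qed

lemma ord_add_zero_right [simp]: "ord_add a 0 = a"
  unfolding ord_add.simps[of a 0] by (rule Least_equality) auto

lemma ord_add_zero_left [simp]: "ord_add 0 b = b"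
proof (induction b rule: less_induct)
  case (less b)
  have "(LEAST c. 0 \<le> c \<and> (\<forall>b'. b' < b \<longrightarrow> ord_add 0 b' < c)) = b"
  proof (rule Least_equality)
    show "0 \<le> b \<and> (\<forall>b'. b' < b \<longrightarrow> ord_add 0 b' < b)" using less by simp
    show "b \<le> c" if "0 \<le> c \<and> (\<forall>b'. b' < b \<longrightarrow> ord_add 0 b' < c)" for c
      using that less[of c] by (metis less_irrefl not_le)
  qed
  then show ?case by (subst ord_add.simps)
qed

lemma less_one_omega1: "b < (1 :: omega1) \<longleftrightarrow> b = 0"
proof -
  obtain c where "\<forall>s\<in>{0}. s < (c :: omega1)"
    using countable_bounded_omega1[of "{0}"] by auto
  then have "0 < c" by simp
  then have "(0 :: omega1) < (LEAST x. 0 < x)" by (rule LeastI)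
  then have "(0 :: omega1) < 1" by (simp add: one_omega1_def)
  moreover have "(1 :: omega1) \<le> b" if "0 < b"
    unfolding one_omega1_def using that by (rule Least_le)
  ultimately show ?thesis
    by (metis leD order.not_eq_order_implies_strict zero_le_omega1)
qed

lemma less_succ_omega1: "b < a + 1 \<longleftrightarrow> b \<le> (a :: omega1)"
proof -
  have lt: "a < a + 1"
    using ord_add_bounds(2)[of 0 1 a] by (simp add: less_one_omega1 plus_omega1_def)
  have "a + 1 \<le> c" if "a < c" for c
    unfolding plus_omega1_def ord_add.simps[of a 1]
    by (rule Least_le) (use that in \<open>auto simp: less_one_omega1\<close>)
  then show ?thesis using lt by (metis leD le_less_trans not_le)
qed

lemma omega_limit: "limit_ord omega"
proof -
  define f :: "nat \<Rightarrow> omega1" where "f n = ((\<lambda>a. a + 1) ^^ n) 0" for n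
  have fS: "f n < f (Suc n)" for n by (simp add: f_def less_succ_omega1)
  obtain c where c: "\<forall>s\<in>range f. s < c"
    using countable_bounded_omega1[of "range f"] by auto
  define d where "d = (LEAST c. \<forall>s\<in>range f. s < c)"
  have d: "\<forall>s\<in>range f. s < d" unfolding d_def using c by (rule LeastI)
  have "\<exists>e>b. e < d" if "b < d" for b
  proof -
    have "\<not> (\<forall>s\<in>range f. s < b)" using that not_less_Least d_def by blast
    then obtain n where "b \<le> f n" by (auto simp: not_less)
    then have "b < f (Suc n)" using fS[of n] by simp
    then show ?thesis using d by blast
  qed
  then have "limit_ord d" using d by (auto simp: limit_ord_def)
  then show ?thesis unfolding omega_def by (rule LeastI)
qed

lemma infinite_below_omega: "infinite {..<omega}"
proof
  assume fin: "finite {..<omega}"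
  have ne: "{..<omega} \<noteq> {}" using omega_limit by (auto simp: limit_ord_def)
  have "Max {..<omega} < omega" using Max_in[OF fin ne] by simp
  then obtain c where "Max {..<omega} < c" "c < omega"
    using omega_limit by (auto simp: limit_ord_def)
  then show False using Max_ge[OF fin, of c] by simp
qed

lemma omega_pos: "0 < omega"
  using omega_limit by (metis limit_ord_def le_less_trans zero_le_omega1)

lemma ord_mult_less:
  assumes "b' < b" "x < a"
  shows "ord_add (ord_mult a b') x < ord_mult a b"
proof -
  have c: "countable {..<b}" "countable {..<a}"
    by (simp_all add: countable_lessThan_omega1)
  have "countable ((\<lambda>(b', x). ord_add (ord_mult a b') x) ` ({..<b} \<times> {..<a}))"
    using c by simp
  then obtain c where "\<forall>s\<in>(\<lambda>(b', x). ord_add (ord_mult a b') x) ` ({..<b} \<times> {..<a}). s < c"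
    using countable_bounded_omega1 by blast
  then have "\<forall>b'. b' < b \<longrightarrow> (\<forall>x<a. ord_add (ord_mult a b') x < c)" by auto
  then have "\<forall>b'. b' < b \<longrightarrow> (\<forall>x<a. ord_add (ord_mult a b') x <
      (LEAST c. \<forall>b'. b' < b \<longrightarrow> (\<forall>x<a. ord_add (ord_mult a b') x < c)))"
    by (rule LeastI)
  then show ?thesis unfolding ord_mult.simps[of a b] using assms by blast
qed

lemma less_ord_mult_obtains:
  assumes "c < ord_mult a b"
  obtains b' x where "b' < b" "x < a" "c \<le> ord_add (ord_mult a b') x"
  using assms that not_less_Least[of c "\<lambda>c. \<forall>b'. b' < b \<longrightarrow> (\<forall>x<a. ord_add (ord_mult a b') x < c)"]
  unfolding ord_mult.simps[of a b] by (meson not_less)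

lemma omega_times_strict_mono: "b < b' \<Longrightarrow> omega * b < omega * b'"
  using ord_mult_less[OF _ omega_pos, of b b'] by (simp add: times_omega1_def)

lemma omega_times_mono: "b \<le> b' \<Longrightarrow> omega * b \<le> omega * b'"
  using omega_times_strict_mono by (metis less_imp_le order.order_iff_strict)

lemma le_omega_times: "b \<le> omega * b"
proof (induction b rule: less_induct)
  case (less b)
  show ?case
  proof (rule ccontr)
    assume "\<not> b \<le> omega * b"
    then have "omega * b < b" by simp
    then show False using less[of "omega * b"] omega_times_strict_mono[of "omega * b" b] by simp
  qed
qed

text \<open>Division by \<open>omega\<close>: let \<open>d\<close> be least with
  \<open>\<gamma> < omega * d\<close>. The recursion for the product yields some
  \<open>b < d\<close> with \<gamma> below \<open>omega * (b + 1)\<close>, and minimality of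
  \<open>d\<close> gives \<open>omega * b \<le> \<gamma>\<close>.\<close>

lemma ht_bounds: "omega * ht \<gamma> \<le> \<gamma>" "\<gamma> < omega * (ht \<gamma> + 1)"
  and ht_unique: "omega * \<alpha> \<le> \<gamma> \<Longrightarrow> \<gamma> < omega * (\<alpha> + 1) \<Longrightarrow> ht \<gamma> = \<alpha>"
proof -
  have uniq: "\<alpha> = \<alpha>'" if "omega * \<alpha> \<le> \<gamma>" "\<gamma> < omega * (\<alpha> + 1)"
    "omega * \<alpha>' \<le> \<gamma>" "\<gamma> < omega * (\<alpha>' + 1)" for \<alpha> \<alpha>'
  proof (rule ccontr)
    have aux: False if "a < a'" "\<gamma> < omega * (a + 1)" "omega * a' \<le> \<gamma>" for a a'
    proof -
      have "a + 1 \<le> a'" using that(1) by (metis less_succ_omega1 not_le)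
      then have "omega * (a + 1) \<le> omega * a'" by (rule omega_times_mono)
      then show False using that by simp
    qed
    assume "\<alpha> \<noteq> \<alpha>'"
    then show False using aux that by (meson neqE)
  qed
  define d where "d = (LEAST d. \<gamma> < omega * d)"
  have "\<gamma> < omega * (\<gamma> + 1)"
    using le_omega_times[of "\<gamma> + 1"] less_succ_omega1[of \<gamma> \<gamma>] by simp
  then have d: "\<gamma> < omega * d" unfolding d_def by (rule LeastI)
  then obtain b x where b: "b < d" "x < omega" "\<gamma> \<le> ord_add (ord_mult omega b) x"
    unfolding times_omega1_def by (rule less_ord_mult_obtains)
  have "omega * b \<le> \<gamma>" using b(1) not_less_Least d_def by (metis not_less)
  moreover have "ord_add (ord_mult omega b) x < omega * (b + 1)"
    unfolding times_omega1_def by (rule ord_mult_less) (use b less_succ_omega1 in auto)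
  ultimately have ex: "omega * b \<le> \<gamma> \<and> \<gamma> < omega * (b + 1)" using b(3) by simp
  have "omega * ht \<gamma> \<le> \<gamma> \<and> \<gamma> < omega * (ht \<gamma> + 1)"
    unfolding ht_def by (rule theI[of _ b]) (use ex uniq in blast)+
  then show "omega * ht \<gamma> \<le> \<gamma>" "\<gamma> < omega * (ht \<gamma> + 1)" by auto
  then show "omega * \<alpha> \<le> \<gamma> \<Longrightarrow> \<gamma> < omega * (\<alpha> + 1) \<Longrightarrow> ht \<gamma> = \<alpha>"
    using uniq by blast
qed

text \<open>Serves the thinning twice: only countably many root parts of trees are possible, and all
  but countably many \<open>x \<alpha>\<close> have a height outside a given finite set.\<close>

lemma countable_ht_vimage:
  assumes "countable S"
  shows "countable {\<gamma>. ht \<gamma> \<in> S}"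
proof -
  have "countable (\<Union>\<alpha>\<in>S. {..omega * (\<alpha> + 1)})" using assms countable_atMost_omega1 by blast
  moreover have "{\<gamma>. ht \<gamma> \<in> S} \<subseteq> (\<Union>\<alpha>\<in>S. {..omega * (\<alpha> + 1)})"
    using ht_bounds(2) by (auto intro: less_imp_le)
  ultimately show ?thesis by (rule countable_subset[rotated])
qed

text \<open>Source of the new nodes of the amalgam: the sums of \<open>omega * \<alpha>\<close> with
  the ordinals below \<open>omega\<close> are distinct and all have height \<alpha>.\<close>

lemma infinite_ht_fibre: "infinite {\<gamma>. ht \<gamma> = \<alpha>}"
proof -
  let ?f = "\<lambda>x. ord_add (ord_mult omega \<alpha>) x"
  have "inj_on ?f {..<omega}" using ord_add_bounds(2) by (metis inj_onI less_irrefl neqE)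
  then have "infinite (?f ` {..<omega})" using infinite_below_omega finite_imageD by blast
  moreover have "?f ` {..<omega} \<subseteq> {\<gamma>. ht \<gamma> = \<alpha>}"
  proof clarsimp
    fix x assume "x < omega"
    then show "ht (?f x) = \<alpha>"
      using ord_mult_less[of \<alpha> "\<alpha> + 1" x omega] ord_add_bounds(1) less_succ_omega1[of \<alpha> \<alpha>]
      by (intro ht_unique) (auto simp: times_omega1_def)
  qed
  ultimately show ?thesis using finite_subset by blast
qed

lemma ht_eq_zero_iff: "ht \<gamma> = 0 \<longleftrightarrow> \<gamma> < omega"
proof -
  have m0: "ord_mult omega 0 = 0"
    unfolding ord_mult.simps[of omega 0] by (rule Least_equality) auto
  show ?thesis
  proof
    assume "ht \<gamma> = 0"
    then have "\<gamma> < ord_mult omega (0 + 1)" using ht_bounds(2)[of \<gamma>] by (simp add: times_omega1_def)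
    then obtain b x where "b < 0 + 1" "x < omega" "\<gamma> \<le> ord_add (ord_mult omega b) x"
      by (rule less_ord_mult_obtains)
    moreover from this(1) have "b = 0" by (metis less_succ_omega1 antisym zero_le_omega1)
    ultimately show "\<gamma> < omega" by (simp add: m0)
  next
    assume "\<gamma> < omega"
    then have "ord_add (ord_mult omega 0) \<gamma> < ord_mult omega (0 + 1)"
      by (intro ord_mult_less) (auto simp: less_succ_omega1)
    then show "ht \<gamma> = 0" by (intro ht_unique) (auto simp: times_omega1_def m0)
  qed
qed

section \<open>Labelled forests\<close>

text \<open>Graph form of rho-separation at one entry \<open>a\<close> of an enumeration:
  \<open>X\<close> stands for the entries before \<open>a\<close>, a label is an index together with
  a direction, and \<open>C\<close> will say that two indices have large rho-distance. In
  \<open>forest_order\<close> an injective numbering replaces the enumeration, which is easier to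
  rearrange.\<close>

definition forest_vertex ::
    "('c \<times> bool \<Rightarrow> 'v \<Rightarrow> 'v \<Rightarrow> bool) \<Rightarrow> ('c \<Rightarrow> 'c \<Rightarrow> bool) \<Rightarrow> 'v \<Rightarrow> 'v set \<Rightarrow> bool"
  where "forest_vertex E C a X \<longleftrightarrow> (\<forall>u\<in>X. \<forall>v\<in>X. \<forall>l l'. E l a u \<longrightarrow> E l' a v \<longrightarrow>
    (u, l) \<noteq> (v, l') \<longrightarrow> u = v \<and> C (fst l) (fst l'))"

definition forest_order ::
    "('c \<times> bool \<Rightarrow> 'v \<Rightarrow> 'v \<Rightarrow> bool) \<Rightarrow> ('c \<Rightarrow> 'c \<Rightarrow> bool) \<Rightarrow> ('v \<Rightarrow> nat) \<Rightarrow> 'v set \<Rightarrow> bool"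
  where "forest_order E C pos X \<longleftrightarrow> inj_on pos X \<and>
    (\<forall>a\<in>X. forest_vertex E C a {u \<in> X. pos u < pos a})"

lemma forest_vertexD:
  assumes "forest_vertex E C a X" "u \<in> X" "v \<in> X" "E l a u" "E l' a v"
  shows "u = v" and "l \<noteq> l' \<Longrightarrow> C (fst l) (fst l')"
  using assms unfolding forest_vertex_def by blast+

lemma forest_orderD:
  assumes "forest_order E C pos X" "a \<in> X" "u \<in> X" "v \<in> X"
    "pos u < pos a" "pos v < pos a" "E l a u" "E l' a v"
  shows "u = v" and "l \<noteq> l' \<Longrightarrow> C (fst l) (fst l')"
proof -
  have "forest_vertex E C a {u \<in> X. pos u < pos a}"
    using assms(1,2) by (simp add: forest_order_def)
  then show "u = v" "l \<noteq> l' \<Longrightarrow> C (fst l) (fst l')"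
    using forest_vertexD[of E C a _ u v l l'] assms by blast+
qed

lemma forest_order_parallel:
  assumes ord: "forest_order E C pos X"
    and sym: "\<And>\<tau> s u v. E (\<tau>, s) u v \<Longrightarrow> E (\<tau>, \<not> s) v u"
    and uv: "u \<in> X" "v \<in> X" "u \<noteq> v" "E l u v" "E l' u v" "l \<noteq> l'"
  shows "C (fst l) (fst l')"
proof (cases "pos v < pos u")
  case True
  then show ?thesis using forest_orderD(2)[OF ord, of u v v l l'] uv by blast
next
  case False
  have "pos u \<noteq> pos v" using ord uv(1-3) by (auto simp: forest_order_def inj_on_def)
  then have "pos u < pos v" using False by simp
  moreover have "E (fst l, \<not> snd l) v u" "E (fst l', \<not> snd l') v u"
    using sym[of "fst l" "snd l"] sym[of "fst l'" "snd l'"] uv by auto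
  moreover have "(fst l, \<not> snd l) \<noteq> (fst l', \<not> snd l')" using uv(6) by (auto simp: prod_eq_iff)
  ultimately show ?thesis
    using forest_orderD(2)[OF ord, of v u u "(fst l, \<not> snd l)" "(fst l', \<not> snd l')"] uv by auto
qed

text \<open>A forest can be rooted at any of its vertices. The induction removes the last vertex
  \<open>a\<close>, which is a leaf. If \<open>b\<close> is another vertex, the rest is rooted at
  \<open>b\<close> and \<open>a\<close> stays last; if \<open>b = a\<close>, the rest is rooted at
  the neighbour of \<open>a\<close> and \<open>a\<close> comes first.\<close>

lemma forest_order_reroot:
  assumes fin: "finite X"
    and sym: "\<And>\<tau> s u v. E (\<tau>, s) u v \<Longrightarrow> E (\<tau>, \<not> s) v u"
    and ord: "forest_order E C pos X" and b: "b \<in> X"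
  shows "\<exists>pos'. forest_order E C pos' X \<and> (\<forall>a\<in>X. pos' b \<le> pos' a)"
  using fin ord b
proof (induction "card X" arbitrary: X b)
  case 0
  then show ?case by simp
next
  case (Suc n)
  have "finite (pos ` X)" "pos ` X \<noteq> {}" using Suc.prems by auto
  then have "Max (pos ` X) \<in> pos ` X" by (rule Max_in)
  then obtain a where "a \<in> X" "pos a = Max (pos ` X)" by auto
  then have a: "a \<in> X" "\<And>u. u \<in> X \<Longrightarrow> pos u \<le> pos a"
    using \<open>finite (pos ` X)\<close> by auto
  define Y where "Y = X - {a}"
  have X: "X = insert a Y" "a \<notin> Y" "finite Y" "card Y = n"
    using a(1) Suc.prems(1) Suc.hyps(2) by (auto simp: Y_def)
  have inj: "inj_on pos X" using Suc.prems(2) by (simp add: forest_order_def)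
  have lt: "pos u < pos a" if "u \<in> Y" for u
    using that a(1) a(2)[of u] inj_onD[OF inj, of u a] X(2) unfolding X(1)
    by (metis insertCI order_neq_le_trans)
  have ordY: "forest_order E C pos Y"
  proof -
    have "{u \<in> X. pos u < pos v} = {u \<in> Y. pos u < pos v}" if "v \<in> Y" for v
      using lt[OF that] X by auto
    then show ?thesis using Suc.prems(2) X inj
      by (auto simp: forest_order_def intro: inj_on_subset)
  qed
  have fa: "forest_vertex E C a Y"
  proof -
    have "{u \<in> X. pos u < pos a} = Y" using lt X by auto
    then show ?thesis using Suc.prems(2) a by (metis forest_order_def)
  qed
  show ?case
  proof (cases "b = a")
    case False
    then have "b \<in> Y" using Suc.prems(3) X by auto
    then obtain pos' where pos': "forest_order E C pos' Y" "\<forall>a\<in>Y. pos' b \<le> pos' a"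
      using Suc.hyps(1)[of Y b] X ordY by auto
    obtain N where N: "\<And>u. u \<in> Y \<Longrightarrow> pos' u < N"
      using finite_nat_set_iff_bounded[of "pos' ` Y"] X(3) by auto
    define pos'' where "pos'' = pos'(a := N)"
    have p: "pos'' a = N" "\<And>u. u \<in> Y \<Longrightarrow> pos'' u = pos' u" using X by (auto simp: pos''_def)
    have "{u \<in> X. pos'' u < pos'' v} = {u \<in> Y. pos' u < pos' v}" if "v \<in> Y" for v
      using p N[OF that] that X(1,2) by auto
    moreover have "{u \<in> X. pos'' u < pos'' a} = Y" using p N X by auto
    moreover have "inj_on pos'' X"
    proof -
      have "inj_on pos'' Y" using pos'(1) p(2) by (simp add: forest_order_def inj_on_def)
      moreover have "pos'' a \<notin> pos'' ` Y" using p N by (metis imageE less_irrefl)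
      ultimately show ?thesis using X(1,2) by simp
    qed
    ultimately have "forest_order E C pos'' X"
      using pos'(1) fa X(1) by (simp add: forest_order_def)
    moreover have "\<forall>v\<in>X. pos'' b \<le> pos'' v"
      using pos'(2) p N X \<open>b \<in> Y\<close> by (auto intro: less_imp_le)
    ultimately show ?thesis by blast
  next
    case True
    \<comment> \<open>Putting \<open>a\<close> first gives a new earlier neighbour only to the
      neighbour of \<open>a\<close> in \<open>Y\<close>, which is unique. Making that vertex the
      first of \<open>Y\<close> leaves it no other earlier one; if \<open>a\<close> is isolated, the
      old order of \<open>Y\<close> serves.\<close>
    have "\<exists>pos'. forest_order E C pos' Y \<and>
        (\<forall>v\<in>Y. (\<exists>l. E l a v) \<longrightarrow> (\<forall>u\<in>Y. pos' v \<le> pos' u))"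
    proof (cases "\<exists>p\<in>Y. \<exists>l. E l a p")
      case True
      then obtain p l where p: "p \<in> Y" "E l a p" by blast
      then obtain pos' where "forest_order E C pos' Y" "\<forall>u\<in>Y. pos' p \<le> pos' u"
        using Suc.hyps(1)[of Y p] X ordY by auto
      then show ?thesis using forest_vertexD(1)[OF fa _ _ p(2)] p(1) by blast
    qed (use ordY in blast)
    then obtain pos' where pos': "forest_order E C pos' Y"
      "\<And>v u l. v \<in> Y \<Longrightarrow> E l a v \<Longrightarrow> u \<in> Y \<Longrightarrow> pos' v \<le> pos' u" by blast
    define pos'' where "pos'' = (\<lambda>v. if v = a then 0 else Suc (pos' v))"
    have p: "pos'' a = 0" "\<And>u. u \<in> Y \<Longrightarrow> pos'' u = Suc (pos' u)"
      using X by (auto simp: pos''_def)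
    have earlier: "{u \<in> X. pos'' u < pos'' v} = insert a {u \<in> Y. pos' u < pos' v}" if "v \<in> Y" for v
      using p that X by auto
    have sym': "E (fst l, \<not> snd l) v u" if "E l u v" for l u v
      using sym[of "fst l" "snd l"] that by simp
    have "forest_vertex E C v (insert a {u \<in> Y. pos' u < pos' v})" if v: "v \<in> Y" for v
    proof (cases "\<exists>l. E l a v")
      case True
      then have "{u \<in> Y. pos' u < pos' v} = {}" using pos'(2)[OF v] by (auto simp: not_less)
      moreover have "C (fst l) (fst l')" if "E l v a" "E l' v a" "l \<noteq> l'" for l l'
        using forest_vertexD(2)[OF fa v v sym'[OF that(1)] sym'[OF that(2)]] that(3)
        by (auto simp: prod_eq_iff)
      ultimately show ?thesis by (auto simp: forest_vertex_def)
    next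
      case False
      then have "\<not> E l v a" for l using sym' by blast
      moreover have "forest_vertex E C v {u \<in> Y. pos' u < pos' v}"
        using pos'(1) v by (simp add: forest_order_def)
      ultimately show ?thesis unfolding forest_vertex_def by blast
    qed
    moreover have "forest_vertex E C a {u \<in> X. pos'' u < pos'' a}"
      using p by (simp add: forest_vertex_def)
    moreover have "inj_on pos'' X"
    proof -
      have "inj_on pos'' Y" using pos'(1) p(2) by (simp add: forest_order_def inj_on_def)
      moreover have "pos'' a \<notin> pos'' ` Y" using p by (metis imageE nat.distinct(1))
      ultimately show ?thesis using X(1,2) by simp
    qed
    ultimately have "forest_order E C pos'' X"
      using X earlier by (auto simp: forest_order_def)
    then show ?thesis using True p(1) by auto
  qed
qed

text \<open>An edge of label \<open>(\<tau>, True)\<close> is an arrow of \<open>f\<^sub>\<tau>\<close>, one of label \<open>(\<tau>, False)\<close> an arrow of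
  its inverse.\<close>

definition edge :: "(omega2 \<rightharpoonup> pfun) \<Rightarrow> omega2 \<times> bool \<Rightarrow> omega1 \<Rightarrow> omega1 \<Rightarrow> bool"
  where "edge F l u v \<longleftrightarrow> fst l \<in> dom F \<and>
    (if snd l then the (F (fst l)) u = Some v else the (F (fst l)) v = Some u)"

lemma edge_flip: "edge F (\<tau>, s) u v \<Longrightarrow> edge F (\<tau>, \<not> s) v u"
  by (auto simp: edge_def)

lemma pfun_pow_eq_Some:
  assumes "inj_on f (dom f)" "m \<in> {-1, 1}"
  shows "pfun_pow f m a = Some b \<longleftrightarrow> (if m = 1 then f a = Some b else f b = Some a)"
proof -
  have inj: "x = x'" if "f x = Some y" "f x' = Some y" for x x' y
    using that assms(1) by (auto simp: inj_on_def dom_def)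
  then have uniq: "(THE x. f x = Some y) = x" if "f x = Some y" for x y
    using that by blast
  show ?thesis using assms(2)
    by (auto simp: pfun_pow_def pfun_inverse_def ran_def uniq dest: inj split: if_splits)
qed

text \<open>From an enumeration one takes the index as number; from a numbering one sorts by it.
  Injectivity of the functions identifies the exponent -1 with the reversed label.\<close>

lemma rho_separated_iff_forest_order:
  assumes inj: "\<And>\<tau>. \<tau> \<in> dom F \<Longrightarrow> inj_on (the (F \<tau>)) (dom (the (F \<tau>)))" and fin: "finite X"
  shows "rho_separated \<rho> F h X \<longleftrightarrow> (\<exists>pos. forest_order (edge F) (\<lambda>\<tau> \<zeta>. h \<le> \<rho> \<tau> \<zeta>) pos X)"
proof (intro iffI)
  have E: "edge F (\<tau>, s) u v \<longleftrightarrow> \<tau> \<in> dom F \<and> pfun_pow (the (F \<tau>)) (if s then 1 else -1) u = Some v"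
    for \<tau> s u v
    using pfun_pow_eq_Some[OF inj, of \<tau> "if s then 1 else -1" u v]
    by (cases "\<tau> \<in> dom F"; cases s) (simp_all add: edge_def)
  show "\<exists>pos. forest_order (edge F) (\<lambda>\<tau> \<zeta>. h \<le> \<rho> \<tau> \<zeta>) pos X" if "rho_separated \<rho> F h X"
  proof -
    from that obtain a where a: "distinct a" "set a = X" "rho_separated_tuple \<rho> F h a"
      by (auto simp: rho_separated_def)
    define pos where "pos = inv_into {..<length a} (nth a)"
    have pos: "pos (a ! i) = i" if "i < length a" for i
      using that a(1) unfolding pos_def by (intro inv_into_f_f) (auto simp: inj_on_nth)
    have "forest_vertex (edge F) (\<lambda>\<tau> \<zeta>. h \<le> \<rho> \<tau> \<zeta>) v {u \<in> X. pos u < pos v}" if v: "v \<in> X" for v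
      unfolding forest_vertex_def
    proof (intro ballI allI impI)
      fix u w l l'
      assume uw: "u \<in> {u \<in> X. pos u < pos v}" "w \<in> {u \<in> X. pos u < pos v}"
        and e: "edge F l v u" "edge F l' v w" and ne: "(u, l) \<noteq> (w, l')"
      obtain i j0 j1 where ij: "i < length a" "v = a ! i" "j0 < length a" "u = a ! j0"
        "j1 < length a" "w = a ! j1"
        using v uw a(2) by (auto simp: in_set_conv_nth)
      then have lt: "j0 < i" "j1 < i" using uw pos by auto
      define m0 m1 :: int where m: "m0 = (if snd l then 1 else -1)" "m1 = (if snd l' then 1 else -1)"
      have "j0 = j1 \<and> h \<le> \<rho> (fst l) (fst l')"
      proof (rule a(3)[unfolded rho_separated_tuple_def, rule_format, OF ij(1), of j0 m0 "fst l" j1 m1])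
        show "(j0, m0, fst l) \<noteq> (j1, m1, fst l') \<and> j0 < i \<and> m0 \<in> {- 1, 1} \<and> fst l \<in> dom F \<and>
          pfun_pow (the (F (fst l))) m0 (a ! i) = Some (a ! j0) \<and> j1 < i \<and> m1 \<in> {- 1, 1} \<and>
          fst l' \<in> dom F \<and> pfun_pow (the (F (fst l'))) m1 (a ! i) = Some (a ! j1)"
          using e ne lt ij E[of "fst l" "snd l"] E[of "fst l'" "snd l'"]
          by (cases l; cases l') (auto simp: m split: if_splits)
      qed
      then show "u = w \<and> h \<le> \<rho> (fst l) (fst l')" using ij by simp
    qed
    moreover have "inj_on pos X"
      using a(1,2) pos by (metis inj_onI in_set_conv_nth)
    ultimately show "\<exists>pos. forest_order (edge F) (\<lambda>\<tau> \<zeta>. h \<le> \<rho> \<tau> \<zeta>) pos X"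
      by (auto simp: forest_order_def)
  qed
  assume "\<exists>pos. forest_order (edge F) (\<lambda>\<tau> \<zeta>. h \<le> \<rho> \<tau> \<zeta>) pos X"
  then obtain pos where pos: "forest_order (edge F) (\<lambda>\<tau> \<zeta>. h \<le> \<rho> \<tau> \<zeta>) pos X" ..
  obtain xs where xs: "set xs = X" "distinct xs" using finite_distinct_list[OF fin] by blast
  define a where "a = sort_key pos xs"
  have a: "set a = X" "distinct a" "sorted (map pos a)"
    using xs by (auto simp: a_def)
  have lt: "pos (a ! j) < pos (a ! i)" if "j < i" "i < length a" for i j
  proof -
    have "pos (a ! j) \<le> pos (a ! i)"
      using sorted_nth_mono[OF a(3), of j i] that by simp
    moreover have "a ! j \<noteq> a ! i" using a(2) that nth_eq_iff_index_eq by fastforce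
    moreover have "a ! j \<in> X" "a ! i \<in> X" using that a(1) nth_mem by (metis order.strict_trans)+
    ultimately show ?thesis using pos by (metis forest_order_def inj_onD order_neq_le_trans)
  qed
  have "rho_separated_tuple \<rho> F h a"
    unfolding rho_separated_tuple_def
  proof (intro allI impI)
    fix i j0 j1 :: nat and m0 m1 :: int and \<tau>0 \<tau>1
    assume i: "i < length a" and "(j0, m0, \<tau>0) \<noteq> (j1, m1, \<tau>1) \<and>
      j0 < i \<and> m0 \<in> {-1, 1} \<and> \<tau>0 \<in> dom F \<and> pfun_pow (the (F \<tau>0)) m0 (a ! i) = Some (a ! j0) \<and>
      j1 < i \<and> m1 \<in> {-1, 1} \<and> \<tau>1 \<in> dom F \<and> pfun_pow (the (F \<tau>1)) m1 (a ! i) = Some (a ! j1)"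
    then have asm: "(j0, m0, \<tau>0) \<noteq> (j1, m1, \<tau>1)" "j0 < i" "m0 \<in> {-1, 1}" "\<tau>0 \<in> dom F"
      "pfun_pow (the (F \<tau>0)) m0 (a ! i) = Some (a ! j0)" "j1 < i" "m1 \<in> {-1, 1}" "\<tau>1 \<in> dom F"
      "pfun_pow (the (F \<tau>1)) m1 (a ! i) = Some (a ! j1)" by blast+
    have e: "edge F (\<tau>0, m0 = 1) (a ! i) (a ! j0)" "edge F (\<tau>1, m1 = 1) (a ! i) (a ! j1)"
      using E[of \<tau>0 "m0 = 1" "a ! i" "a ! j0"] E[of \<tau>1 "m1 = 1" "a ! i" "a ! j1"] asm by auto
    have X: "a ! i \<in> X" "a ! j0 \<in> X" "a ! j1 \<in> X"
      using a(1) i asm(2,6) by (auto intro: nth_mem)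
    note D = forest_orderD[OF pos X lt[OF asm(2) i] lt[OF asm(6) i] e]
    have j: "j0 = j1" using D(1) a(2) i asm(2,6) by (simp add: nth_eq_iff_index_eq)
    then have "(\<tau>0, m0 = 1) \<noteq> (\<tau>1, m1 = 1)" using asm(1,3,7) by auto
    then show "j0 = j1 \<and> h \<le> \<rho> \<tau>0 \<tau>1" using D(2) j by simp
  qed
  then show "rho_separated \<rho> F h X" using a unfolding rho_separated_def by blast
qed

section \<open>Conditions as labelled graphs\<close>

lemma ht_zero [simp]: "ht 0 = 0"
  by (simp add: ht_eq_zero_iff omega_pos)

lemma omega1_pos_iff: "0 < (a::omega1) \<longleftrightarrow> a \<noteq> 0"
  by (metis less_irrefl order_neq_le_trans zero_le_omega1)

lemma standard_finite_treeD:
  assumes "standard_finite_tree T"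
  shows "finite (fst T)" and "0 \<in> fst T" and "trans (snd T)"
    and "v \<in> fst T \<Longrightarrow> v = 0 \<or> omega \<le> v"
    and "(u, v) \<in> snd T \<Longrightarrow> u \<in> fst T \<and> v \<in> fst T \<and> ht u < ht v"
    and "(u, v) \<in> snd T \<Longrightarrow> (w, v) \<in> snd T \<Longrightarrow> u = w \<or> (u, w) \<in> snd T \<or> (w, u) \<in> snd T"
    and "v \<in> fst T \<Longrightarrow> h \<in> ht ` fst T \<Longrightarrow> h < ht v \<Longrightarrow> \<exists>u. (u, v) \<in> snd T \<and> ht u = h"
proof -
  obtain X lt where T: "T = (X, lt)" by (cases T)
  have *: "finite X" "X \<subseteq> {0} \<union> {x. omega \<le> x}" "0 \<in> X"
    "lt \<subseteq> X \<times> X" "trans lt" "\<And>x. x \<in> X \<Longrightarrow> total_on {y. (y, x) \<in> lt} lt"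
    "\<And>x y. (x, y) \<in> lt \<Longrightarrow> ht x < ht y"
    "\<And>x a. x \<in> X \<Longrightarrow> a \<in> ht ` X \<Longrightarrow> a < ht x \<Longrightarrow> \<exists>y. (y, x) \<in> lt \<and> ht y = a"
    using assms unfolding standard_finite_tree_def T by auto
  show "finite (fst T)" "0 \<in> fst T" "trans (snd T)"
    "v \<in> fst T \<Longrightarrow> v = 0 \<or> omega \<le> v"
    "(u, v) \<in> snd T \<Longrightarrow> u \<in> fst T \<and> v \<in> fst T \<and> ht u < ht v"
    "v \<in> fst T \<Longrightarrow> h \<in> ht ` fst T \<Longrightarrow> h < ht v \<Longrightarrow> \<exists>u. (u, v) \<in> snd T \<and> ht u = h"
    using *(1-5,7,8) by (auto simp: T)
  show "(u, v) \<in> snd T \<Longrightarrow> (w, v) \<in> snd T \<Longrightarrow> u = w \<or> (u, w) \<in> snd T \<or> (w, u) \<in> snd T"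
    using *(4) *(6)[of v] unfolding T total_on_def by auto
qed

text \<open>Linearity of the predecessors comes from their existence and uniqueness at each height:
  for \<open>u\<close> and \<open>w\<close> below \<open>v\<close> with \<open>ht u < ht w\<close>,
  the predecessor of \<open>w\<close> at height \<open>ht u\<close> is below \<open>v\<close> as
  well, hence equals \<open>u\<close>.\<close>

lemma standard_finite_treeI:
  assumes "finite (fst W)" "0 \<in> fst W" "trans (snd W)"
    and "\<And>v. v \<in> fst W \<Longrightarrow> v = 0 \<or> omega \<le> v"
    and lt: "\<And>u v. (u, v) \<in> snd W \<Longrightarrow> u \<in> fst W \<and> v \<in> fst W \<and> ht u < ht v"
    and uniq: "\<And>u v w. (u, v) \<in> snd W \<Longrightarrow> (w, v) \<in> snd W \<Longrightarrow> ht u = ht w \<Longrightarrow> u = w"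
    and below: "\<And>v h. v \<in> fst W \<Longrightarrow> h \<in> ht ` fst W \<Longrightarrow> h < ht v \<Longrightarrow> \<exists>u. (u, v) \<in> snd W \<and> ht u = h"
  shows "standard_finite_tree W"
proof -
  obtain X lt where W: "W = (X, lt)" by (cases W)
  have aux: "(u, w) \<in> lt" if uw: "(u, v) \<in> lt" "(w, v) \<in> lt" "ht u < ht w" for u v w
  proof -
    obtain u' where "(u', w) \<in> lt" "ht u' = ht u"
      using below[of w "ht u"] uw assms(5)[of w v] assms(5)[of u v] by (auto simp: W)
    moreover from this have "u' = u"
      using uniq[of u' v u] uw transD[OF assms(3), of u' w v] by (simp add: W)
    ultimately show ?thesis by simp
  qed
  have "total_on {y. (y, x) \<in> lt} lt" for x
  proof (rule total_onI)
    fix u w assume "u \<in> {y. (y, x) \<in> lt}" "w \<in> {y. (y, x) \<in> lt}" "u \<noteq> w"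
    then show "(u, w) \<in> lt \<or> (w, u) \<in> lt"
      using aux[of u x w] aux[of w x u] uniq[of u x w] by (cases "ht u" "ht w" rule: linorder_cases) (auto simp: W)
  qed
  moreover have "irrefl lt" using lt by (auto simp: W irrefl_def)
  ultimately show ?thesis using assms unfolding standard_finite_tree_def
    by (auto simp: W)
qed

locale condition =
  fixes \<rho> :: "omega2 \<Rightarrow> omega2 \<Rightarrow> omega1" and T :: ftree and F :: "omega2 \<rightharpoonup> pfun"
  assumes cond: "(T, F) \<in> forcing_P \<rho>"
begin

lemma tree: "standard_finite_tree T"
  and finite_dom: "finite (dom F)"
  and std_fun: "\<gamma> \<in> dom F \<Longrightarrow> standard_function T (the (F \<gamma>))"
  and separated: "\<alpha> \<in> heights T \<Longrightarrow> rho_separated \<rho> F \<alpha> (level T \<alpha>)"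
  using cond by (auto simp: forcing_P_def)

lemmas finite_tree = standard_finite_treeD(1)[OF tree]
  and zero_mem = standard_finite_treeD(2)[OF tree]
  and lt_trans = transD[OF standard_finite_treeD(3)[OF tree]]
  and mem_cases = standard_finite_treeD(4)[OF tree]
  and ltD = standard_finite_treeD(5)[OF tree]
  and lt_linear = standard_finite_treeD(6)[OF tree]
  and below = standard_finite_treeD(7)[OF tree]

lemma lt_unique: "(u, v) \<in> snd T \<Longrightarrow> (w, v) \<in> snd T \<Longrightarrow> ht u = ht w \<Longrightarrow> u = w"
  using lt_linear[of u v w] ltD by force

lemma lt_lower: "(u, v) \<in> snd T \<Longrightarrow> (w, v) \<in> snd T \<Longrightarrow> ht u < ht w \<Longrightarrow> (u, w) \<in> snd T"
  using lt_linear[of u v w] ltD by force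

lemma restrict_eq: "(u, v) \<in> snd T \<Longrightarrow> tree_restrict T v (ht u) = u"
  unfolding tree_restrict_def using lt_unique[of _ v u] ltD[of u v]
  by (intro the_equality) (auto simp: level_def)

lemma edgeD: "edge F l u v \<Longrightarrow> u \<in> fst T \<and> v \<in> fst T \<and> ht v = ht u"
  using std_fun[of "fst l"] unfolding edge_def standard_function_def
  by (auto simp: ran_def dom_def subset_iff split: if_splits)

lemma edge_ne: "edge F l u v \<Longrightarrow> u \<noteq> 0 \<Longrightarrow> u \<noteq> v"
proof -
  assume e: "edge F l u v" and "u \<noteq> 0"
  have "the (F (fst l)) u \<noteq> Some u"
    using std_fun[of "fst l"] e \<open>u \<noteq> 0\<close> unfolding edge_def standard_function_def
    by (metis DiffI domI empty_iff insert_iff option.sel)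
  then show "u \<noteq> v" using e by (auto simp: edge_def split: if_splits)
qed

lemma edge_fun: "edge F l u v \<Longrightarrow> edge F l u w \<Longrightarrow> v = w"
  using std_fun[of "fst l"] unfolding edge_def standard_function_def
  by (auto simp: inj_on_def dom_def split: if_splits)

text \<open>Arrows project to lower levels: downward closure puts the restriction of
  \<open>u\<close> into the domain, and monotonicity puts its value below \<open>v\<close>. For an
  arrow of the inverse the two ends are exchanged.\<close>

lemma edge_down:
  assumes "edge F l u v" "h \<in> heights T" "h < ht u"
  obtains u' v' where "(u', u) \<in> snd T" "(v', v) \<in> snd T" "ht u' = h" "ht v' = h" "edge F l u' v'"
proof -
  have *: "\<exists>u' v'. (u', u) \<in> snd T \<and> (v', v) \<in> snd T \<and> ht u' = h \<and> ht v' = h \<and> edge F (\<tau>, True) u' v'"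
    if e: "edge F (\<tau>, True) u v" and h: "h < ht u" for \<tau> u v
  proof -
    have f: "standard_function T (the (F \<tau>))" "the (F \<tau>) u = Some v" "\<tau> \<in> dom F"
      using e std_fun[of \<tau>] by (auto simp: edge_def)
    obtain u' where u': "(u', u) \<in> snd T" "ht u' = h"
      using below[of u h] edgeD[OF e] h assms(2) by (auto simp: heights_def)
    then have "u' \<in> dom (the (F \<tau>))"
      using f restrict_eq[OF u'(1)] assms(2) h unfolding standard_function_def by (metis domI)
    then obtain v' where v': "the (F \<tau>) u' = Some v'" by blast
    then have "(v', v) \<in> snd T" "ht v' = h"
      using f u' unfolding standard_function_def by (metis domI option.sel)+
    then show ?thesis using u' v' f(3) by (auto simp: edge_def)
  qed
  show thesis
  proof (cases "snd l")
    case True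
    then have "l = (fst l, True)" by (simp add: prod_eq_iff)
    then show ?thesis using *[of "fst l" u v] assms that by metis
  next
    case False
    then have "edge F (fst l, True) v u" "h < ht v"
      using assms edgeD[OF assms(1)] by (auto simp: edge_def)
    then obtain v' u' where "(u', u) \<in> snd T" "(v', v) \<in> snd T" "ht u' = h" "ht v' = h"
      "edge F (fst l, True) v' u'"
      using * by blast
    then show ?thesis using False that[of u' v'] by (auto simp: edge_def)
  qed
qed

lemma finite_level: "finite (level T \<alpha>)"
  using finite_tree by (auto simp: level_def)

lemma ex_forest_order:
  assumes "\<alpha> \<in> heights T"
  shows "\<exists>pos. forest_order (edge F) (\<lambda>\<tau> \<zeta>. \<alpha> \<le> \<rho> \<tau> \<zeta>) pos (level T \<alpha>)"
  using separated[OF assms] std_fun finite_level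
  by (subst rho_separated_iff_forest_order[symmetric]) (auto simp: standard_function_def)

lemma parallel_edges:
  assumes "\<alpha> \<in> heights T" "ht u = \<alpha>" "edge F l u v" "edge F l' u v" "l \<noteq> l'"
  shows "\<alpha> \<le> \<rho> (fst l) (fst l')"
proof -
  obtain pos where pos: "forest_order (edge F) (\<lambda>\<tau> \<zeta>. \<alpha> \<le> \<rho> \<tau> \<zeta>) pos (level T \<alpha>)"
    using ex_forest_order[OF assms(1)] by blast
  have "u \<noteq> 0" using assms(1,2) by (auto simp: heights_def)
  then have "u \<noteq> v" using edge_ne[OF assms(3)] by blast
  moreover have "u \<in> level T \<alpha>" "v \<in> level T \<alpha>"
    using edgeD[OF assms(3)] assms(2) by (auto simp: level_def)
  ultimately show ?thesis
    using forest_order_parallel[OF pos edge_flip] assms(3-5) by blast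
qed

end

text \<open>A condition is recognised from its edge relation alone. Injectivity is functionality of
  the reversed labels. Strict monotonicity for \<open>u\<close> below \<open>z\<close> follows from
  projection: the arrow at \<open>z\<close> projects to height \<open>ht u\<close>, where it starts
  at \<open>u\<close> because restrictions are unique.\<close>

lemma forcing_PI:
  assumes tree: "standard_finite_tree W"
    and fin: "finite (dom H)"
    and edgeD: "\<And>l u v. edge H l u v \<Longrightarrow> u \<in> fst W \<and> v \<in> fst W \<and> ht v = ht u"
    and edge_ne: "\<And>l u v. edge H l u v \<Longrightarrow> u \<noteq> 0 \<Longrightarrow> u \<noteq> v"
    and edge_fun: "\<And>l u v w. edge H l u v \<Longrightarrow> edge H l u w \<Longrightarrow> v = w"
    and edge_down: "\<And>l u v h. edge H l u v \<Longrightarrow> h \<in> heights W \<Longrightarrow> h < ht u \<Longrightarrow>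
      \<exists>u' v'. (u', u) \<in> snd W \<and> (v', v) \<in> snd W \<and> ht u' = h \<and> edge H l u' v'"
    and forest: "\<And>\<alpha>. \<alpha> \<in> heights W \<Longrightarrow>
      \<exists>pos. forest_order (edge H) (\<lambda>\<tau> \<zeta>. \<alpha> \<le> \<rho> \<tau> \<zeta>) pos (level W \<alpha>)"
  shows "(W, H) \<in> forcing_P \<rho>"
proof -
  note ltD = standard_finite_treeD(5)[OF tree]
  have uniq: "u = w" if "(u, v) \<in> snd W" "(w, v) \<in> snd W" "ht u = ht w" for u v w
    using standard_finite_treeD(6)[OF tree that(1,2)] ltD that(3) by force
  have ht0: "v = 0" if "v \<in> fst W" "ht v = 0" for v
    using standard_finite_treeD(4)[OF tree that(1)] that(2) by (auto simp: ht_eq_zero_iff)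
  have restrict: "tree_restrict W v (ht u) = u" if "(u, v) \<in> snd W" for u v
    unfolding tree_restrict_def using uniq[of _ v u] that ltD[of u v]
    by (intro the_equality) (auto simp: level_def)
  have std: "standard_function W f" if f: "\<tau> \<in> dom H" "f = the (H \<tau>)" for \<tau> f
  proof -
    have e: "f u = Some v \<longleftrightarrow> edge H (\<tau>, True) u v" "f u = Some v \<longleftrightarrow> edge H (\<tau>, False) v u" for u v
      using f by (auto simp: edge_def)
    have incr: "(v, w) \<in> snd W" if uw: "f u = Some v" "f z = Some w" "(u, z) \<in> snd W" for u z v w
    \<comment> \<open>\<open>heights W\<close> omits 0, so projection says nothing at height 0;
      there 0 is the only node, and it lies below every node of positive height.\<close>
    proof (cases "ht u = 0")
      case True
      then have "v = 0" using edgeD[of "(\<tau>, True)" u v] e uw ht0 by auto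
      moreover have "0 < ht w"
        using ltD[OF uw(3)] edgeD[of "(\<tau>, True)" z w] e uw(2) True by auto
      moreover have "w \<in> fst W" "0 \<in> ht ` fst W"
        using edgeD[of "(\<tau>, True)" z w] e uw(2) standard_finite_treeD(2)[OF tree] image_eqI[of 0 ht 0] by auto
      ultimately obtain w' where "(w', w) \<in> snd W" "ht w' = 0"
        using standard_finite_treeD(7)[OF tree, of w 0] by blast
      then show ?thesis using ht0 ltD \<open>v = 0\<close> by blast
    next
      case False
      then obtain u' v' where "(u', z) \<in> snd W" "(v', w) \<in> snd W" "ht u' = ht u" "edge H (\<tau>, True) u' v'"
        using edge_down[of "(\<tau>, True)" z w "ht u"] ltD[OF uw(3)] e uw(2) by (auto simp: heights_def)
      then show ?thesis using uniq[of u' z u] uw e edge_fun by metis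
    qed
    have inj: "u = u'" if "f u = Some v" "f u' = Some v" for u u' v
      using that e(2) edge_fun by metis
    have down: "tree_restrict W u h \<in> dom f" if uv: "f u = Some v" and h: "h \<in> heights W" "h < ht u" for u v h
      using edge_down[of "(\<tau>, True)" u v h] e(1) uv h restrict by (metis domI)
    show ?thesis unfolding standard_function_def
    proof (intro conjI ballI impI)
      show "dom f \<subseteq> fst W" "ran f \<subseteq> fst W"
        using e edgeD[of "(\<tau>, True)"] by (auto simp: dom_def ran_def)
      show "inj_on f (dom f)" using inj by (auto simp: inj_on_def)
      show "(the (f u), the (f v)) \<in> snd W" if "u \<in> dom f" "v \<in> dom f" "(u, v) \<in> snd W" for u v
        using that incr by auto
      show "ht (the (f u)) = ht u" if "u \<in> dom f" for u
      proof -
        obtain v where v: "f u = Some v" using \<open>u \<in> dom f\<close> by blast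
        then have "edge H (\<tau>, True) u v" using e(1) by simp
        from edgeD[OF this] show ?thesis using v by (metis option.sel)
      qed
      show "tree_restrict W u h \<in> dom f" if "u \<in> dom f" "h \<in> heights W" "h < ht u" for u h
        using that down by blast
      show "the (f u) \<noteq> u" if "u \<in> dom f - {0}" for u
        using that e(1) edge_ne[of "(\<tau>, True)" u u] by (metis DiffE domD insertCI option.sel)
    qed
  qed
  have "rho_separated \<rho> H \<alpha> (level W \<alpha>)" if "\<alpha> \<in> heights W" for \<alpha>
  proof (subst rho_separated_iff_forest_order)
    show "inj_on (the (H \<tau>)) (dom (the (H \<tau>)))" if "\<tau> \<in> dom H" for \<tau>
      using std[OF that] by (simp add: standard_function_def)
    show "finite (level W \<alpha>)"
      using standard_finite_treeD(1)[OF tree] by (auto simp: level_def)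
  qed (rule forest[OF that])
  then show ?thesis using tree fin std by (auto simp: forcing_P_def)
qed

definition family_of :: "omega2 set \<Rightarrow> (omega2 \<times> bool \<Rightarrow> omega1 \<Rightarrow> omega1 \<Rightarrow> bool) \<Rightarrow> (omega2 \<rightharpoonup> pfun)"
  where "family_of D E = (\<lambda>\<tau>. if \<tau> \<in> D
    then Some (\<lambda>u. if \<exists>v. E (\<tau>, True) u v then Some (THE v. E (\<tau>, True) u v) else None) else None)"

lemma dom_family_of [simp]: "dom (family_of D E) = D"
  by (auto simp: family_of_def dom_def)

lemma edge_family_of:
  assumes dom: "\<And>l u v. E l u v \<Longrightarrow> fst l \<in> D"
    and sym: "\<And>\<tau> s u v. E (\<tau>, s) u v \<Longrightarrow> E (\<tau>, \<not> s) v u"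
    and func: "\<And>l u v w. E l u v \<Longrightarrow> E l u w \<Longrightarrow> v = w"
  shows "edge (family_of D E) l u v \<longleftrightarrow> E l u v"
proof -
  have the: "(THE v. E (\<tau>, True) u v) = v" if "E (\<tau>, True) u v" for \<tau> u v
    using that func by blast
  have *: "edge (family_of D E) (\<tau>, True) u v \<longleftrightarrow> E (\<tau>, True) u v" for \<tau> u v
    using dom[of "(\<tau>, True)"] the func[of "(\<tau>, True)"] by (auto simp: edge_def family_of_def)
  have "edge (family_of D E) (\<tau>, s) u v \<longleftrightarrow> E (\<tau>, s) u v" for \<tau> s
  proof (cases s)
    case False
    have "edge (family_of D E) (\<tau>, False) u v \<longleftrightarrow> edge (family_of D E) (\<tau>, True) v u"
      by (simp add: edge_def)
    then show ?thesis using False *[of \<tau> v u] sym[of \<tau> True v u] sym[of \<tau> False u v] by auto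
  qed (simp add: *)
  then show ?thesis by (cases l) simp
qed

section \<open>Lifting the branch to the smaller tree\<close>

text \<open>The situation of one pair of conditions after the thinning. \<open>\<phi>\<close> is the
  isomorphism of the first non-root levels, and \<open>b0\<close> is the node at height
  \<open>q\<close> on the branch to \<open>y\<close>. By \<open>root_type\<close> every arrow of
  \<open>G\<close> in the root has a parallel arrow of \<open>F\<close>; \<open>rho_mixed\<close>
  and \<open>rho_mixed_min\<close> are what the special property of rho gives for indices on
  different sides of the common domain.\<close>

locale amalgamation = T: condition \<rho> T F + U: condition \<rho> U G
  for \<rho> T F U G +
  fixes p q x y b0 :: omega1 and \<phi> :: "omega1 \<Rightarrow> omega1"
  assumes rho_sym: "\<rho> \<tau> \<zeta> = \<rho> \<zeta> \<tau>"
    and p: "p \<in> heights T" and q: "q \<in> heights U"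
    and ht_less_q: "v \<in> fst T \<Longrightarrow> ht v < q"
    and root_eq: "{v \<in> fst T. ht v < p} = {v \<in> fst U. ht v < q}"
    and root_lt: "ht v < p \<Longrightarrow> (u, v) \<in> snd T \<longleftrightarrow> (u, v) \<in> snd U"
    and root_edge: "fst l \<in> dom F \<inter> dom G \<Longrightarrow> ht u < p \<Longrightarrow> edge F l u v \<longleftrightarrow> edge G l u v"
    and root_type: "\<zeta> \<in> dom G \<Longrightarrow> \<exists>\<zeta>'. \<forall>s u v. ht u < p \<longrightarrow> edge G (\<zeta>, s) u v \<longrightarrow> edge F (\<zeta>', s) u v"
    and phi: "bij_betw \<phi> (level U q) (level T p)"
    and phi_lt: "b \<in> level U q \<Longrightarrow> ht u < p \<Longrightarrow> (u, b) \<in> snd U \<longleftrightarrow> (u, \<phi> b) \<in> snd T"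
    and phi_edge: "b \<in> level U q \<Longrightarrow> b' \<in> level U q \<Longrightarrow> fst l \<in> dom F \<inter> dom G \<Longrightarrow>
      edge G l b b' \<longleftrightarrow> edge F l (\<phi> b) (\<phi> b')"
    and x: "x \<in> fst T" and b0: "b0 \<in> level U q"
    and y: "y = b0 \<or> (b0, y) \<in> snd U" and phi_b0: "\<phi> b0 = x \<or> (\<phi> b0, x) \<in> snd T"
    and rho_root: "\<tau> \<in> dom F \<inter> dom G \<Longrightarrow> \<zeta> \<in> dom F \<inter> dom G \<Longrightarrow> \<rho> \<tau> \<zeta> < p"
    and rho_mixed: "\<tau> \<in> dom F - dom G \<Longrightarrow> \<zeta> \<in> dom G - dom F \<Longrightarrow> u \<in> fst T \<Longrightarrow> ht u < p \<Longrightarrow>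
      ht u \<le> \<rho> \<tau> \<zeta>"
    and rho_mixed_min: "\<tau> \<in> dom F - dom G \<Longrightarrow> \<zeta> \<in> dom G - dom F \<Longrightarrow> \<gamma> \<in> dom F \<inter> dom G \<Longrightarrow>
      min (\<rho> \<tau> \<gamma>) (\<rho> \<zeta> \<gamma>) \<le> \<rho> \<tau> \<zeta>"
begin

abbreviation A where "A \<equiv> dom F \<inter> dom G"
abbreviation B where "B \<equiv> level U q"

definition Mid :: "omega1 set" where "Mid = {h \<in> heights T. p \<le> h}"

lemma p_less_q: "p < q"
  using p ht_less_q by (auto simp: heights_def)

lemma p_pos: "0 < p"
  using p by (auto simp: heights_def omega1_pos_iff)

lemma MidD: "h \<in> Mid \<Longrightarrow> h \<in> heights T \<and> p \<le> h \<and> h < q \<and> h \<in> ht ` fst T"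
  using ht_less_q by (auto simp: Mid_def heights_def)

lemma MidI: "v \<in> fst T \<Longrightarrow> p \<le> ht v \<Longrightarrow> ht v \<in> Mid"
  using p_pos by (auto simp: Mid_def heights_def)

lemma BD: "b \<in> B \<Longrightarrow> b \<in> fst U \<and> ht b = q \<and> b \<noteq> 0"
  using p_less_q p_pos by (auto simp: level_def)

lemma phi_mem: "b \<in> B \<Longrightarrow> \<phi> b \<in> fst T \<and> ht (\<phi> b) = p"
  using phi by (auto simp: bij_betw_def level_def)

lemma phi_inj: "b \<in> B \<Longrightarrow> b' \<in> B \<Longrightarrow> \<phi> b = \<phi> b' \<Longrightarrow> b = b'"
  using phi by (auto simp: bij_betw_def inj_on_def)

lemma phi_surj: "v \<in> fst T \<Longrightarrow> ht v = p \<Longrightarrow> \<exists>b\<in>B. v = \<phi> b"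
  using phi by (auto simp: bij_betw_def level_def image_iff set_eq_iff)

lemma root_mem: "v \<in> fst T \<and> ht v < p \<longleftrightarrow> v \<in> fst U \<and> ht v < q"
  using root_eq by blast

lemma root_iff: "ht v < p \<Longrightarrow> v \<in> fst T \<longleftrightarrow> v \<in> fst U"
  using root_mem[of v] p_less_q by (metis order.strict_trans)

lemma U_cases: "v \<in> fst U \<Longrightarrow> ht v < p \<or> q \<le> ht v"
  using root_mem[of v] by (metis not_le)

lemma T_U_root: "v \<in> fst T \<Longrightarrow> v \<in> fst U \<Longrightarrow> ht v < p"
  using U_cases ht_less_q leD by blast

text \<open>The values of \<open>\<rho>\<close> on \<open>A\<close> lie below \<open>p\<close>, so above the root two \<open>A\<close>-labelled edges are
  never parallel.\<close>

lemma A_unique_T: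
  assumes "edge F l u v" "edge F l' u v" "fst l \<in> A" "fst l' \<in> A" "p \<le> ht u"
  shows "l = l'"
proof (rule ccontr)
  assume "l \<noteq> l'"
  have "ht u \<in> heights T" using T.edgeD[OF assms(1)] assms(5) MidI MidD by blast
  then have "ht u \<le> \<rho> (fst l) (fst l')" using T.parallel_edges assms \<open>l \<noteq> l'\<close> by blast
  then show False using rho_root[OF assms(3,4)] assms(5) by simp
qed

lemma A_unique_U:
  assumes "edge G l u v" "edge G l' u v" "fst l \<in> A" "fst l' \<in> A" "q \<le> ht u"
  shows "l = l'"
proof (rule ccontr)
  assume "l \<noteq> l'"
  have "ht u \<in> heights U" using U.edgeD[OF assms(1)] assms(5) p_less_q p_pos
    by (auto simp: heights_def)
  then have "ht u \<le> \<rho> (fst l) (fst l')" using U.parallel_edges assms \<open>l \<noteq> l'\<close> by blast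
  then show False using rho_root[OF assms(3,4)] assms(5) p_less_q by simp
qed

end

text \<open>Rooting the forest on \<open>B\<close> at \<open>b0\<close> makes every set that is connected to \<open>b0\<close> closed under
  passing to the unique earlier neighbour.\<close>

locale rooted_amalgamation = amalgamation +
  fixes pos :: "omega1 \<Rightarrow> nat"
  assumes pos: "forest_order (edge G) (\<lambda>\<tau> \<zeta>. q \<le> \<rho> \<tau> \<zeta>) pos (level U q)"
    and pos_b0: "b \<in> level U q \<Longrightarrow> pos b0 \<le> pos b"
begin

text \<open>\<open>lift h b u\<close>: the node \<open>u\<close> of height \<open>h\<close> is the position above \<open>\<phi> b\<close> that the branch to
  \<open>x\<close> forces on \<open>b\<close>.\<close>

inductive lift :: "omega1 \<Rightarrow> omega1 \<Rightarrow> omega1 \<Rightarrow> bool"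
  where base: "u \<in> fst T \<Longrightarrow> u = x \<or> (u, x) \<in> snd T \<Longrightarrow> p \<le> ht u \<Longrightarrow> lift (ht u) b0 u"
  | step: "lift h b u \<Longrightarrow> b' \<in> B \<Longrightarrow> pos b < pos b' \<Longrightarrow> fst l \<in> A \<Longrightarrow> edge G l b b' \<Longrightarrow>
      edge F l u v \<Longrightarrow> lift h b' v"

text \<open>Forced nodes stay above \<open>\<phi>\<close>: an arrow of \<open>F\<close> projects to
  height \<open>p\<close>, starts there at \<open>\<phi> b\<close>, and by \<open>phi_edge\<close>
  has to end at \<open>\<phi> b'\<close>.\<close>

lemma lift_mem:
  "lift h b u \<Longrightarrow> h \<in> Mid \<and> b \<in> B \<and> u \<in> fst T \<and> ht u = h \<and> (\<phi> b = u \<or> (\<phi> b, u) \<in> snd T)"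
proof (induction rule: lift.induct)
  case (base u)
  have "\<phi> b0 = u \<or> (\<phi> b0, u) \<in> snd T"
    using base phi_b0 T.ltD[of u x] T.lt_linear[of "\<phi> b0" x u] T.ltD[of u "\<phi> b0"] phi_mem[OF b0]
    by fastforce
  then show ?case using base b0 MidI by blast
next
  case (step h b u b' l v)
  note uv = T.edgeD[OF step.hyps(6)]
  have e: "edge F l (\<phi> b) (\<phi> b')" using phi_edge[of b b' l] step by blast
  have "\<phi> b' = v \<or> (\<phi> b', v) \<in> snd T"
  proof (cases "\<phi> b = u")
    case True
    then show ?thesis using T.edge_fun[OF e] step.hyps(6) by blast
  next
    case False
    then have lt: "(\<phi> b, u) \<in> snd T" using step.IH by blast
    then have "p < ht u" using T.ltD phi_mem step.IH by metis
    then obtain u' v' where u': "(u', u) \<in> snd T" "(v', v) \<in> snd T" "ht u' = p" "edge F l u' v'"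
      using T.edge_down[OF step.hyps(6) p] by blast
    then have "u' = \<phi> b" using T.lt_unique[OF u'(1) lt] phi_mem[of b] u'(3) step.IH by simp
    then show ?thesis using T.edge_fun[OF e] u' by blast
  qed
  then show ?case using step.IH step.hyps(2) uv by auto
qed

lemma lift_b0: "lift h b0 u \<Longrightarrow> u = x \<or> (u, x) \<in> snd T"
proof (erule lift.cases)
  fix h b u b' l v
  assume "lift h b u" "pos b < pos b'" "b0 = b'"
  then show ?thesis using pos_b0[of b] lift_mem[of h b u] by auto
qed auto

lemma lift_step:
  assumes "lift h b u" "b \<noteq> b0"
  obtains b' l v where "lift h b' v" "pos b' < pos b" "fst l \<in> A" "edge G l b' b" "edge F l v u"
  using assms by (cases rule: lift.cases) auto

lemma edge_flip': "edge F l u v \<longleftrightarrow> edge F (fst l, \<not> snd l) v u"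
  "edge G l u v \<longleftrightarrow> edge G (fst l, \<not> snd l) v u"
  by (auto simp: edge_def)

text \<open>Makes \<open>lift\<close> deterministic: the forest order allows one earlier neighbour,
  and two parallel labels in \<open>A\<close> are excluded above the root.\<close>

lemma parent_unique:
  assumes "edge G l b' b" "edge G l' b'' b" "fst l \<in> A" "fst l' \<in> A" "b \<in> B" "b' \<in> B" "b'' \<in> B"
    "pos b' < pos b" "pos b'' < pos b"
  shows "b' = b'' \<and> l = l'"
proof -
  have "b' = b''"
    using forest_orderD(1)[OF pos assms(5-9)] assms(1,2) edge_flip'(2) by blast
  moreover from this have "l = l'" using A_unique_U[OF assms(1) _ assms(3,4)] assms(2,6) BD by auto
  ultimately show ?thesis ..
qed

text \<open>By \<open>parent_unique\<close> the last step of a derivation of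
  \<open>lift h b u\<close> is determined by \<open>b\<close>, so two derivations follow the same
  arrows from the same node on the branch to \<open>x\<close>.\<close>

lemma lift_fun: "lift h b u \<Longrightarrow> lift h b u' \<Longrightarrow> u = u'"
proof (induction arbitrary: u' rule: lift.induct)
  case (base u)
  then show ?case using lift_b0[of "ht u" u'] lift_mem[of "ht u" b0 u'] T.lt_unique[of u x u'] T.ltD
    by (metis less_irrefl)
next
  case (step h b u b' l v)
  have "b' \<noteq> b0" using step.hyps(3) pos_b0[of b] lift_mem[OF step.hyps(1)] by auto
  obtain b'' l' w where w: "lift h b'' w" "pos b'' < pos b'" "fst l' \<in> A" "edge G l' b'' b'"
    "edge F l' w u'"
    by (rule lift_step[OF step.prems \<open>b' \<noteq> b0\<close>])
  have "b = b'' \<and> l = l'"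
    using parent_unique[OF step.hyps(5) w(4) step.hyps(4) w(3) step.hyps(2) _ _ step.hyps(3) w(2)]
      lift_mem[OF w(1)] lift_mem[OF step.hyps(1)] by blast
  then show ?case using step.IH[of w] w step.hyps(6) T.edge_fun by blast
qed

lemma lift_inj:
  assumes "lift h b u" "lift h b' u"
  shows "b = b'"
proof -
  have "\<phi> b = \<phi> b'"
    using lift_mem[OF assms(1)] lift_mem[OF assms(2)] phi_mem T.lt_unique[of "\<phi> b" u "\<phi> b'"]
      T.ltD[of "\<phi> b" u] T.ltD[of "\<phi> b'" u] by (metis less_irrefl)
  then show ?thesis using phi_inj lift_mem assms by blast
qed

lemma lift_down:
  assumes "lift h b u" "h' \<in> Mid" "h' < h"
  shows "\<exists>u'. (u', u) \<in> snd T \<and> lift h' b u'"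
  using assms(1,3)
proof (induction rule: lift.induct)
  case (base u)
  then obtain u' where u': "(u', u) \<in> snd T" "ht u' = h'"
    using T.below[of u h'] MidD[OF assms(2)] by blast
  then have "u' = x \<or> (u', x) \<in> snd T" using base(2) T.lt_trans by blast
  then have "lift (ht u') b0 u'" using lift.base[of u'] u' T.ltD MidD[OF assms(2)] by blast
  then show ?case using u' by blast
next
  case (step h b u b' l v)
  then obtain u' where u': "(u', u) \<in> snd T" "lift h' b u'" by blast
  have "h' < ht u" using step lift_mem by blast
  then obtain u'' v' where v': "(u'', u) \<in> snd T" "(v', v) \<in> snd T" "ht u'' = h'" "edge F l u'' v'"
    using T.edge_down[OF step.hyps(6)] MidD[OF assms(2)] by blast
  then have "u'' = u'" using T.lt_unique[OF v'(1) u'(1)] lift_mem[OF u'(2)] by simp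
  then show ?case using v' u' lift.step[OF u'(2) step.hyps(2-5)] by blast
qed

text \<open>Arrows of \<open>F\<close> with labels in \<open>A\<close> never leave the forced part;
  this later keeps the amalgamated functions single-valued. Projection to height \<open>p\<close>
  and \<open>phi_edge\<close> produce \<open>b'\<close>, and if \<open>b'\<close> comes after
  \<open>b\<close> the claim is a step of \<open>lift\<close>.\<close>

lemma lift_closed:
  assumes "lift h b u" "edge F l u v" "fst l \<in> A"
  shows "\<exists>b'. lift h b' v \<and> edge G l b b'"
proof -
  note m = lift_mem[OF assms(1)]
  have "\<exists>b'\<in>B. edge F l (\<phi> b) (\<phi> b')"
  proof (cases "\<phi> b = u")
    case True
    then show ?thesis using assms(2) T.edgeD[OF assms(2)] phi_surj[of v] phi_mem m by metis
  next
    case False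
    then have lt: "(\<phi> b, u) \<in> snd T" using m by blast
    then have "p < ht u" using T.ltD phi_mem m by metis
    then obtain u' v' where u': "(u', u) \<in> snd T" "(v', v) \<in> snd T" "ht u' = p" "ht v' = p" "edge F l u' v'"
      using T.edge_down[OF assms(2) p] by blast
    then have "u' = \<phi> b" using T.lt_unique[OF u'(1) lt] phi_mem[of b] u'(3) m by simp
    then show ?thesis using u' phi_surj[of v'] T.ltD by blast
  qed
  then obtain b' where b': "b' \<in> B" "edge F l (\<phi> b) (\<phi> b')" by blast
  then have e: "edge G l b b'" using phi_edge m assms(3) by blast
  have "b \<noteq> b'" using U.edge_ne[OF e] BD m by blast
  then have "pos b \<noteq> pos b'" using pos m b'(1) by (auto simp: forest_order_def inj_on_def)
  then consider "pos b < pos b'" | "pos b' < pos b" by linarith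
  then show ?thesis
  proof cases
    case 1
    then show ?thesis using lift.step[OF assms(1) b'(1) 1 assms(3) e assms(2)] e by blast
  next
    case 2
    \<comment> \<open>Now \<open>b'\<close> is the parent of \<open>b\<close>, so \<open>u\<close>
      itself was obtained from a forced node over \<open>b'\<close> along the reverse of
      \<open>l\<close>; that node is \<open>v\<close>.\<close>
    then have "b \<noteq> b0" using pos_b0[OF b'(1)] by auto
    obtain b'' l' w where w: "lift h b'' w" "pos b'' < pos b" "fst l' \<in> A" "edge G l' b'' b"
      "edge F l' w u"
      by (rule lift_step[OF assms(1) \<open>b \<noteq> b0\<close>])
    have "b' = b'' \<and> (fst l, \<not> snd l) = l'"
      using parent_unique[of "(fst l, \<not> snd l)" b' b l' b''] e edge_flip'(2)[of l] w 2 b'(1) m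
        lift_mem[OF w(1)] assms(3) by auto
    then have "b' = b''" "edge F l u w" using w(5) edge_flip'(1)[of l u w] by auto
    then show ?thesis using w(1) e T.edge_fun[OF assms(2)] by blast
  qed
qed

lemma ex_fresh: "\<exists>g. \<forall>h. inj_on (g h) B \<and> (\<forall>b\<in>B. ht (g h b) = h \<and> g h b \<notin> fst T)"
proof -
  have "\<exists>f. inj_on f B \<and> (\<forall>b\<in>B. ht (f b) = h \<and> f b \<notin> fst T)" for h
  proof -
    have "infinite ({\<gamma>. ht \<gamma> = h} - fst T)" using infinite_ht_fibre T.finite_tree by simp
    then obtain S where S: "S \<subseteq> {\<gamma>. ht \<gamma> = h} - fst T" "finite S" "card S = card B"
      using infinite_arbitrarily_large by blast
    then obtain f where "bij_betw f B S"
      using finite_same_card_bij[OF U.finite_level] by metis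
    then show ?thesis using S by (auto simp: bij_betw_def)
  qed
  then show ?thesis by (rule choice[OF allI])
qed

text \<open>The forced node is used wherever \<open>lift\<close> provides one, and a fresh ordinal
  of the right height everywhere else. Hence a branch meets \<open>T\<close> above the root only
  where \<open>x\<close> forces it to.\<close>

lemma ex_branches:
  "\<exists>c. (\<forall>h\<in>Mid. inj_on (c h) B \<and> (\<forall>b\<in>B. ht (c h b) = h \<and> (c h b \<in> fst T \<longleftrightarrow> lift h b (c h b)))) \<and>
    (\<forall>h b u. lift h b u \<longrightarrow> c h b = u)"
proof -
  obtain g where g: "\<And>h. inj_on (g h) B" "\<And>h b. b \<in> B \<Longrightarrow> ht (g h b) = h \<and> g h b \<notin> fst T"
    using ex_fresh by blast
  define c where "c h b = (if \<exists>u. lift h b u then THE u. lift h b u else g h b)" for h b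
  have c1: "c h b = u" if "lift h b u" for h b u
    using that lift_fun unfolding c_def by auto
  have c2: "c h b = g h b" if "\<nexists>u. lift h b u" for h b
    using that by (simp add: c_def)
  have iff: "c h b \<in> fst T \<longleftrightarrow> lift h b (c h b)" if "b \<in> B" for h b
    using c1[of h b] c2[of h b] g(2)[OF that, of h] lift_mem[of h b] by metis
  have "inj_on (c h) B" for h
  proof (rule inj_onI)
    fix b b' assume bb: "b \<in> B" "b' \<in> B" "c h b = c h b'"
    show "b = b'"
    proof (cases "lift h b (c h b)")
      case True
      then have "lift h b' (c h b)" using iff bb by metis
      then show ?thesis using lift_inj True by blast
    next
      case False
      then have "\<not> lift h b' (c h b')" using iff bb by metis
      then have "g h b = g h b'" using False bb c1 c2 by metis
      then show ?thesis using g(1)[of h] bb by (auto dest: inj_onD)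
    qed
  qed
  moreover have "ht (c h b) = h" if "b \<in> B" for h b
    using c1[of h b] c2[of h b] g(2)[OF that, of h] lift_mem[of h b] by metis
  ultimately show ?thesis using c1 iff by blast
qed

end

section \<open>The amalgamated tree\<close>

locale branched_amalgamation = rooted_amalgamation +
  fixes c :: "omega1 \<Rightarrow> omega1 \<Rightarrow> omega1"
  assumes c_inj: "h \<in> Mid \<Longrightarrow> inj_on (c h) (level U q)"
    and c_ht: "h \<in> Mid \<Longrightarrow> b \<in> level U q \<Longrightarrow> ht (c h b) = h"
    and c_T: "h \<in> Mid \<Longrightarrow> b \<in> level U q \<Longrightarrow> c h b \<in> fst T \<longleftrightarrow> lift h b (c h b)"
    and c_lift: "lift h b u \<Longrightarrow> c h b = u"
begin

lemma c_eq: "c h b = c h' b' \<Longrightarrow> h \<in> Mid \<Longrightarrow> h' \<in> Mid \<Longrightarrow> b \<in> B \<Longrightarrow> b' \<in> B \<Longrightarrow> h = h' \<and> b = b'"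
  using c_ht[of h b] c_ht[of h' b'] c_inj[of h] by (auto dest: inj_onD)

lemma c_not_U: "h \<in> Mid \<Longrightarrow> b \<in> B \<Longrightarrow> c h b \<notin> fst U"
  using U_cases[of "c h b"] c_ht[of h b] MidD[of h] by auto

lemma c_x: "c (ht x) b0 = x"
proof -
  have "p \<le> ht x" using phi_b0 phi_mem[OF b0] T.ltD[of "\<phi> b0" x] by auto
  then show ?thesis using lift.base[of x] x c_lift by blast
qed

lemma ht_x: "ht x \<in> Mid"
  using phi_b0 phi_mem[OF b0] T.ltD[of "\<phi> b0" x] x by (intro MidI) auto

text \<open>Where a branch runs through \<open>T\<close>, the order intended for it is already the
  order of \<open>T\<close>: below \<open>p\<close> this is \<open>phi_lt\<close>, and from
  \<open>p\<close> on it is \<open>lift_down\<close>.\<close>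

lemma c_pred:
  assumes "h \<in> Mid" "b \<in> B" "c h b \<in> fst T"
  shows "(u, c h b) \<in> snd T \<longleftrightarrow> ht u < p \<and> (u, b) \<in> snd U \<or> (\<exists>h'\<in>Mid. h' < h \<and> u = c h' b)"
proof -
  have l: "lift h b (c h b)" using c_T assms by blast
  have phi: "\<phi> b = c h b \<or> (\<phi> b, c h b) \<in> snd T" using lift_mem[OF l] by blast
  have down: "(c h' b, c h b) \<in> snd T" if "h' \<in> Mid" "h' < h" for h'
    using lift_down[OF l that] c_lift by blast
  have root: "(u, c h b) \<in> snd T" if "ht u < p" "(u, b) \<in> snd U"
    using phi phi_lt[OF assms(2) that(1)] that(2) T.lt_trans by metis
  show ?thesis
  proof
    assume u: "(u, c h b) \<in> snd T"
    then have hu: "ht u < h" using T.ltD c_ht assms by metis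
    show "ht u < p \<and> (u, b) \<in> snd U \<or> (\<exists>h'\<in>Mid. h' < h \<and> u = c h' b)"
    proof (cases "ht u < p")
      case True
      then have "(u, \<phi> b) \<in> snd T"
        using phi T.lt_lower[OF u, of "\<phi> b"] u phi_mem[OF assms(2)] by metis
      then show ?thesis using phi_lt[OF assms(2) True] True by blast
    next
      case False
      then have "ht u \<in> Mid" using T.ltD[OF u] MidI by auto
      then have "u = c (ht u) b"
        using T.lt_unique[OF u down[OF _ hu]] c_ht assms(2) by simp
      then show ?thesis using \<open>ht u \<in> Mid\<close> hu by blast
    qed
  qed (use root down in blast)
qed

lemma c_closed:
  assumes "h \<in> Mid" "b \<in> B" "edge F l (c h b) v" "fst l \<in> A"
  shows "\<exists>b'\<in>B. v = c h b' \<and> edge G l b b'"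
proof -
  have "lift h b (c h b)" using c_T T.edgeD assms by blast
  then obtain b' where "lift h b' v" "edge G l b b'" using lift_closed assms(3,4) by blast
  then show ?thesis using c_lift lift_mem by blast
qed

text \<open>The last step in the derivation of \<open>lift\<close> is the arrow from the parent.
  Thus, at each height, the vertices whose nodes lie in \<open>T\<close> are joined to
  \<open>b0\<close> inside the forest on \<open>B\<close>.\<close>

lemma c_parent:
  assumes "h \<in> Mid" "b \<in> B" "c h b \<in> fst T" "b \<noteq> b0"
  obtains b' l where "b' \<in> B" "c h b' \<in> fst T" "pos b' < pos b" "fst l \<in> A" "edge G l b b'"
    "edge F l (c h b) (c h b')"
proof -
  have "lift h b (c h b)" using c_T assms by blast
  then obtain b' l v where *: "lift h b' v" "pos b' < pos b" "fst l \<in> A" "edge G l b' b"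
    "edge F l v (c h b)"
    by (rule lift_step[OF _ assms(4)])
  then have "v = c h b'" "b' \<in> B" "v \<in> fst T" using c_lift lift_mem by blast+
  then show thesis
    using that[of b' "(fst l, \<not> snd l)"] * edge_flip'(1)[of l v] edge_flip'(2)[of l b'] by auto
qed

section \<open>The order of the amalgam\<close>

definition Br :: "omega1 \<Rightarrow> omega1 set"
  where "Br b = {u. ht u < p \<and> (u, b) \<in> snd U} \<union> (\<lambda>h. c h b) ` Mid"

definition Up :: "omega1 \<Rightarrow> omega1 set"
  where "Up b = {v. v = b \<or> (b, v) \<in> snd U}"

text \<open>No transitive closure is taken: branches ordered by height and placed below the whole
  cone \<open>Up b\<close> already give a transitive relation. This is verified by describing the
  predecessors of the three kinds of nodes.\<close>

definition W :: ftree
  where "W = (fst T \<union> fst U \<union> (\<Union>h\<in>Mid. c h ` B),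
    snd T \<union> snd U \<union> {(u, v). \<exists>b\<in>B. u \<in> Br b \<and> v \<in> Br b \<union> Up b \<and> ht u < ht v})"

lemma snd_W: "(u, v) \<in> snd W \<longleftrightarrow> (u, v) \<in> snd T \<or> (u, v) \<in> snd U \<or>
    (\<exists>b\<in>B. u \<in> Br b \<and> v \<in> Br b \<union> Up b \<and> ht u < ht v)"
  by (simp add: W_def)

lemma BrD: "b \<in> B \<Longrightarrow> u \<in> Br b \<Longrightarrow> ht u < q"
  using MidD c_ht p_less_q by (auto simp: Br_def)

lemma UpD: "b \<in> B \<Longrightarrow> u \<in> Up b \<Longrightarrow> u \<in> fst U \<and> q \<le> ht u"
  using BD U.ltD[of b u] by (auto simp: Up_def)

lemma Br_W: "b \<in> B \<Longrightarrow> u \<in> Br b \<Longrightarrow> u \<in> fst W"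
  using U.ltD[of u b] by (auto simp: Br_def W_def)

lemma Br_unique: "b \<in> B \<Longrightarrow> u \<in> Br b \<Longrightarrow> v \<in> Br b \<Longrightarrow> ht u = ht v \<Longrightarrow> u = v"
  using c_ht MidD U.lt_unique[of u b v] by (fastforce simp: Br_def)

lemma Up_unique: "b \<in> B \<Longrightarrow> b' \<in> B \<Longrightarrow> v \<in> Up b \<Longrightarrow> v \<in> Up b' \<Longrightarrow> b = b'"
  using BD[of b] BD[of b'] U.lt_unique[of b v b'] U.ltD[of b b'] U.ltD[of b' b] by (auto simp: Up_def)

lemma ex_Up:
  assumes "v \<in> fst U" "q \<le> ht v"
  obtains b where "b \<in> B" "v \<in> Up b"
proof (cases "ht v = q")
  case True
  then show ?thesis using that[of v] assms by (auto simp: Up_def level_def)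
next
  case False
  then have "q < ht v" using assms(2) by simp
  then obtain b where "(b, v) \<in> snd U" "ht b = q"
    using U.below[of v q] assms(1) q unfolding heights_def by blast
  then show ?thesis using that[of b] U.ltD[of b v] by (auto simp: Up_def level_def)
qed

lemma Br_root_iff: "ht u < q \<Longrightarrow> u \<in> fst U \<Longrightarrow> b \<in> B \<Longrightarrow> v \<in> Up b \<Longrightarrow> (u, v) \<in> snd U \<longleftrightarrow> u \<in> Br b"
  using U_cases[of u] U.lt_lower[of u v b] U.lt_trans[of u b v] BD[of b] c_not_U
  by (auto simp: Br_def Up_def)

lemma W_cases:
  assumes "v \<in> fst W"
  obtains (T) "v \<in> fst T" | (mid) h b where "h \<in> Mid" "b \<in> B" "v = c h b"
    | (top) b where "v \<in> fst U" "q \<le> ht v" "b \<in> B" "v \<in> Up b"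
proof -
  consider "v \<in> fst T" | h b where "h \<in> Mid" "b \<in> B" "v = c h b" | "v \<in> fst U" "v \<notin> fst T"
    using assms by (auto simp: W_def)
  then show thesis
  proof cases
    case 3
    then have "q \<le> ht v" using U_cases root_iff by blast
    then show ?thesis using ex_Up 3(1) top by metis
  qed (use T mid in blast)+
qed

lemma Br_lower_T:
  assumes "b \<in> B" "v \<in> Br b" "v \<in> fst T"
  shows "(u, v) \<in> snd T \<longleftrightarrow> u \<in> Br b \<and> ht u < ht v"
proof (cases "ht v < p")
  case True
  then have v: "(v, b) \<in> snd U" using assms(2) c_ht[OF _ assms(1)] MidD by (fastforce simp: Br_def)
  have "(u, v) \<in> snd T \<longleftrightarrow> (u, v) \<in> snd U" using root_lt[OF True] .
  also have "\<dots> \<longleftrightarrow> (u, b) \<in> snd U \<and> ht u < ht v"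
    using U.lt_trans v U.lt_lower U.ltD by blast
  also have "\<dots> \<longleftrightarrow> u \<in> Br b \<and> ht u < ht v"
    using True c_ht[OF _ assms(1)] MidD by (fastforce simp: Br_def)
  finally show ?thesis .
next
  case False
  then obtain h where h: "h \<in> Mid" "v = c h b" using assms(2) by (auto simp: Br_def)
  then show ?thesis using c_pred[OF h(1) assms(1)] assms(3) c_ht[OF _ assms(1)] MidD[OF h(1)]
    by (fastforce simp: Br_def)
qed

text \<open>Pairs of \<open>U\<close> that end in \<open>T\<close> lie in the root, where the orders
  agree, and pairs of a branch that end in \<open>T\<close> are pairs of \<open>T\<close> by
  \<open>Br_lower_T\<close>. So \<open>T\<close> keeps its sets of predecessors.\<close>

lemma pred_T:
  assumes "v \<in> fst T"
  shows "(u, v) \<in> snd W \<longleftrightarrow> (u, v) \<in> snd T"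
proof -
  have "(u, v) \<in> snd T" if "(u, v) \<in> snd U"
    using that root_lt[of v u] T_U_root[OF assms] U.ltD by blast
  moreover have "(u, v) \<in> snd T" if "b \<in> B" "u \<in> Br b" "v \<in> Br b \<union> Up b" "ht u < ht v" for b
    using that Br_lower_T[of b v u] UpD[of b v] ht_less_q[OF assms] assms by fastforce
  ultimately show ?thesis by (auto simp: W_def)
qed

lemma pred_mid:
  assumes "h \<in> Mid" "b \<in> B"
  shows "(u, c h b) \<in> snd W \<longleftrightarrow> u \<in> Br b \<and> ht u < h"
proof -
  have cb: "c h b \<in> Br b" using assms(1) by (auto simp: Br_def)
  have "u \<in> Br b" if "(u, c h b) \<in> snd T"
    using Br_lower_T[OF assms(2) cb, of u] that T.ltD by blast
  moreover have "(u, c h b) \<notin> snd U" using U.ltD c_not_U[OF assms] by blast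
  moreover have "b' = b" if "b' \<in> B" "c h b \<in> Br b' \<union> Up b'" for b'
    using that c_eq[of h b _ b'] assms c_not_U[OF assms] U.ltD[of "c h b" b'] UpD[of b' "c h b"]
    by (auto simp: Br_def)
  moreover have "ht u < h" if "(u, c h b) \<in> snd W"
    using that T.ltD[of u "c h b"] U.ltD[of u "c h b"] c_ht[OF assms] by (auto simp: W_def)
  ultimately have "u \<in> Br b \<and> ht u < h" if "(u, c h b) \<in> snd W" using that by (auto simp: W_def)
  moreover have "(u, c h b) \<in> snd W" if "u \<in> Br b \<and> ht u < h"
    using that cb assms(2) c_ht[OF assms] by (auto simp: W_def)
  ultimately show ?thesis by blast
qed

lemma pred_top:
  assumes "b \<in> B" "v \<in> Up b"
  shows "(u, v) \<in> snd W \<longleftrightarrow> u \<in> Br b \<or> (u, v) \<in> snd U"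
proof -
  note v = UpD[OF assms]
  have "(u, v) \<notin> snd T" using T.ltD ht_less_q v leD by blast
  moreover have "b' = b" if "b' \<in> B" "v \<in> Br b' \<union> Up b'" for b'
    using that BrD[of b' v] v Up_unique[OF that(1) assms(1) _ assms(2)] by auto
  moreover have "ht u < ht v" if "u \<in> Br b"
    using BrD[OF assms(1) that] v by (metis less_le_trans)
  ultimately show ?thesis using assms unfolding snd_W by blast
qed

lemma Br_down: "b \<in> B \<Longrightarrow> v \<in> Br b \<Longrightarrow> (u, v) \<in> snd W \<Longrightarrow> u \<in> Br b"
proof -
  assume b: "b \<in> B" and v: "v \<in> Br b" and uv: "(u, v) \<in> snd W"
  show "u \<in> Br b"
  proof (cases "v \<in> fst T")
    case True
    then show ?thesis using Br_lower_T[OF b v] pred_T uv by blast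
  next
    case False
    then obtain h where "h \<in> Mid" "v = c h b"
      using v root_iff[of v] U.ltD[of v b] by (auto simp: Br_def)
    then show ?thesis using pred_mid b uv by blast
  qed
qed

lemma ltW_ht: "(u, v) \<in> snd W \<Longrightarrow> u \<in> fst W \<and> v \<in> fst W \<and> ht u < ht v"
proof -
  assume "(u, v) \<in> snd W"
  then consider "(u, v) \<in> snd T" | "(u, v) \<in> snd U"
    | b where "b \<in> B" "u \<in> Br b" "v \<in> Br b \<union> Up b" "ht u < ht v"
    by (auto simp: W_def)
  then show ?thesis
  proof cases
    case 3
    then show ?thesis using Br_W UpD[of b v] by (auto simp: W_def)
  qed (use T.ltD U.ltD in \<open>auto simp: W_def\<close>)
qed

lemma heights_W: "h \<in> ht ` fst W \<longleftrightarrow> h \<in> ht ` fst T \<or> h \<in> ht ` fst U"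
  using c_ht MidD by (fastforce simp: W_def)

lemma heights_low: "h \<in> ht ` fst W \<Longrightarrow> h < q \<Longrightarrow> h \<in> ht ` fst T \<and> (h < p \<and> h \<in> ht ` fst U \<or> h \<in> Mid)"
proof -
  assume h: "h \<in> ht ` fst W" "h < q"
  have hT: "h \<in> ht ` fst T" using h U_cases root_iff by (auto simp: heights_W not_le[symmetric])
  then show ?thesis using root_iff MidI by (cases "h < p") (auto simp: not_less)
qed

lemma tree_W: "standard_finite_tree W"
proof (rule standard_finite_treeI)
  have "finite Mid" using T.finite_tree by (auto simp: Mid_def heights_def)
  then show "finite (fst W)"
    using T.finite_tree U.finite_tree U.finite_level by (auto simp: W_def)
  show "0 \<in> fst W" using T.zero_mem by (simp add: W_def)
  show "v = 0 \<or> omega \<le> v" if "v \<in> fst W" for v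
    using that
  proof (cases v rule: W_cases)
    case (mid h b)
    then have "ht v \<noteq> 0" using c_ht MidD[of h] p_pos by auto
    then show ?thesis using ht_eq_zero_iff not_le by blast
  qed (use T.mem_cases U.mem_cases in blast)+
  show "u \<in> fst W \<and> v \<in> fst W \<and> ht u < ht v" if "(u, v) \<in> snd W" for u v
    using ltW_ht[OF that] .
  show "trans (snd W)"
  proof (rule transI)
    fix u v w assume uv: "(u, v) \<in> snd W" and vw: "(v, w) \<in> snd W"
    have "w \<in> fst W" using ltW_ht[OF vw] by blast
    then show "(u, w) \<in> snd W"
    proof (cases w rule: W_cases)
      case T
      then show ?thesis using uv vw pred_T T.ltD T.lt_trans by metis
    next
      case (mid h b)
      then have "v \<in> Br b" "ht v < h" using pred_mid vw by blast+
      then show ?thesis using Br_down[OF mid(2) _ uv] pred_mid mid ltW_ht[OF uv] by auto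
    next
      case (top b)
      show ?thesis
      proof (cases "v \<in> Br b")
        case True
        then show ?thesis using Br_down[OF top(3) _ uv] pred_top[OF top(3,4)] by blast
      next
        case False
        then have vwU: "(v, w) \<in> snd U" using pred_top[OF top(3,4)] vw by blast
        \<comment> \<open>A predecessor of \<open>w\<close> in \<open>U\<close> of height below
          \<open>q\<close> would belong to \<open>Br b\<close>.\<close>
        then have "q \<le> ht v" using Br_root_iff[OF _ _ top(3,4), of v] False U.ltD not_le by blast
        then obtain b' where b': "b' \<in> B" "v \<in> Up b'" using ex_Up U.ltD[OF vwU] by blast
        then have "w \<in> Up b'" using vwU U.lt_trans by (auto simp: Up_def)
        then have "b' = b" using Up_unique b' top by blast
        then show ?thesis using pred_top[OF b'] pred_top[OF top(3,4)] uv vwU U.lt_trans by blast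
      qed
    qed
  qed
  show "u = w" if uv: "(u, v) \<in> snd W" "(w, v) \<in> snd W" "ht u = ht w" for u v w
  proof -
    have "v \<in> fst W" using ltW_ht[OF uv(1)] by blast
    then show ?thesis
    proof (cases v rule: W_cases)
      case T
      then show ?thesis using uv pred_T T.lt_unique by blast
    next
      case (mid h b)
      then show ?thesis using uv pred_mid Br_unique by blast
    next
      case (top b)
      \<comment> \<open>Whether a predecessor of a top node comes from \<open>Br b\<close> or from
        \<open>U\<close> above it depends only on its height, so two of equal height come from the
        same side.\<close>
      have "z \<in> Br b \<longleftrightarrow> ht z < q" if "(z, v) \<in> snd W" for z
        using that pred_top[OF top(3,4)] BrD[OF top(3)] Br_root_iff[OF _ _ top(3,4), of z] U.ltD by blast
      then show ?thesis using uv pred_top[OF top(3,4)] Br_unique[OF top(3)] U.lt_unique by metis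
    qed
  qed
  show "\<exists>u. (u, v) \<in> snd W \<and> ht u = h" if v: "v \<in> fst W" and h: "h \<in> ht ` fst W" "h < ht v" for v h
  proof -
    have Br: "\<exists>u\<in>Br b. ht u = h" if "b \<in> B" "h < q" for b
    proof (cases "h < p")
      case True
      then obtain u where "(u, b) \<in> snd U" "ht u = h"
        using heights_low[OF h(1) \<open>h < q\<close>] MidD U.below[of b h] BD[OF \<open>b \<in> B\<close>] \<open>h < q\<close> by force
      then show ?thesis using True by (auto simp: Br_def)
    next
      case False
      then have "h \<in> Mid" using heights_low[OF h(1) \<open>h < q\<close>] by blast
      then show ?thesis using c_ht[OF _ \<open>b \<in> B\<close>] by (auto simp: Br_def)
    qed
    from v show ?thesis
    proof (cases v rule: W_cases)
      case T
      then have "h < q" using ht_less_q[OF T] h(2) by simp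
      then have "h \<in> ht ` fst T" using heights_low h(1) by blast
      then show ?thesis using T.below[OF T] h(2) pred_T[OF T] by metis
    next
      case (mid h' b)
      then have "h < h'" "h < q" using h(2) c_ht[OF mid(1,2)] MidD[OF mid(1)] by auto
      then show ?thesis using Br[OF mid(2)] pred_mid[OF mid(1,2)] mid(3) by blast
    next
      case (top b)
      show ?thesis
      proof (cases "h < q")
        case True
        then show ?thesis using Br[OF top(3)] pred_top[OF top(3,4)] by blast
      next
        case False
        then have "h \<in> ht ` fst U" using h(1) ht_less_q by (auto simp: heights_W)
        then show ?thesis using U.below[OF top(1)] h(2) pred_top[OF top(3,4)] by blast
      qed
    qed
  qed
qed

end

section \<open>The amalgamated functions\<close>

lemma strongerI:
  assumes "fst T \<subseteq> fst U" "snd T \<subseteq> snd U" "dom F \<subseteq> dom G"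
    and ext: "\<And>l u v. edge F l u v \<Longrightarrow> edge G l u v"
    and agree: "\<And>\<gamma> \<tau> u v. \<gamma> \<in> dom F \<Longrightarrow> \<tau> \<in> dom F \<Longrightarrow> \<gamma> \<noteq> \<tau> \<Longrightarrow> edge G (\<gamma>, True) u v \<Longrightarrow>
      edge G (\<tau>, True) u v \<Longrightarrow>
      \<exists>z w. (u = z \<or> (u, z) \<in> snd U) \<and> z \<in> fst T \<and> edge F (\<gamma>, True) z w \<and> edge F (\<tau>, True) z w"
  shows "stronger (U, G) (T, F)"
proof -
  have "the (F \<gamma>) \<subseteq>\<^sub>m the (G \<gamma>)" if "\<gamma> \<in> dom F" for \<gamma>
    unfolding map_le_def
  proof
    fix u assume "u \<in> dom (the (F \<gamma>))"
    then obtain v where v: "the (F \<gamma>) u = Some v" by blast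
    then have "edge G (\<gamma>, True) u v" using ext[of "(\<gamma>, True)" u v] that by (auto simp: edge_def)
    then show "the (F \<gamma>) u = the (G \<gamma>) u" using v by (simp add: edge_def)
  qed
  moreover have "\<exists>z\<in>fst T. (u = z \<or> (u, z) \<in> snd U) \<and> z \<in> dom (the (F \<gamma>)) \<inter> dom (the (F \<tau>)) \<and>
      the (F \<gamma>) z = the (F \<tau>) z"
    if \<gamma>\<tau>: "\<gamma> \<in> dom F" "\<tau> \<in> dom F" "\<gamma> \<noteq> \<tau>" and u: "u \<in> dom (the (G \<gamma>)) \<inter> dom (the (G \<tau>))"
      "the (G \<gamma>) u = the (G \<tau>) u" for \<gamma> \<tau> u
  proof -
    obtain v where "the (G \<gamma>) u = Some v" "the (G \<tau>) u = Some v" using u by auto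
    then have "edge G (\<gamma>, True) u v" "edge G (\<tau>, True) u v"
      using \<gamma>\<tau>(1,2) assms(3) by (auto simp: edge_def)
    then obtain z w where "(u = z \<or> (u, z) \<in> snd U) \<and> z \<in> fst T \<and> edge F (\<gamma>, True) z w \<and>
        edge F (\<tau>, True) z w"
      using agree[OF \<gamma>\<tau>] by blast
    then show ?thesis by (intro bexI[of _ z]) (auto simp: edge_def)
  qed
  ultimately show ?thesis using assms(1-3) by (simp add: stronger_def tree_extends_def)
qed

context branched_amalgamation
begin

definition E :: "omega2 \<times> bool \<Rightarrow> omega1 \<Rightarrow> omega1 \<Rightarrow> bool"
  where "E l u v \<longleftrightarrow> edge F l u v \<or> edge G l u v \<or>
    (\<exists>h\<in>Mid. \<exists>b\<in>B. \<exists>b'\<in>B. edge G l b b' \<and> u = c h b \<and> v = c h b')"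

lemma E_cases [consumes 1, case_names F G copy]:
  assumes "E l u v"
  obtains "edge F l u v" | "edge G l u v" "ht u < p \<or> q \<le> ht u"
    | h b b' where "h \<in> Mid" "b \<in> B" "b' \<in> B" "edge G l b b'" "u = c h b" "v = c h b'"
  using assms U.edgeD U_cases unfolding E_def by blast

lemma E_flip: "E (\<tau>, s) u v \<Longrightarrow> E (\<tau>, \<not> s) v u"
  unfolding E_def using edge_flip by metis

lemma edge_dom: "edge F l u v \<Longrightarrow> fst l \<in> dom F" "edge G l u v \<Longrightarrow> fst l \<in> dom G"
  by (auto simp: edge_def)

lemma E_dom: "E l u v \<Longrightarrow> fst l \<in> dom F \<union> dom G"
  by (auto simp: E_def dest: edge_dom)

lemma E_mem:
  assumes "E l u v"
  shows "u \<in> fst W \<and> v \<in> fst W \<and> ht v = ht u"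
  using assms
proof (cases rule: E_cases)
  case F
  show ?thesis using T.edgeD[OF F] by (simp add: W_def)
next
  case G
  show ?thesis using U.edgeD[OF G(1)] by (simp add: W_def)
next
  case (copy h b b')
  then show ?thesis using c_ht by (auto simp: W_def)
qed

lemma edge_B: "edge G l b b' \<Longrightarrow> b \<in> B \<Longrightarrow> b' \<in> B \<and> b \<noteq> b'"
  using U.edgeD[of l b b'] U.edge_ne[of l b b'] BD[of b] by (auto simp: level_def)

lemma E_ne:
  assumes "E l u v" "u \<noteq> 0"
  shows "u \<noteq> v"
  using assms(1)
proof (cases rule: E_cases)
  case (copy h b b')
  then show ?thesis using edge_B c_eq by blast
qed (use T.edge_ne U.edge_ne assms(2) in blast)+

lemma E_mid:
  assumes "h \<in> Mid" "b \<in> B"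
  shows "E l (c h b) v \<longleftrightarrow> edge F l (c h b) v \<or> (\<exists>b'\<in>B. v = c h b' \<and> edge G l b b')"
proof
  assume "E l (c h b) v"
  then show "edge F l (c h b) v \<or> (\<exists>b'\<in>B. v = c h b' \<and> edge G l b b')"
  proof (cases rule: E_cases)
    case G
    then show ?thesis using U.edgeD c_not_U assms by blast
  next
    case (copy h' d d')
    then show ?thesis using c_eq[of h b h' d] assms by blast
  qed simp
next
  assume "edge F l (c h b) v \<or> (\<exists>b'\<in>B. v = c h b' \<and> edge G l b b')"
  then show "E l (c h b) v" using assms unfolding E_def by blast
qed

lemma E_top: "q \<le> ht u \<Longrightarrow> E l u v \<longleftrightarrow> edge G l u v"
proof
  assume u: "q \<le> ht u" and "E l u v"
  from this(2) show "edge G l u v"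
  proof (cases rule: E_cases)
    case F
    then show ?thesis using u T.edgeD[OF F] ht_less_q leD by blast
  next
    case (copy h b b')
    then show ?thesis using u c_ht[OF copy(1,2)] MidD[OF copy(1)] by auto
  qed simp
qed (simp add: E_def)

lemma E_root: "ht u < p \<Longrightarrow> E l u v \<longleftrightarrow> edge F l u v \<or> edge G l u v"
proof
  assume u: "ht u < p" and "E l u v"
  from this(2) show "edge F l u v \<or> edge G l u v"
  proof (cases rule: E_cases)
    case (copy h b b')
    then show ?thesis using u c_ht[OF copy(1,2)] MidD[OF copy(1)] by auto
  qed simp_all
qed (auto simp: E_def)

text \<open>The delicate case is a middle node \<open>c h b\<close> with an arrow of
  \<open>F\<close> and a copied arrow under the same label. That label lies in \<open>A\<close>, and
  \<open>c_closed\<close> shows the arrow of \<open>F\<close> to be a copy as well. In the root, a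
  label in \<open>A\<close> has the same arrows on both sides by \<open>root_edge\<close>.\<close>

lemma E_fun:
  assumes "E l u v" "E l u w"
  shows "v = w"
proof -
  consider "q \<le> ht u" | "ht u < p" | h b where "h \<in> Mid" "b \<in> B" "u = c h b"
    | "edge F l u v" "edge F l u w"
    using assms(1)
  proof (cases rule: E_cases)
    case F
    from assms(2) show ?thesis by (cases rule: E_cases) (use F that in blast)+
  qed (use that in blast)+
  then show ?thesis
  proof cases
    case 1
    then show ?thesis using assms E_top U.edge_fun by blast
  next
    case 2
    have e: "edge F l u v \<or> edge G l u v" "edge F l u w \<or> edge G l u w"
      using assms E_root[OF 2] by blast+
    have "(edge F l u v \<and> edge F l u w) \<or> (edge G l u v \<and> edge G l u w)"
    proof (cases "fst l \<in> A")
      case True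
      then show ?thesis using e root_edge[OF True 2] by simp
    next
      case False
      then show ?thesis using e edge_dom[of l u] by blast
    qed
    then show ?thesis using T.edge_fun[of l u v w] U.edge_fun[of l u v w] by blast
  next
    case (3 h b)
    note * = E_mid[OF 3(1,2)]
    show ?thesis
    proof (cases "edge F l u v \<and> edge F l u w")
      case False
      then have "fst l \<in> dom G" using assms * edge_dom(2) unfolding 3(3) by blast
      then have "\<exists>b'\<in>B. z = c h b' \<and> edge G l b b'" if "E l u z" for z
        using c_closed[OF 3(1,2)] that * edge_dom(1) unfolding 3(3) by blast
      then show ?thesis using assms U.edge_fun by blast
    qed (use T.edge_fun in blast)
  qed (rule T.edge_fun)
qed

lemma E_down:
  assumes "E l u v" "h \<in> heights W" "h < ht u"
  shows "\<exists>u' v'. (u', u) \<in> snd W \<and> (v', v) \<in> snd W \<and> ht u' = h \<and> E l u' v'"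
proof -
  have h: "h \<in> ht ` fst W" "h \<noteq> 0" using assms(2) by (auto simp: heights_def)
  have sub: "snd T \<subseteq> snd W" "snd U \<subseteq> snd W" by (auto simp: W_def)
  \<comment> \<open>An arrow between vertices of \<open>B\<close> projects along their branches:
    inside \<open>U\<close> below height \<open>p\<close>, and to its copies from \<open>p\<close>
    on.\<close>
  have B_edge: "\<exists>u' v'. u' \<in> Br b \<and> v' \<in> Br b' \<and> ht u' = h \<and> ht v' = h \<and> E l u' v'"
    if b: "b \<in> B" "edge G l b b'" "h < q" for b b'
  proof (cases "h < p")
    case True
    then have "h \<in> heights U" using heights_low[OF h(1) b(3)] h(2) MidD[of h] by (auto simp: heights_def)
    then obtain u' v' where uv: "(u', b) \<in> snd U" "(v', b') \<in> snd U" "ht u' = h" "ht v' = h" "edge G l u' v'"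
      using U.edge_down[OF b(2)] BD[OF b(1)] b(3) by metis
    then have "u' \<in> Br b" "v' \<in> Br b'" "E l u' v'" using True by (simp_all add: Br_def E_def)
    then show ?thesis using uv by blast
  next
    case False
    then have "h \<in> Mid" using heights_low[OF h(1) b(3)] by blast
    then have "c h b \<in> Br b" "c h b' \<in> Br b'" "ht (c h b) = h" "ht (c h b') = h" "E l (c h b) (c h b')"
      using b edge_B[OF b(2,1)] c_ht by (auto simp: Br_def E_mid)
    then show ?thesis by blast
  qed
  from assms(1) show ?thesis
  proof (cases rule: E_cases)
    case F
    then have "h < q" using assms(3) T.edgeD[OF F] ht_less_q less_trans by blast
    then have "h \<in> heights T" using heights_low[OF h(1)] h(2) by (auto simp: heights_def)
    then obtain u' v' where "(u', u) \<in> snd T" "(v', v) \<in> snd T" "ht u' = h" "edge F l u' v'"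
      using T.edge_down[OF F _ assms(3)] by metis
    moreover from this have "E l u' v'" by (simp add: E_def)
    ultimately show ?thesis using sub by blast
  next
    case G
    show ?thesis
    proof (cases "h \<in> heights U")
      case True
      then obtain u' v' where "(u', u) \<in> snd U" "(v', v) \<in> snd U" "ht u' = h" "edge G l u' v'"
        using U.edge_down[OF G(1) _ assms(3)] by metis
      moreover from this have "E l u' v'" by (simp add: E_def)
      ultimately show ?thesis using sub by blast
    next
      case False
      \<comment> \<open>Here \<open>h\<close> is a height of \<open>T\<close> only, hence a middle
        height. The arrow is first projected to level \<open>q\<close> of \<open>U\<close> and from
        there along the branches.\<close>
      then have hT: "h \<in> ht ` fst T" using h heights_W by (auto simp: heights_def)
      then have hq: "h < q" using ht_less_q by auto
      have "\<not> h < p" using False heights_low[OF h(1) hq] h(2) MidD[of h] by (auto simp: heights_def)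
      then have u: "q \<le> ht u" using G(2) assms(3) by auto
      note uv = U.edgeD[OF G(1)]
      obtain b where b: "b \<in> B" "u \<in> Up b" using ex_Up uv u by blast
      obtain b' where b': "v \<in> Up b'" "edge G l b b'"
      proof (cases "u = b")
        case True
        then show ?thesis using that[of v] G(1) by (auto simp: Up_def)
      next
        case False
        then have bu: "(b, u) \<in> snd U" using b(2) by (auto simp: Up_def)
        then have "q < ht u" using U.ltD BD[OF b(1)] by metis
        then obtain u' v' where u': "(u', u) \<in> snd U" "(v', v) \<in> snd U" "ht u' = q" "edge G l u' v'"
          using U.edge_down[OF G(1) q] by metis
        then have "u' = b" using U.lt_unique[OF u'(1) bu] BD[OF b(1)] by simp
        then show ?thesis using that[of v'] u' by (auto simp: Up_def)
      qed
      then have "b' \<in> B" using edge_B b by blast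
      then show ?thesis using B_edge[OF b(1) b'(2) hq] pred_top[OF b] pred_top[OF _ b'(1)] by blast
    qed
  next
    case (copy h' b b')
    then have "h < h'" "h < q" using assms(3) c_ht MidD less_trans by metis+
    then obtain u' v' where "u' \<in> Br b" "v' \<in> Br b'" "ht u' = h" "ht v' = h" "E l u' v'"
      using B_edge[OF copy(2,4)] by blast
    moreover from this have "(u', u) \<in> snd W" "(v', v) \<in> snd W"
      using pred_mid[OF copy(1,2)] pred_mid[OF copy(1,3)] \<open>h < h'\<close> copy(5,6) by simp_all
    ultimately show ?thesis by blast
  qed
qed

text \<open>The numbering of \<open>T\<close> works, since by \<open>root_type\<close> each
  neighbour along \<open>G\<close> is also a neighbour along \<open>F\<close>. For parallel labels
  on different sides, either one of them lies in \<open>A\<close>, so that both arrows occur in one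
  condition, or \<open>rho_mixed\<close> applies.\<close>

lemma forest_root:
  assumes \<alpha>: "\<alpha> \<in> heights W" "\<alpha> < p"
  shows "\<exists>pos. forest_order E (\<lambda>\<tau> \<zeta>. \<alpha> \<le> \<rho> \<tau> \<zeta>) pos (level W \<alpha>)"
proof -
  have \<alpha>T: "\<alpha> \<in> heights T" and \<alpha>U: "\<alpha> \<in> heights U"
    using heights_low[of \<alpha>] \<alpha> p_less_q less_trans[OF \<alpha>(2) p_less_q] MidD[of \<alpha>]
    by (auto simp: heights_def)
  have lev: "level W \<alpha> = level T \<alpha>"
    using \<alpha>(2) root_iff c_ht MidD by (fastforce simp: level_def W_def)
  obtain posT where posT: "forest_order (edge F) (\<lambda>\<tau> \<zeta>. \<alpha> \<le> \<rho> \<tau> \<zeta>) posT (level T \<alpha>)"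
    using T.ex_forest_order[OF \<alpha>T] by blast
  have "forest_vertex E (\<lambda>\<tau> \<zeta>. \<alpha> \<le> \<rho> \<tau> \<zeta>) a {u \<in> level T \<alpha>. posT u < posT a}"
    if a: "a \<in> level T \<alpha>" for a
    unfolding forest_vertex_def
  proof (intro ballI allI impI)
    fix u v l l'
    assume u: "u \<in> {u \<in> level T \<alpha>. posT u < posT a}" and v: "v \<in> {u \<in> level T \<alpha>. posT u < posT a}"
      and e: "E l a u" "E l' a v" and ne: "(u, l) \<noteq> (v, l')"
    have aT: "a \<in> fst T" "ht a = \<alpha>" using a by (auto simp: level_def)
    have star: "\<exists>m. edge F m a w" if "E l a w" for l w
    proof (cases "edge F l a w")
      case False
      then have "edge G l a w" using that E_root aT \<alpha>(2) by simp
      then show ?thesis using root_type[of "fst l"] edge_dom aT \<alpha>(2) by (metis prod.collapse)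
    qed blast
    have uv: "u = v" using star[OF e(1)] star[OF e(2)] forest_orderD(1)[OF posT a] u v by blast
    then have ne: "l \<noteq> l'" using ne by simp
    have mixed: "\<alpha> \<le> \<rho> (fst l) (fst l')"
      if "edge F l a u" "edge G l' a u" "l \<noteq> l'" for l l'
    proof -
      have "edge G l a u" if "fst l \<in> dom G"
        using root_edge[of l a u] that \<open>edge F l a u\<close> edge_dom aT \<alpha>(2) by auto
      moreover have "edge F l' a u" if "fst l' \<in> dom F"
        using root_edge[of l' a u] that \<open>edge G l' a u\<close> edge_dom aT \<alpha>(2) by auto
      ultimately show ?thesis
        using rho_mixed[of "fst l" "fst l'" a] T.parallel_edges[OF \<alpha>T aT(2)]
          U.parallel_edges[OF \<alpha>U aT(2)] that edge_dom aT \<alpha>(2) by blast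
    qed
    have "\<alpha> \<le> \<rho> (fst l) (fst l')"
      using e uv E_root[of a] aT \<alpha>(2) mixed[of l l'] mixed[of l' l] ne rho_sym[of "fst l"]
        T.parallel_edges[OF \<alpha>T aT(2)] U.parallel_edges[OF \<alpha>U aT(2)] by metis
    then show "u = v \<and> \<alpha> \<le> \<rho> (fst l) (fst l')" using uv by blast
  qed
  then show ?thesis using posT unfolding lev forest_order_def by blast
qed

lemma forest_top:
  assumes \<alpha>: "\<alpha> \<in> heights W" "q \<le> \<alpha>"
  shows "\<exists>pos. forest_order E (\<lambda>\<tau> \<zeta>. \<alpha> \<le> \<rho> \<tau> \<zeta>) pos (level W \<alpha>)"
proof -
  have "u \<notin> fst T" if "ht u = \<alpha>" for u using that ht_less_q \<alpha>(2) leD by blast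
  moreover have "ht (c h b) \<noteq> \<alpha>" if "h \<in> Mid" "b \<in> B" for h b
    using c_ht[OF that] MidD[OF that(1)] \<alpha>(2) by auto
  ultimately have lev: "level W \<alpha> = level U \<alpha>" unfolding level_def W_def by auto
  have "\<alpha> \<notin> ht ` fst T" using ht_less_q \<alpha>(2) leD by blast
  then have "\<alpha> \<in> ht ` fst U" using \<alpha>(1) heights_W by (simp add: heights_def)
  then have "\<alpha> \<in> heights U" using \<alpha>(1) by (simp add: heights_def)
  then obtain posU where posU: "forest_order (edge G) (\<lambda>\<tau> \<zeta>. \<alpha> \<le> \<rho> \<tau> \<zeta>) posU (level U \<alpha>)"
    using U.ex_forest_order by blast
  have "E l a u \<longleftrightarrow> edge G l a u" if "a \<in> level U \<alpha>" for l a u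
    using that E_top \<alpha>(2) by (auto simp: level_def)
  then have "forest_vertex E (\<lambda>\<tau> \<zeta>. \<alpha> \<le> \<rho> \<tau> \<zeta>) a X \<longleftrightarrow>
      forest_vertex (edge G) (\<lambda>\<tau> \<zeta>. \<alpha> \<le> \<rho> \<tau> \<zeta>) a X" if "a \<in> level U \<alpha>" for a X
    using that by (simp add: forest_vertex_def)
  then have "forest_order E (\<lambda>\<tau> \<zeta>. \<alpha> \<le> \<rho> \<tau> \<zeta>) posU (level U \<alpha>)"
    using posU by (simp add: forest_order_def)
  then show ?thesis using lev by auto
qed

text \<open>The later of \<open>b\<close> and \<open>b'\<close> is not \<open>b0\<close> and its
  node lies in \<open>T\<close>, so by \<open>c_parent\<close> an arrow with label in
  \<open>A\<close> leads to its parent. The parent is the other vertex, because the earlier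
  neighbour in \<open>B\<close> is unique. These common arrows are what the two forests are glued
  along.\<close>

lemma copy_parallel:
  assumes h: "h \<in> Mid" and b: "b \<in> B" "b' \<in> B" "edge G l b b'" "c h b \<in> fst T" "c h b' \<in> fst T"
  obtains m where "fst m \<in> A" "edge G m b b'" "edge F m (c h b) (c h b')"
proof -
  have *: "\<exists>m. fst m \<in> A \<and> edge G m d d' \<and> edge F m (c h d) (c h d')"
    if d: "d \<in> B" "d' \<in> B" "edge G l d d'" "c h d \<in> fst T" "pos d' < pos d" for d d' l
  proof -
    have "d \<noteq> b0" using d(5) pos_b0[OF d(2)] by auto
    then obtain d'' m where m: "d'' \<in> B" "c h d'' \<in> fst T" "pos d'' < pos d" "fst m \<in> A" "edge G m d d''"
      "edge F m (c h d) (c h d'')"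
      using c_parent[OF h d(1,4)] by blast
    have "d' = d''" using forest_orderD(1)[OF pos d(1,2) m(1) d(5) m(3) d(3) m(5)] .
    then show ?thesis using m by blast
  qed
  have "pos b \<noteq> pos b'" using pos b edge_B[OF b(3,1)] by (auto simp: forest_order_def inj_on_def)
  then consider "pos b' < pos b" | "pos b < pos b'" by linarith
  then show thesis
  proof cases
    case 1
    then show ?thesis using *[OF b(1-4)] that by blast
  next
    case 2
    have "edge G (fst l, \<not> snd l) b' b" using b(3) edge_flip'(2) by blast
    then obtain m where "fst m \<in> A" "edge G m b' b" "edge F m (c h b') (c h b)"
      using *[OF b(2,1) _ b(5) 2] by blast
    then show ?thesis using that[of "(fst m, \<not> snd m)"] edge_flip' by auto
  qed
qed

text \<open>Two arrows of \<open>F\<close>, or two copies, are separated by their own condition. An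
  arrow of \<open>F\<close> and a copy are compared through the arrow \<open>m\<close> from
  \<open>copy_parallel\<close>, which is parallel to both.\<close>

lemma mid_parallel:
  assumes \<alpha>: "\<alpha> \<in> Mid" and a: "a \<in> fst T" "ht a = \<alpha>" "u \<in> fst T" "E l a u" "E l' a u" "l \<noteq> l'"
  shows "\<alpha> \<le> \<rho> (fst l) (fst l')"
proof -
  have \<alpha>T: "\<alpha> \<in> heights T" "\<alpha> < q" using \<alpha> MidD by blast+
  have aU: "\<not> (ht a < p \<or> q \<le> ht a)" using a(2) MidD[OF \<alpha>] by auto
  have par: "\<alpha> \<le> \<rho> (fst l) (fst l')" if "b \<in> B" "edge G l b b'" "edge G l' b b'" "l \<noteq> l'" for b b' l l'
    using U.parallel_edges[OF q _ that(2-4)] BD[OF that(1)] \<alpha>T(2) by auto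
  have mixed: "\<alpha> \<le> \<rho> (fst l) (fst l')"
    if F: "edge F l a u" and G: "edge G l' b b'" and b: "b \<in> B" "b' \<in> B" "a = c \<alpha> b" "u = c \<alpha> b'"
      and ne: "l \<noteq> l'" for l l' b b'
  proof -
    obtain m where m: "fst m \<in> A" "edge G m b b'" "edge F m a u"
      using copy_parallel[OF \<alpha> b(1,2) G] a(1,3) b(3,4) by blast
    consider "l = m" | "l' = m" | "l \<noteq> m" "l' \<noteq> m" by blast
    then show ?thesis
    proof cases
      case 1
      then show ?thesis using par[OF b(1) _ G ne] m(2) by blast
    next
      case 2
      then show ?thesis using T.parallel_edges[OF \<alpha>T(1) a(2) F _ ne] m(3) by blast
    next
      case 3
      \<comment> \<open>Being different from \<open>m\<close>, neither label can lie in
        \<open>A\<close>, as labels in \<open>A\<close> are not parallel here. So the two indices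
        lie on different sides of \<open>A\<close>, and \<open>rho_mixed_min\<close> applies with
        both rho-distances to \<open>m\<close> at least \<alpha>.\<close>
      have "fst l \<notin> dom G"
        using A_unique_T[OF F m(3) _ m(1)] 3(1) edge_dom(1)[OF F] a(2) MidD[OF \<alpha>] by blast
      moreover have "fst l' \<notin> dom F"
        using A_unique_U[OF G m(2) _ m(1)] 3(2) edge_dom(2)[OF G] BD[OF b(1)] by blast
      moreover have "\<alpha> \<le> \<rho> (fst l) (fst m)"
        using T.parallel_edges[OF \<alpha>T(1) a(2) F m(3) 3(1)] .
      moreover have "\<alpha> \<le> \<rho> (fst l') (fst m)" using par[OF b(1) G m(2) 3(2)] .
      moreover have "fst l \<in> dom F" "fst l' \<in> dom G" using edge_dom F G by blast+
      ultimately show ?thesis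
        using rho_mixed_min[of "fst l" "fst l'" "fst m"] m(1) by (meson DiffI min.boundedI order.trans)
    qed
  qed
  from a(4) show ?thesis
  proof (cases rule: E_cases)
    case F: F
    from a(5) show ?thesis
    proof (cases rule: E_cases)
      case (copy h b b')
      have "h = \<alpha>" using copy(5) a(2) c_ht[OF copy(1,2)] by simp
      then show ?thesis using mixed[OF F copy(4,2,3)] copy(5,6) a(6) by simp
    qed (use T.parallel_edges[OF \<alpha>T(1) a(2) F _ a(6)] aU in auto)
  next
    case (copy h b b')
    have h: "h = \<alpha>" using copy(5) a(2) c_ht[OF copy(1,2)] by simp
    from a(5) show ?thesis
    proof (cases rule: E_cases)
      case F
      then show ?thesis
        using mixed[OF F copy(4,2,3)] copy(5,6) h a(6) rho_sym[of "fst l"] by simp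
    next
      case c2: (copy h' d d')
      have "h' = \<alpha>" using c2(5) a(2) c_ht[OF c2(1,2)] by simp
      then have "d = b" "d' = b'"
        using c_eq[of h' d h b] c_eq[of h' d' h b'] c2(1-3,5,6) copy(1-3,5,6) by simp_all
      then show ?thesis using par[OF copy(2,4) _ a(6)] c2(4) by blast
    qed (use aU in blast)
  qed (use aU in blast)
qed

text \<open>The nodes of \<open>T\<close> come first, numbered as in \<open>T\<close>, then the new
  nodes, numbered as their vertices in \<open>B\<close>. Before a node of \<open>T\<close> there are
  only nodes of \<open>T\<close>, and arrows to them are parallel to arrows of \<open>F\<close>. A
  new node has only copied arrows, and its earlier neighbours come from earlier vertices of
  \<open>B\<close>.\<close>

lemma forest_mid:
  assumes \<alpha>: "\<alpha> \<in> Mid"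
  shows "\<exists>pos. forest_order E (\<lambda>\<tau> \<zeta>. \<alpha> \<le> \<rho> \<tau> \<zeta>) pos (level W \<alpha>)"
proof -
  have \<alpha>T: "\<alpha> \<in> heights T" "\<alpha> < q" "p \<le> \<alpha>" using \<alpha> MidD by blast+
  have level_W: "v \<in> level W \<alpha> \<longleftrightarrow> v \<in> level T \<alpha> \<or> v \<in> c \<alpha> ` B" for v
    using c_ht \<alpha> U_cases[of v] \<alpha>T(2,3) by (auto simp: level_def W_def)
  obtain posT where posT: "forest_order (edge F) (\<lambda>\<tau> \<zeta>. \<alpha> \<le> \<rho> \<tau> \<zeta>) posT (level T \<alpha>)"
    using T.ex_forest_order[OF \<alpha>T(1)] by blast
  obtain N where N: "\<And>u. u \<in> level T \<alpha> \<Longrightarrow> posT u < N"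
    using finite_nat_set_iff_bounded[of "posT ` level T \<alpha>"] T.finite_level by auto
  define posW where "posW v = (if v \<in> fst T then posT v else N + pos (inv_into B (c \<alpha>) v))" for v
  have posW_T: "posW v = posT v" if "v \<in> level T \<alpha>" for v
    using that by (simp add: posW_def level_def)
  have posW_c: "posW (c \<alpha> b) = N + pos b" if "b \<in> B" "c \<alpha> b \<notin> fst T" for b
    using that inv_into_f_f[OF c_inj[OF \<alpha>]] by (simp add: posW_def)
  have lev_cases: "(v \<in> level T \<alpha> \<and> v \<in> fst T \<and> ht v = \<alpha>) \<or> (\<exists>b\<in>B. v = c \<alpha> b \<and> c \<alpha> b \<notin> fst T)"
    if "v \<in> level W \<alpha>" for v
    using that level_W[of v] c_ht[OF \<alpha>] by (auto simp: level_def)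
  have "inj_on posW (level W \<alpha>)"
  proof (rule inj_onI)
    fix u v assume uv: "u \<in> level W \<alpha>" "v \<in> level W \<alpha>" "posW u = posW v"
    have injT: "inj_on posT (level T \<alpha>)" and injU: "inj_on pos B"
      using posT pos by (auto simp: forest_order_def)
    have lt: "posW w < N" if "w \<in> level T \<alpha>" for w
      using that N posW_T by simp
    show "u = v"
      using lev_cases[OF uv(1)] lev_cases[OF uv(2)]
    proof (elim disjE bexE conjE)
      assume "u \<in> level T \<alpha>" "v \<in> level T \<alpha>"
      then show ?thesis using uv(3) posW_T injT by (auto dest: inj_onD)
    next
      fix b assume "u \<in> level T \<alpha>" "b \<in> B" "v = c \<alpha> b" "c \<alpha> b \<notin> fst T"
      then show ?thesis using uv(3) lt[of u] posW_c[of b] by simp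
    next
      fix b assume "v \<in> level T \<alpha>" "b \<in> B" "u = c \<alpha> b" "c \<alpha> b \<notin> fst T"
      then show ?thesis using uv(3) lt[of v] posW_c[of b] by simp
    next
      fix b d assume "b \<in> B" "u = c \<alpha> b" "c \<alpha> b \<notin> fst T" "d \<in> B" "v = c \<alpha> d" "c \<alpha> d \<notin> fst T"
      then show ?thesis using uv(3) posW_c[of b] posW_c[of d] injU by (auto dest: inj_onD)
    qed
  qed
  moreover have "forest_vertex E (\<lambda>\<tau> \<zeta>. \<alpha> \<le> \<rho> \<tau> \<zeta>) a {u \<in> level W \<alpha>. posW u < posW a}"
    if aW: "a \<in> level W \<alpha>" for a
    unfolding forest_vertex_def
  proof (intro ballI allI impI)
    fix u v l l'
    assume u: "u \<in> {u \<in> level W \<alpha>. posW u < posW a}" and v: "v \<in> {u \<in> level W \<alpha>. posW u < posW a}"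
      and e: "E l a u" "E l' a v" and ne: "(u, l) \<noteq> (v, l')"
    show "u = v \<and> \<alpha> \<le> \<rho> (fst l) (fst l')"
    proof (cases "a \<in> fst T")
      case True
      then have a: "a \<in> level T \<alpha>" "ht a = \<alpha>" using lev_cases[OF aW] by blast+
      have early: "w \<in> level T \<alpha> \<and> posT w < posT a" if "w \<in> level W \<alpha>" "posW w < posW a" for w
      proof -
        have "w \<in> level T \<alpha>"
          using lev_cases[OF that(1)] posW_c that(2) posW_T[OF a(1)] N[OF a(1)] by force
        then show ?thesis using that(2) posW_T a(1) by simp
      qed
      have star: "\<exists>m. edge F m a w" if "E l a w" "w \<in> fst T" for l w
        using that(1)
      proof (cases rule: E_cases)
        case G
        then show ?thesis using a(2) \<alpha>T by auto
      next
        case (copy h b b')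
        then show ?thesis using copy_parallel[OF copy(1-4)] True that(2) by metis
      qed blast
      have uT: "u \<in> level T \<alpha>" "posT u < posT a" "v \<in> level T \<alpha>" "posT v < posT a"
        using early u v by blast+
      obtain m m' where "edge F m a u" "edge F m' a v"
        using star[OF e(1)] star[OF e(2)] uT(1,3) unfolding level_def by blast
      then have "u = v" by (rule forest_orderD(1)[OF posT a(1) uT(1,3,2,4)])
      moreover have "\<alpha> \<le> \<rho> (fst l) (fst l')"
        using mid_parallel[OF \<alpha> True a(2) _ e(1), of l'] uT(1) e(2) ne \<open>u = v\<close> by (simp add: level_def)
      ultimately show ?thesis ..
    next
      case False
      then obtain b where b: "b \<in> B" "a = c \<alpha> b" "c \<alpha> b \<notin> fst T" using lev_cases[OF aW] by blast
      have nb: "\<exists>b'\<in>B. w = c \<alpha> b' \<and> edge G l b b' \<and> pos b' < pos b"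
        if e: "E l a w" and w: "posW w < posW a" for l w
      proof -
        have "\<not> edge F l a w" using T.edgeD b by blast
        then obtain b' where b': "b' \<in> B" "w = c \<alpha> b'" "edge G l b b'"
          using e E_mid[OF \<alpha> b(1)] unfolding b(2) by blast
        have npos: "pos b \<noteq> pos b'"
          using pos b(1) b'(1) edge_B[OF b'(3) b(1)] by (auto simp: forest_order_def inj_on_def)
        \<comment> \<open>If \<open>b'\<close> came after \<open>b\<close>, its node would be new
          and numbered after \<open>a\<close>, or it would lie in \<open>T\<close>. In the latter
          case the node of the parent of \<open>b'\<close> lies in \<open>T\<close>, too; but that
          parent would be \<open>b\<close>, whose node is new.\<close>
        have "\<not> pos b < pos b'"
        proof
          assume lt: "pos b < pos b'"
          show False
          proof (cases "w \<in> fst T")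
            case True
            have "b' \<noteq> b0" using lt pos_b0[OF b(1)] by auto
            then obtain b'' m where m: "b'' \<in> B" "c \<alpha> b'' \<in> fst T" "pos b'' < pos b'" "edge G m b' b''"
              using c_parent[OF \<alpha> b'(1)] True b'(2) by metis
            have "edge G (fst l, \<not> snd l) b' b" using b'(3) edge_flip'(2) by blast
            then have "b = b''" using forest_orderD(1)[OF pos b'(1) b(1) m(1) lt m(3) _ m(4)] by blast
            then show ?thesis using m(2) b(3) by blast
          next
            case False
            then show ?thesis using w lt posW_c[of b] posW_c[of b'] b b' by simp
          qed
        qed
        then show ?thesis using b' npos by auto
      qed
      obtain d where d: "d \<in> B" "u = c \<alpha> d" "edge G l b d" "pos d < pos b" using nb[OF e(1)] u by blast
      obtain d' where d': "d' \<in> B" "v = c \<alpha> d'" "edge G l' b d'" "pos d' < pos b" using nb[OF e(2)] v by blast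
      note D = forest_orderD[OF pos b(1) d(1) d'(1) d(4) d'(4) d(3) d'(3)]
      have "u = v" using D(1) d(2) d'(2) by simp
      moreover have "q \<le> \<rho> (fst l) (fst l')" using D(2) ne \<open>u = v\<close> by blast
      ultimately show ?thesis using \<alpha>T(2) by auto
    qed
  qed
  ultimately show ?thesis unfolding forest_order_def by blast
qed

section \<open>The amalgam as a common extension\<close>

definition H :: "omega2 \<rightharpoonup> pfun"
  where "H = family_of (dom F \<union> dom G) E"

lemma edge_H: "edge H = E"
  unfolding H_def using E_dom E_flip E_fun by (intro ext edge_family_of) blast+

lemma W_H_forcing: "(W, H) \<in> forcing_P \<rho>"
proof (rule forcing_PI[of W H, unfolded edge_H], rule tree_W)
  show "finite (dom H)" using T.finite_dom U.finite_dom by (simp add: H_def)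
  have "\<alpha> < p \<or> \<alpha> \<in> Mid \<or> q \<le> \<alpha>" if "\<alpha> \<in> heights W" for \<alpha>
    using that heights_low[of \<alpha>] by (auto simp: heights_def not_le[symmetric])
  then show "\<exists>pos. forest_order E (\<lambda>\<tau> \<zeta>. \<alpha> \<le> \<rho> \<tau> \<zeta>) pos (level W \<alpha>)"
    if "\<alpha> \<in> heights W" for \<alpha>
    using that forest_root forest_mid forest_top by metis
qed (use E_mem E_ne E_fun E_down in blast)+

text \<open>The witness is \<open>u\<close> itself, since both arrows already belong to
  \<open>F\<close>. A copied one has its index in \<open>A\<close>. The other cannot be a copy too,
  as labels in \<open>A\<close> are not parallel, so it is an arrow of \<open>F\<close> and both
  ends lie in \<open>T\<close>. Then \<open>copy_parallel\<close> and the same uniqueness put the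
  copied arrow into \<open>F\<close>.\<close>

lemma stronger_T: "stronger (W, H) (T, F)"
proof (rule strongerI, unfold edge_H)
  show "\<exists>z w. (u = z \<or> (u, z) \<in> snd W) \<and> z \<in> fst T \<and> edge F (\<gamma>, True) z w \<and> edge F (\<tau>, True) z w"
    if \<gamma>\<tau>: "\<gamma> \<in> dom F" "\<tau> \<in> dom F" "\<gamma> \<noteq> \<tau>" and e: "E (\<gamma>, True) u v" "E (\<tau>, True) u v" for \<gamma> \<tau> u v
  proof -
    have *: "edge F (\<gamma>, True) u v"
      if \<gamma>\<tau>: "\<gamma> \<in> dom F" "\<tau> \<in> dom F" "\<gamma> \<noteq> \<tau>" and e: "E (\<gamma>, True) u v" "E (\<tau>, True) u v" for \<gamma> \<tau>
      using e(1)
    proof (cases rule: E_cases)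
      case G
      then have \<gamma>: "\<gamma> \<in> A" using \<gamma>\<tau>(1) edge_dom(2)[OF G(1)] by simp
      show ?thesis
      proof (cases "ht u < p")
        case True
        then show ?thesis using root_edge[of "(\<gamma>, True)" u v] \<gamma> G(1) by simp
      next
        case False
        then have q: "q \<le> ht u" using G(2) by blast
        then have t: "edge G (\<tau>, True) u v" using e(2) E_top by blast
        have "(\<gamma>, True) = (\<tau>, True)"
          using A_unique_U[OF G(1) t _ _ q] \<gamma> \<gamma>\<tau>(2) edge_dom(2)[OF t] by simp
        then show ?thesis using \<gamma>\<tau>(3) by simp
      qed
    next
      case (copy h b b')
      then have \<gamma>: "\<gamma> \<in> A" using \<gamma>\<tau>(1) edge_dom(2)[OF copy(4)] by simp
      have nG: "\<not> edge G (\<tau>, True) b b'"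
      proof
        assume t: "edge G (\<tau>, True) b b'"
        have "(\<gamma>, True) = (\<tau>, True)"
          using A_unique_U[OF copy(4) t] BD[OF copy(2)] \<gamma> \<gamma>\<tau>(2) edge_dom(2)[OF t] by simp
        then show False using \<gamma>\<tau>(3) by simp
      qed
      have "edge F (\<tau>, True) (c h b) v \<or> (\<exists>d\<in>B. v = c h d \<and> edge G (\<tau>, True) b d)"
        using e(2) E_mid[OF copy(1,2)] copy(5) by simp
      then have "edge F (\<tau>, True) u v"
        using c_eq[of h _ h b'] copy nG by metis
      then have uv: "c h b \<in> fst T" "c h b' \<in> fst T" using T.edgeD copy(5,6) by blast+
      obtain m where m: "fst m \<in> A" "edge G m b b'" "edge F m (c h b) (c h b')"
        using copy_parallel[OF copy(1-4) uv] by blast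
      then have "m = (\<gamma>, True)" using A_unique_U[OF m(2) copy(4)] \<gamma> BD[OF copy(2)] by simp
      then show ?thesis using m(3) copy by simp
    qed
    have "edge F (\<gamma>, True) u v" "edge F (\<tau>, True) u v"
      using *[OF \<gamma>\<tau> e] *[OF \<gamma>\<tau>(2,1) _ e(2,1)] \<gamma>\<tau>(3) by auto
    then show ?thesis using T.edgeD by blast
  qed
qed (auto simp: W_def E_def H_def)

text \<open>In the root and at the top the witness is \<open>u\<close>. At a middle node
  \<open>c h b\<close> it is the vertex \<open>b\<close> above it: if one arrow is a copy,
  \<open>c_closed\<close> makes the other one a copy, while two arrows of \<open>F\<close> would be
  parallel with labels in \<open>A\<close>.\<close>

lemma stronger_U: "stronger (W, H) (U, G)"
proof (rule strongerI, unfold edge_H)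
  show "\<exists>z w. (u = z \<or> (u, z) \<in> snd W) \<and> z \<in> fst U \<and> edge G (\<gamma>, True) z w \<and> edge G (\<tau>, True) z w"
    if \<gamma>\<tau>: "\<gamma> \<in> dom G" "\<tau> \<in> dom G" "\<gamma> \<noteq> \<tau>" and e: "E (\<gamma>, True) u v" "E (\<tau>, True) u v" for \<gamma> \<tau> u v
  proof -
    have copy: ?thesis if h: "h \<in> Mid" "b \<in> B" "b' \<in> B" "u = c h b" "v = c h b'"
      and g: "edge G (\<gamma>, True) b b' \<or> edge G (\<tau>, True) b b'" for h b b'
    proof -
      have copied: "edge G (\<zeta>, True) b b'" if z: "\<zeta> \<in> dom G" "E (\<zeta>, True) u v" for \<zeta>
      proof -
        have "edge F (\<zeta>, True) (c h b) v \<or> (\<exists>d\<in>B. v = c h d \<and> edge G (\<zeta>, True) b d)"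
          using z(2) E_mid[OF h(1,2)] h(4) by simp
        then have "\<exists>d\<in>B. v = c h d \<and> edge G (\<zeta>, True) b d"
          using c_closed[OF h(1,2), of "(\<zeta>, True)" v] edge_dom(1)[of "(\<zeta>, True)"] z(1) by auto
        then show ?thesis using c_eq[of h _ h b'] h by metis
      qed
      have "b \<in> Up b" by (simp add: Up_def)
      moreover have "u \<in> Br b" using h by (auto simp: Br_def)
      ultimately have "(u, b) \<in> snd W" using pred_top h(2) by blast
      then show ?thesis using copied \<gamma>\<tau> e BD[OF h(2)] by blast
    qed
    consider "ht u < p" | "q \<le> ht u" | "p \<le> ht u" "ht u < q" by fastforce
    then show ?thesis
    proof cases
      case 1
      have "edge G (\<zeta>, True) u v" if "\<zeta> \<in> dom G" "E (\<zeta>, True) u v" for \<zeta>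
        using that E_root[OF 1] root_edge[of "(\<zeta>, True)" u v] 1 edge_dom(1)[of "(\<zeta>, True)"] by auto
      then show ?thesis using \<gamma>\<tau> e U.edgeD by blast
    next
      case 2
      then show ?thesis using e E_top U.edgeD by blast
    next
      case 3
      have notG: "\<not> (ht u < p \<or> q \<le> ht u)" using 3 by auto
      show ?thesis
      proof (cases "edge F (\<gamma>, True) u v \<and> edge F (\<tau>, True) u v")
        case True
        then have "(\<gamma>, True) = (\<tau>, True)"
          using A_unique_T[of "(\<gamma>, True)" u v "(\<tau>, True)"] 3(1) \<gamma>\<tau> edge_dom(1)[of _ u v] by force
        then show ?thesis using \<gamma>\<tau>(3) by simp
      next
        case False
        then obtain h b b' where "h \<in> Mid" "b \<in> B" "b' \<in> B" "u = c h b" "v = c h b'"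
          "edge G (\<gamma>, True) b b' \<or> edge G (\<tau>, True) b b'"
          using e notG by (metis E_cases)
        then show ?thesis by (rule copy)
      qed
    qed
  qed
qed (auto simp: W_def E_def H_def)

lemma x_less_y: "(x, y) \<in> snd W"
proof -
  have "x \<in> Br b0" using c_x ht_x by (force simp: Br_def)
  moreover have "y \<in> Up b0" using y by (auto simp: Up_def)
  ultimately show ?thesis using pred_top[OF b0] by blast
qed

end

lemma (in amalgamation) amalgam:
  "\<exists>W H. (W, H) \<in> forcing_P \<rho> \<and> stronger (W, H) (T, F) \<and> stronger (W, H) (U, G) \<and> (x, y) \<in> snd W"
proof -
  obtain pos0 where pos0: "forest_order (edge G) (\<lambda>\<tau> \<zeta>. q \<le> \<rho> \<tau> \<zeta>) pos0 B"
    using U.ex_forest_order[OF q] by blast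
  have "\<exists>pos. forest_order (edge G) (\<lambda>\<tau> \<zeta>. q \<le> \<rho> \<tau> \<zeta>) pos B \<and> (\<forall>b\<in>B. pos b0 \<le> pos b)"
    using forest_order_reroot[OF U.finite_level _ pos0 b0] edge_flip by blast
  then obtain pos where "forest_order (edge G) (\<lambda>\<tau> \<zeta>. q \<le> \<rho> \<tau> \<zeta>) pos B" "\<And>b. b \<in> B \<Longrightarrow> pos b0 \<le> pos b"
    by blast
  then have "rooted_amalgamation_axioms \<rho> U G q b0 pos"
    by (rule rooted_amalgamation_axioms.intro)
  then have r: "rooted_amalgamation \<rho> T F U G p q x y b0 \<phi> pos"
    by (rule rooted_amalgamation.intro[OF amalgamation_axioms])
  interpret R: rooted_amalgamation \<rho> T F U G p q x y b0 \<phi> pos by (rule r)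
  obtain c where c: "\<And>h. h \<in> Mid \<Longrightarrow> inj_on (c h) B"
    "\<And>h b. h \<in> Mid \<Longrightarrow> b \<in> B \<Longrightarrow> ht (c h b) = h"
    "\<And>h b. h \<in> Mid \<Longrightarrow> b \<in> B \<Longrightarrow> c h b \<in> fst T \<longleftrightarrow> R.lift h b (c h b)"
    "\<And>h b u. R.lift h b u \<Longrightarrow> c h b = u"
    using R.ex_branches by blast
  interpret Br: branched_amalgamation \<rho> T F U G p q x y b0 \<phi> pos c
    by (rule branched_amalgamation.intro[OF r], rule branched_amalgamation_axioms.intro) (use c in blast)+
  show ?thesis using Br.W_H_forcing Br.stronger_T Br.stronger_U Br.x_less_y by blast
qed

section \<open>Thinning out uncountable families\<close>

text \<open>Zorn's lemma gives a maximal subset of \<open>Z\<close> of the required kind. If it were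
  countable, an element of \<open>Z\<close> above all its members and outside their countable
  exceptional sets could be added.\<close>

lemma uncountable_sparse_subset:
  fixes Z :: "omega1 set"
  assumes Z: "uncountable Z" and Q: "\<And>\<alpha>. \<alpha> \<in> Z \<Longrightarrow> countable {\<beta> \<in> Z. \<not> Q \<alpha> \<beta>}"
  obtains Z' where "Z' \<subseteq> Z" "uncountable Z'" "\<And>\<alpha> \<beta>. \<alpha> \<in> Z' \<Longrightarrow> \<beta> \<in> Z' \<Longrightarrow> \<alpha> < \<beta> \<Longrightarrow> Q \<alpha> \<beta>"
proof -
  define \<A> where "\<A> = {S. S \<subseteq> Z \<and> (\<forall>\<alpha>\<in>S. \<forall>\<beta>\<in>S. \<alpha> < \<beta> \<longrightarrow> Q \<alpha> \<beta>)}"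
  have "\<Union>\<C> \<in> \<A>" if "subset.chain \<A> \<C>" for \<C>
  proof -
    have sub: "\<C> \<subseteq> \<A>" and ch: "\<And>X Y. X \<in> \<C> \<Longrightarrow> Y \<in> \<C> \<Longrightarrow> X \<subseteq> Y \<or> Y \<subseteq> X"
      using that unfolding subset_chain_def by blast+
    have "Q \<alpha> \<beta>" if ab: "\<alpha> \<in> \<Union>\<C>" "\<beta> \<in> \<Union>\<C>" "\<alpha> < \<beta>" for \<alpha> \<beta>
    proof -
      obtain X Y where XY: "X \<in> \<C>" "\<alpha> \<in> X" "Y \<in> \<C>" "\<beta> \<in> Y" using ab by blast
      then obtain V where "V \<in> \<C>" "\<alpha> \<in> V" "\<beta> \<in> V" using ch[OF XY(1,3)] by blast
      then show ?thesis using sub ab(3) unfolding \<A>_def by blast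
    qed
    then show ?thesis using sub unfolding \<A>_def by blast
  qed
  moreover have "{} \<in> \<A>" by (simp add: \<A>_def)
  ultimately obtain M where M: "M \<in> \<A>" "\<And>X. X \<in> \<A> \<Longrightarrow> M \<subseteq> X \<Longrightarrow> X = M"
    using subset_Zorn_nonempty[of \<A>] by (metis empty_iff)
  have "uncountable M"
  proof
    assume cM: "countable M"
    then obtain b where b: "\<forall>s\<in>M. s < b" using countable_bounded_omega1 by blast
    define bad where "bad = (\<Union>\<alpha>\<in>M. {\<beta> \<in> Z. \<not> Q \<alpha> \<beta>}) \<union> {..b}"
    have "countable bad" unfolding bad_def
      using cM Q M(1) countable_atMost_omega1 by (auto simp: \<A>_def)
    then have "\<not> Z \<subseteq> bad" using Z countable_subset by blast
    then obtain \<beta> where "\<beta> \<in> Z" "\<beta> \<notin> bad" by blast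
    then have \<beta>: "\<beta> \<in> Z" "b < \<beta>" "\<And>\<alpha>. \<alpha> \<in> M \<Longrightarrow> Q \<alpha> \<beta>"
      unfolding bad_def by (simp_all add: not_le)
    have "\<alpha> < \<beta>" if "\<alpha> \<in> M" for \<alpha> using b \<beta>(2) that less_trans by blast
    then have "insert \<beta> M \<in> \<A>" using \<beta> M(1) unfolding \<A>_def by (auto dest: less_asym)
    then have "\<beta> \<in> M" using M(2) by blast
    then show False using b \<beta>(2) less_asym by blast
  qed
  moreover have "M \<subseteq> Z" "\<And>\<alpha> \<beta>. \<alpha> \<in> M \<Longrightarrow> \<beta> \<in> M \<Longrightarrow> \<alpha> < \<beta> \<Longrightarrow> Q \<alpha> \<beta>"
    using M(1) by (simp_all add: \<A>_def)
  ultimately show thesis using that[of M] by simp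
qed

lemma uncountable_pigeonhole:
  assumes "uncountable Z" "countable (f ` Z)"
  obtains y where "uncountable {\<alpha> \<in> Z. f \<alpha> = y}"
proof (rule ccontr)
  assume "\<not> thesis"
  then have "countable (\<Union>y\<in>f ` Z. {\<alpha> \<in> Z. f \<alpha> = y})" using assms(2) that by blast
  moreover have "(\<Union>y\<in>f ` Z. {\<alpha> \<in> Z. f \<alpha> = y}) = Z" by blast
  ultimately show False using assms(1) by simp
qed

text \<open>Once the size of \<open>D \<alpha>\<close> is fixed, the root is a largest set
  \<open>A\<close> contained in uncountably many \<open>D \<alpha>\<close>. By maximality every
  element outside \<open>A\<close> lies in only countably many of these, so
  \<open>uncountable_sparse_subset\<close> can remove all intersections outside
  \<open>A\<close>.\<close>

lemma delta_system:
  fixes Z :: "omega1 set"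
  assumes Z: "uncountable Z" and fin: "\<And>\<alpha>. \<alpha> \<in> Z \<Longrightarrow> finite (D \<alpha>)"
  obtains Z' A where "Z' \<subseteq> Z" "uncountable Z'" "\<And>\<alpha>. \<alpha> \<in> Z' \<Longrightarrow> A \<subseteq> D \<alpha>"
    "\<And>\<alpha> \<beta>. \<alpha> \<in> Z' \<Longrightarrow> \<beta> \<in> Z' \<Longrightarrow> \<alpha> \<noteq> \<beta> \<Longrightarrow> D \<alpha> \<inter> D \<beta> = A"
proof -
  have "countable ((\<lambda>\<alpha>. card (D \<alpha>)) ` Z)" by simp
  then obtain n where "uncountable {\<alpha> \<in> Z. card (D \<alpha>) = n}"
    by (rule uncountable_pigeonhole[OF Z])
  then obtain Y where Y: "uncountable Y" "Y \<subseteq> Z" "\<And>\<alpha>. \<alpha> \<in> Y \<Longrightarrow> card (D \<alpha>) = n" by blast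
  let ?P = "\<lambda>k. \<exists>A. finite A \<and> card A = k \<and> uncountable {\<alpha> \<in> Y. A \<subseteq> D \<alpha>}"
  have "?P 0" using Y(1) by (intro exI[of _ "{}"]) simp
  moreover have "k \<le> n" if "?P k" for k
  proof -
    from that obtain A where A: "card A = k" "uncountable {\<alpha> \<in> Y. A \<subseteq> D \<alpha>}" by blast
    then have "{\<alpha> \<in> Y. A \<subseteq> D \<alpha>} \<noteq> {}" by force
    then obtain \<alpha> where "\<alpha> \<in> Y" "A \<subseteq> D \<alpha>" by blast
    then show ?thesis using A(1) Y(2,3) fin card_mono by blast
  qed
  ultimately obtain k where k: "?P k" "\<And>j. ?P j \<Longrightarrow> j \<le> k"
    using GreatestI_nat[of ?P 0 n] Greatest_le_nat[of ?P _ n] by blast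
  then obtain A where A: "finite A" "card A = k" "uncountable {\<alpha> \<in> Y. A \<subseteq> D \<alpha>}" by blast
  define X where "X = {\<alpha> \<in> Y. A \<subseteq> D \<alpha>}"
  have e: "countable {\<alpha> \<in> X. e \<in> D \<alpha>}" if "e \<notin> A" for e
  proof (rule ccontr)
    assume "uncountable {\<alpha> \<in> X. e \<in> D \<alpha>}"
    moreover have "{\<alpha> \<in> X. e \<in> D \<alpha>} = {\<alpha> \<in> Y. insert e A \<subseteq> D \<alpha>}" by (auto simp: X_def)
    ultimately have "?P (Suc k)" using A(1,2) that by (intro exI[of _ "insert e A"]) simp
    then show False using k(2)[of "Suc k"] by simp
  qed
  have "countable {\<beta> \<in> X. \<not> D \<alpha> \<inter> D \<beta> \<subseteq> A}" if "\<alpha> \<in> X" for \<alpha>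
  proof -
    have "finite (D \<alpha>)" using fin Y(2) that by (auto simp: X_def)
    then have "countable (\<Union>e\<in>D \<alpha> - A. {\<beta> \<in> X. e \<in> D \<beta>})"
      using e by (intro countable_UN) (auto intro: countable_finite)
    moreover have "{\<beta> \<in> X. \<not> D \<alpha> \<inter> D \<beta> \<subseteq> A} \<subseteq> (\<Union>e\<in>D \<alpha> - A. {\<beta> \<in> X. e \<in> D \<beta>})" by blast
    ultimately show ?thesis by (rule countable_subset[rotated])
  qed
  then obtain Z' where Z': "Z' \<subseteq> X" "uncountable Z'"
    "\<And>\<alpha> \<beta>. \<alpha> \<in> Z' \<Longrightarrow> \<beta> \<in> Z' \<Longrightarrow> \<alpha> < \<beta> \<Longrightarrow> D \<alpha> \<inter> D \<beta> \<subseteq> A"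
    using uncountable_sparse_subset[of X "\<lambda>\<alpha> \<beta>. D \<alpha> \<inter> D \<beta> \<subseteq> A"] A(3) unfolding X_def by blast
  show thesis
  proof (rule that)
    show "Z' \<subseteq> Z" "uncountable Z'" "\<And>\<alpha>. \<alpha> \<in> Z' \<Longrightarrow> A \<subseteq> D \<alpha>"
      using Z'(1,2) Y(2) by (auto simp: X_def)
    show "D \<alpha> \<inter> D \<beta> = A" if "\<alpha> \<in> Z'" "\<beta> \<in> Z'" "\<alpha> \<noteq> \<beta>" for \<alpha> \<beta>
    proof -
      have "D \<alpha> \<inter> D \<beta> \<subseteq> A"
      proof (cases "\<alpha> < \<beta>")
        case True
        then show ?thesis using Z'(3) that(1,2) by blast
      next
        case False
        then have "\<beta> < \<alpha>" using that(3) by simp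
        then show ?thesis using Z'(3)[OF that(2,1)] by blast
      qed
      moreover have "A \<subseteq> D \<alpha>" "A \<subseteq> D \<beta>" using Z'(1) that by (auto simp: X_def)
      ultimately show ?thesis by blast
    qed
  qed
qed

text \<open>Passes from families of sets to indexed families. If \<open>D\<close> takes only
  countably many values, it is constant on an uncountable set, where the bound is vacuous; otherwise
  one index is chosen for each set of the thinned family.\<close>

lemma rho_function_uncountable:
  fixes D :: "omega1 \<Rightarrow> omega2 set"
  assumes \<rho>: "rho_function \<rho>" and Z: "uncountable Z" and fin: "\<And>\<alpha>. \<alpha> \<in> Z \<Longrightarrow> finite (D \<alpha>)"
  obtains Z' where "Z' \<subseteq> Z" "uncountable Z'"
    "\<And>\<alpha> \<beta> \<tau> \<zeta> \<gamma>. \<alpha> \<in> Z' \<Longrightarrow> \<beta> \<in> Z' \<Longrightarrow> \<alpha> \<noteq> \<beta> \<Longrightarrow> \<tau> \<in> D \<alpha> - D \<beta> \<Longrightarrow> \<zeta> \<in> D \<beta> - D \<alpha> \<Longrightarrow>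
      \<gamma> \<in> D \<alpha> \<inter> D \<beta> \<Longrightarrow> max (min (\<rho> \<tau> \<gamma>) (\<rho> \<zeta> \<gamma>)) \<mu> \<le> \<rho> \<tau> \<zeta>"
proof (cases "countable (D ` Z)")
  case True
  obtain A where "uncountable {\<alpha> \<in> Z. D \<alpha> = A}" by (rule uncountable_pigeonhole[OF Z True])
  then show thesis by (rule that[rotated]) auto
next
  case False
  have "\<forall>x\<in>D ` Z. finite x" using fin by blast
  then have "\<exists>\<F>\<subseteq>D ` Z. uncountable \<F> \<and> (\<forall>x\<in>\<F>. \<forall>y\<in>\<F>. x \<noteq> y \<longrightarrow>
      (\<forall>\<tau>\<in>x - y. \<forall>\<zeta>\<in>y - x. \<forall>\<gamma>\<in>x \<inter> y. max (min (\<rho> \<tau> \<gamma>) (\<rho> \<zeta> \<gamma>)) \<mu> \<le> \<rho> \<tau> \<zeta>))"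
    using \<rho> False unfolding rho_function_def by blast
  then obtain \<F> where \<F>: "\<F> \<subseteq> D ` Z" "uncountable \<F>" and
    bound: "\<forall>x\<in>\<F>. \<forall>y\<in>\<F>. x \<noteq> y \<longrightarrow>
      (\<forall>\<tau>\<in>x - y. \<forall>\<zeta>\<in>y - x. \<forall>\<gamma>\<in>x \<inter> y. max (min (\<rho> \<tau> \<gamma>) (\<rho> \<zeta> \<gamma>)) \<mu> \<le> \<rho> \<tau> \<zeta>)"
    by (elim exE conjE)
  define g where "g = inv_into Z D"
  have g: "g x \<in> Z" "D (g x) = x" if "x \<in> \<F>" for x
    using inv_into_into[of x D Z] f_inv_into_f[of x D Z] subsetD[OF \<F>(1) that] by (simp_all add: g_def)
  have "D ` (g ` \<F>) = \<F>" using g(2) by force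
  then have "uncountable (g ` \<F>)" using \<F>(2) countable_image[of "g ` \<F>" D] by auto
  moreover have "max (min (\<rho> \<tau> \<gamma>) (\<rho> \<zeta> \<gamma>)) \<mu> \<le> \<rho> \<tau> \<zeta>"
    if "\<alpha> \<in> g ` \<F>" "\<beta> \<in> g ` \<F>" "\<tau> \<in> D \<alpha> - D \<beta>" "\<zeta> \<in> D \<beta> - D \<alpha>" "\<gamma> \<in> D \<alpha> \<inter> D \<beta>" for \<alpha> \<beta> \<tau> \<zeta> \<gamma>
    using that g(2) by (intro bound[rule_format, of "D \<alpha>" "D \<beta>"]) auto
  moreover have "g ` \<F> \<subseteq> Z" using g(1) by blast
  ultimately show thesis using that[of "g ` \<F>"] by simp
qed

text \<open>The defining property of \<open>\<rho>\<close> is vacuous for disjoint sets; enlarging all sets by a common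
  element \<open>\<gamma>0\<close> yields the bound \<open>\<mu>\<close> in this case, too.\<close>

lemma rho_function_thin:
  fixes D :: "omega1 \<Rightarrow> omega2 set"
  assumes \<rho>: "rho_function \<rho>" and Z: "uncountable Z" and fin: "\<And>\<alpha>. \<alpha> \<in> Z \<Longrightarrow> finite (D \<alpha>)"
  obtains Z' where "Z' \<subseteq> Z" "uncountable Z'"
    "\<And>\<alpha> \<beta> \<tau> \<zeta>. \<alpha> \<in> Z' \<Longrightarrow> \<beta> \<in> Z' \<Longrightarrow> \<tau> \<in> D \<alpha> - D \<beta> \<Longrightarrow> \<zeta> \<in> D \<beta> - D \<alpha> \<Longrightarrow>
      \<mu> \<le> \<rho> \<tau> \<zeta> \<and> (\<forall>\<gamma>\<in>D \<alpha> \<inter> D \<beta>. min (\<rho> \<tau> \<gamma>) (\<rho> \<zeta> \<gamma>) \<le> \<rho> \<tau> \<zeta>)"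
proof -
  fix \<gamma>0 :: omega2
  \<comment> \<open>With membership of \<open>\<gamma>0\<close> decided uniformly, inserting it
    leaves the differences of the sets unchanged.\<close>
  obtain P where "uncountable {\<alpha> \<in> Z. (\<gamma>0 \<in> D \<alpha>) = P}"
    by (rule uncountable_pigeonhole[OF Z, of "\<lambda>\<alpha>. \<gamma>0 \<in> D \<alpha>"]) (auto intro: countable_finite)
  then obtain Z' where Z': "Z' \<subseteq> {\<alpha> \<in> Z. (\<gamma>0 \<in> D \<alpha>) = P}" "uncountable Z'" and
    bound: "\<And>\<alpha> \<beta> \<tau> \<zeta> \<gamma>. \<alpha> \<in> Z' \<Longrightarrow> \<beta> \<in> Z' \<Longrightarrow> \<alpha> \<noteq> \<beta> \<Longrightarrow>
      \<tau> \<in> insert \<gamma>0 (D \<alpha>) - insert \<gamma>0 (D \<beta>) \<Longrightarrow> \<zeta> \<in> insert \<gamma>0 (D \<beta>) - insert \<gamma>0 (D \<alpha>) \<Longrightarrow>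
      \<gamma> \<in> insert \<gamma>0 (D \<alpha>) \<inter> insert \<gamma>0 (D \<beta>) \<Longrightarrow> max (min (\<rho> \<tau> \<gamma>) (\<rho> \<zeta> \<gamma>)) \<mu> \<le> \<rho> \<tau> \<zeta>"
    by (rule rho_function_uncountable[OF \<rho>, of _ "\<lambda>\<alpha>. insert \<gamma>0 (D \<alpha>)" \<mu>]) (use fin in auto)
  show thesis
  proof (rule that)
    show "Z' \<subseteq> Z" "uncountable Z'" using Z' by auto
    fix \<alpha> \<beta> \<tau> \<zeta> assume *: "\<alpha> \<in> Z'" "\<beta> \<in> Z'" "\<tau> \<in> D \<alpha> - D \<beta>" "\<zeta> \<in> D \<beta> - D \<alpha>"
    have "\<gamma>0 \<in> D \<alpha> \<longleftrightarrow> \<gamma>0 \<in> D \<beta>" using Z'(1) *(1,2) by blast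
    then have "max (min (\<rho> \<tau> \<gamma>) (\<rho> \<zeta> \<gamma>)) \<mu> \<le> \<rho> \<tau> \<zeta>" if "\<gamma> \<in> insert \<gamma>0 (D \<alpha> \<inter> D \<beta>)" for \<gamma>
      using * that by (intro bound[of \<alpha> \<beta>]) auto
    then show "\<mu> \<le> \<rho> \<tau> \<zeta> \<and> (\<forall>\<gamma>\<in>D \<alpha> \<inter> D \<beta>. min (\<rho> \<tau> \<gamma>) (\<rho> \<zeta> \<gamma>) \<le> \<rho> \<tau> \<zeta>)"
      by (meson insertCI max.boundedE)
  qed
qed

section \<open>Compatible pairs\<close>

text \<open>Turns equality of types into the hypotheses of \<open>amalgamation\<close>. The first
  non-root levels are described by positions in enumerations, so \<open>\<phi>\<close> sends the
  entry of \<open>lU\<close> at a position to the entry of \<open>lT\<close> at the same position;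
  position \<open>k\<close> marks the nodes on the branches to \<open>x\<close> and
  \<open>y\<close>.\<close>

lemma ex_amalgam_of_equal_type:
  fixes lT lU :: "omega1 list"
  assumes conds: "condition \<rho> T F" "condition \<rho> U G" and \<rho>: "rho_function \<rho>"
    and p: "p \<in> heights T" and q: "q \<in> heights U"
    and lt_q: "\<And>v. v \<in> fst T \<Longrightarrow> ht v < q"
    and R: "{v \<in> fst T. ht v < p} = R" "{v \<in> fst U. ht v < q} = R"
    and R_lt: "snd T \<inter> R \<times> R = snd U \<inter> R \<times> R"
    and A: "dom F \<inter> dom G = A"
    and lT: "distinct lT" "set lT = level T p" and lU: "distinct lU" "set lU = level U q"
    and len: "length lT = length lU"
    and pred: "\<And>u i. u \<in> R \<Longrightarrow> i < length lT \<Longrightarrow> (u, lT ! i) \<in> snd T \<longleftrightarrow> (u, lU ! i) \<in> snd U"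
    and edges: "\<And>\<gamma> i j. \<gamma> \<in> A \<Longrightarrow> i < length lT \<Longrightarrow> j < length lT \<Longrightarrow>
      the (F \<gamma>) (lT ! i) = Some (lT ! j) \<longleftrightarrow> the (G \<gamma>) (lU ! i) = Some (lU ! j)"
    and root: "\<And>\<gamma> u v. \<gamma> \<in> A \<Longrightarrow> u \<in> R \<Longrightarrow> v \<in> R \<Longrightarrow>
      the (F \<gamma>) u = Some v \<longleftrightarrow> the (G \<gamma>) u = Some v"
    and type: "\<And>\<zeta>. \<zeta> \<in> dom G \<Longrightarrow> \<exists>\<zeta>'\<in>dom F. \<forall>u\<in>R. \<forall>v\<in>R. the (G \<zeta>) u = Some v \<longrightarrow> the (F \<zeta>') u = Some v"
    and k: "k < length lT" "lT ! k = x \<or> (lT ! k, x) \<in> snd T" "lU ! k = y \<or> (lU ! k, y) \<in> snd U"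
    and x: "x \<in> fst T"
    and rho_root: "\<And>\<tau> \<zeta>. \<tau> \<in> A \<Longrightarrow> \<zeta> \<in> A \<Longrightarrow> \<rho> \<tau> \<zeta> < p"
    and rho_mixed: "\<And>\<tau> \<zeta>. \<tau> \<in> dom F - dom G \<Longrightarrow> \<zeta> \<in> dom G - dom F \<Longrightarrow>
      (\<forall>u\<in>R. ht u \<le> \<rho> \<tau> \<zeta>) \<and> (\<forall>\<gamma>\<in>A. min (\<rho> \<tau> \<gamma>) (\<rho> \<zeta> \<gamma>) \<le> \<rho> \<tau> \<zeta>)"
  shows "\<exists>W H. (W, H) \<in> forcing_P \<rho> \<and> stronger (W, H) (T, F) \<and> stronger (W, H) (U, G) \<and> (x, y) \<in> snd W"
proof -
  interpret T: condition \<rho> T F by (rule conds)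
  interpret U: condition \<rho> U G by (rule conds)
  let ?n = "length lT"
  define idx where "idx = inv_into {..<?n} (nth lU)"
  define \<phi> where "\<phi> b = lT ! idx b" for b
  have bT: "bij_betw (nth lT) {..<?n} (level T p)"
    using bij_betw_nth[OF lT(1) refl lT(2)[symmetric]] .
  have bU: "bij_betw (nth lU) {..<?n} (level U q)"
    using bij_betw_nth[OF lU(1), of "{..<?n}" "level U q"] len lU(2) by simp
  have phi: "\<phi> (lU ! i) = lT ! i" if "i < ?n" for i
    using inv_into_f_f[OF bij_betw_imp_inj_on[OF bU], of i] that by (simp add: \<phi>_def idx_def)
  have ex: "\<exists>i<?n. b = lU ! i" if "b \<in> level U q" for b
    using that lU(2) len by (metis in_set_conv_nth)
  have pq: "p < q" using p lt_q by (auto simp: heights_def)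
  have RT: "u \<in> R \<longleftrightarrow> u \<in> fst T \<and> ht u < p" and RU: "u \<in> R \<longleftrightarrow> u \<in> fst U \<and> ht u < q" for u
    using R by blast+
  have Rp: "u \<in> R \<longleftrightarrow> u \<in> fst U" if "ht u < p" for u
    using RU[of u] that pq by (metis less_trans)
  have edgeF: "edge F (\<tau>, s) u v \<longleftrightarrow> edge F (\<tau>, s) u v \<and> u \<in> R \<and> v \<in> R"
    and edgeG: "edge G (\<tau>, s) u v \<longleftrightarrow> edge G (\<tau>, s) u v \<and> u \<in> R \<and> v \<in> R" if "ht u < p" for \<tau> s u v
    using T.edgeD[of "(\<tau>, s)" u v] U.edgeD[of "(\<tau>, s)" u v] that RT[of u] RT[of v] Rp[of u] Rp[of v] by auto
  have "amalgamation \<rho> T F U G p q x y (lU ! k) \<phi>"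
  proof unfold_locales
    show "\<rho> \<tau> \<zeta> = \<rho> \<zeta> \<tau>" for \<tau> \<zeta> using \<rho> by (auto simp: rho_function_def)
    show "p \<in> heights T" "q \<in> heights U" "x \<in> fst T" by (rule p, rule q, rule x)
    show "{v \<in> fst T. ht v < p} = {v \<in> fst U. ht v < q}" using R by simp
    show "ht v < q" if "v \<in> fst T" for v using lt_q[OF that] .
    show "(u, v) \<in> snd T \<longleftrightarrow> (u, v) \<in> snd U" if v: "ht v < p" for u v
    proof -
      have "u \<in> R \<and> v \<in> R" if "(u, v) \<in> snd T"
        using T.ltD[OF that] v RT less_trans by blast
      moreover have "u \<in> R \<and> v \<in> R" if "(u, v) \<in> snd U"
        using U.ltD[OF that] v Rp less_trans by blast
      ultimately show ?thesis using R_lt by blast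
    qed
    show "edge F l u v \<longleftrightarrow> edge G l u v" if l: "fst l \<in> dom F \<inter> dom G" and u: "ht u < p" for l u v
    proof (cases l)
      case (Pair \<tau> s)
      then have "\<tau> \<in> A" using l A by simp
      then show ?thesis using edgeF[OF u, of \<tau> s v] edgeG[OF u, of \<tau> s v] root[of \<tau> u v] root[of \<tau> v u] l
        unfolding Pair by (auto simp: edge_def)
    qed
    show "\<exists>\<zeta>'. \<forall>s u v. ht u < p \<longrightarrow> edge G (\<zeta>, s) u v \<longrightarrow> edge F (\<zeta>', s) u v" if \<zeta>: "\<zeta> \<in> dom G" for \<zeta>
    proof -
      obtain \<zeta>' where \<zeta>': "\<zeta>' \<in> dom F" "\<And>u v. u \<in> R \<Longrightarrow> v \<in> R \<Longrightarrow> the (G \<zeta>) u = Some v \<Longrightarrow> the (F \<zeta>') u = Some v"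
        using type[OF \<zeta>] by blast
      have "edge F (\<zeta>', s) u v" if u: "ht u < p" and e: "edge G (\<zeta>, s) u v" for s u v
      proof -
        have "u \<in> R" "v \<in> R" using edgeG[OF u] e by blast+
        then show ?thesis using e \<zeta>' by (auto simp: edge_def split: if_splits)
      qed
      then show ?thesis by blast
    qed
    show "bij_betw \<phi> (level U q) (level T p)"
      unfolding \<phi>_def using bij_betw_trans[OF bij_betw_inv_into[OF bU] bT] by (simp add: idx_def comp_def)
    show "(u, b) \<in> snd U \<longleftrightarrow> (u, \<phi> b) \<in> snd T" if b: "b \<in> level U q" and u: "ht u < p" for b u
    proof -
      obtain i where i: "i < ?n" "b = lU ! i" using ex[OF b] by blast
      show ?thesis
      proof (cases "u \<in> R")
        case True
        then show ?thesis using pred[OF True i(1)] phi[OF i(1)] i(2) by simp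
      next
        case False
        then show ?thesis using RT[of u] Rp[OF u] u T.ltD U.ltD by blast
      qed
    qed
    show "edge G l b b' \<longleftrightarrow> edge F l (\<phi> b) (\<phi> b')"
      if b: "b \<in> level U q" "b' \<in> level U q" and l: "fst l \<in> dom F \<inter> dom G" for b b' l
    proof -
      obtain i where i: "i < ?n" "b = lU ! i" using ex[OF b(1)] by blast
      obtain j where j: "j < ?n" "b' = lU ! j" using ex[OF b(2)] by blast
      have "fst l \<in> A" using l A by simp
      then show ?thesis using edges[of "fst l" i j] edges[of "fst l" j i] i j phi l by (auto simp: edge_def)
    qed
    show "lU ! k \<in> level U q" using k(1) len lU(2) nth_mem by metis
    show "y = lU ! k \<or> (lU ! k, y) \<in> snd U" using k(3) by blast
    show "\<phi> (lU ! k) = x \<or> (\<phi> (lU ! k), x) \<in> snd T" using k(2) phi[OF k(1)] by simp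
    show "\<rho> \<tau> \<zeta> < p" if "\<tau> \<in> dom F \<inter> dom G" "\<zeta> \<in> dom F \<inter> dom G" for \<tau> \<zeta>
      using rho_root that A by blast
    show "ht u \<le> \<rho> \<tau> \<zeta>" if "\<tau> \<in> dom F - dom G" "\<zeta> \<in> dom G - dom F" "u \<in> fst T" "ht u < p" for \<tau> \<zeta> u
      using rho_mixed[OF that(1,2)] that(3,4) RT by blast
    show "min (\<rho> \<tau> \<gamma>) (\<rho> \<zeta> \<gamma>) \<le> \<rho> \<tau> \<zeta>"
      if "\<tau> \<in> dom F - dom G" "\<zeta> \<in> dom G - dom F" "\<gamma> \<in> dom F \<inter> dom G" for \<tau> \<zeta> \<gamma>
      using rho_mixed[OF that(1,2)] that(3) A by blast
  qed
  then show ?thesis by (rule amalgamation.amalgam)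
qed

theorem theorem7p1:
  fixes \<rho> :: "omega2 \<Rightarrow> omega2 \<Rightarrow> omega1"
    and T :: "omega1 \<Rightarrow> ftree"
    and F :: "omega1 \<Rightarrow> (omega2 \<rightharpoonup> pfun)"
    and x :: "omega1 \<Rightarrow> omega1"
  assumes "square_omega1"
    and "rho_function \<rho>"
    and "\<And>\<alpha>. (T \<alpha>, F \<alpha>) \<in> forcing_P \<rho>"
    and "\<And>\<alpha>. x \<alpha> \<in> fst (T \<alpha>) - {..<\<alpha>}"
  shows "\<exists>Z :: omega1 set. uncountable Z \<and>
    (\<forall>\<alpha>\<in>Z. \<forall>\<beta>\<in>Z. \<alpha> < \<beta> \<longrightarrow>
      (\<exists>W H. (W, H) \<in> forcing_P \<rho> \<and>
        stronger (W, H) (T \<alpha>, F \<alpha>) \<and> stronger (W, H) (T \<beta>, F \<beta>) \<and>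
        (x \<alpha>, x \<beta>) \<in> snd W))"
proof -
  have conds: "condition \<rho> (T \<alpha>) (F \<alpha>)" for \<alpha> by (rule condition.intro) (rule assms(3))
  have x: "x \<alpha> \<in> fst (T \<alpha>)" "\<alpha> \<le> x \<alpha>" for \<alpha> using assms(4)[of \<alpha>] by auto
  define Ht where "Ht \<alpha> = ht ` fst (T \<alpha>)" for \<alpha>
  have finHt: "finite (Ht \<alpha>)" for \<alpha> using condition.finite_tree[OF conds] by (simp add: Ht_def)
  \<comment> \<open>\<open>H0\<close> is the root of the heights; beyond it, different trees share
    no height.\<close>
  obtain Z1 H0 where Z1: "uncountable Z1" "\<And>\<alpha>. \<alpha> \<in> Z1 \<Longrightarrow> H0 \<subseteq> Ht \<alpha>"
    "\<And>\<alpha> \<beta>. \<alpha> \<in> Z1 \<Longrightarrow> \<beta> \<in> Z1 \<Longrightarrow> \<alpha> \<noteq> \<beta> \<Longrightarrow> Ht \<alpha> \<inter> Ht \<beta> = H0"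
    by (rule delta_system[of UNIV Ht]) (use uncountable_UNIV_omega1 finHt in auto)
  have "Z1 \<noteq> {}" using Z1(1) by force
  then have finH0: "finite H0" using Z1(2) finHt finite_subset by blast
  have zero: "0 \<in> Ht \<alpha>" for \<alpha> using condition.zero_mem[OF conds] ht_zero unfolding Ht_def by (metis imageI)
  have diff: "uncountable (X - C)" if "uncountable X" "countable C" for X C :: "omega1 set"
    using that uncountable_minus_countable by blast
  \<comment> \<open>Height 0 occurs in every tree, so it belongs to the root; this makes the first
    non-root height nonzero, as membership in \<open>heights\<close> demands.\<close>
  have "0 \<in> H0"
  proof -
    obtain \<alpha> where "\<alpha> \<in> Z1" using \<open>Z1 \<noteq> {}\<close> by blast
    moreover have "Z1 - {\<alpha>} \<noteq> {}" using diff[OF Z1(1), of "{\<alpha>}"] by (metis countable_empty countable_insert)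
    then obtain \<beta> where "\<beta> \<in> Z1" "\<beta> \<noteq> \<alpha>" by blast
    ultimately show ?thesis using Z1(3)[of \<alpha> \<beta>] zero by blast
  qed
  \<comment> \<open>The ordinals with height in \<open>H0\<close> are bounded and
    \<open>x \<alpha>\<close> is at least \<alpha>. So for all but countably many indices
    \<open>x \<alpha>\<close> lies outside the root, and a first non-root height
    \<open>p \<alpha>\<close> exists.\<close>
  have "countable {\<alpha>. ht (x \<alpha>) \<in> H0}"
  proof -
    obtain b where b: "\<forall>\<gamma>\<in>{\<gamma>. ht \<gamma> \<in> H0}. \<gamma> < b"
      using countable_bounded_omega1[OF countable_ht_vimage[OF countable_finite[OF finH0]]] by blast
    have "{\<alpha>. ht (x \<alpha>) \<in> H0} \<subseteq> {..b}" using b x(2) by (auto intro: less_imp_le le_less_trans)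
    then show ?thesis using countable_atMost_omega1 countable_subset by blast
  qed
  then have Z2: "uncountable (Z1 - {\<alpha>. ht (x \<alpha>) \<in> H0})" by (rule diff[OF Z1(1)])
  define Z2 where "Z2 = Z1 - {\<alpha>. ht (x \<alpha>) \<in> H0}"
  define p where "p \<alpha> = Min (Ht \<alpha> - H0)" for \<alpha>
  have p: "p \<alpha> \<in> Ht \<alpha> - H0" "\<And>h. h \<in> Ht \<alpha> - H0 \<Longrightarrow> p \<alpha> \<le> h" if "\<alpha> \<in> Z2" for \<alpha>
  proof -
    have "ht (x \<alpha>) \<in> Ht \<alpha> - H0" using that x(1) by (auto simp: Z2_def Ht_def)
    then have "Ht \<alpha> - H0 \<noteq> {}" "finite (Ht \<alpha> - H0)" using finHt by auto
    then show "p \<alpha> \<in> Ht \<alpha> - H0" "\<And>h. h \<in> Ht \<alpha> - H0 \<Longrightarrow> p \<alpha> \<le> h"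
      unfolding p_def using Min_in Min_le by blast+
  qed
  \<comment> \<open>Disjointness of the non-root heights makes \<open>p\<close> injective, so it
    exceeds any given bound at all but countably many indices.\<close>
  have "inj_on p Z2"
  proof (rule inj_onI)
    fix \<alpha> \<beta> assume "\<alpha> \<in> Z2" "\<beta> \<in> Z2" "p \<alpha> = p \<beta>"
    then show "\<alpha> = \<beta>" using p(1)[of \<alpha>] p(1)[of \<beta>] Z1(3)[of \<alpha> \<beta>] by (auto simp: Z2_def)
  qed
  then have p_small: "countable {\<alpha> \<in> Z2. p \<alpha> \<le> \<xi>}" for \<xi>
  proof -
    have "countable (p ` {\<alpha> \<in> Z2. p \<alpha> \<le> \<xi>})"
      by (rule countable_subset[OF _ countable_atMost_omega1[of \<xi>]]) auto
    moreover have "inj_on p {\<alpha> \<in> Z2. p \<alpha> \<le> \<xi>}" using \<open>inj_on p Z2\<close> by (rule inj_on_subset) auto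
    ultimately show ?thesis by (rule countable_image_inj_on)
  qed
  have p_large: "uncountable {\<alpha> \<in> Z. \<xi> < p \<alpha>}" if "uncountable Z" "Z \<subseteq> Z2" for Z \<xi>
  proof -
    have "Z - {\<alpha> \<in> Z2. p \<alpha> \<le> \<xi>} = {\<alpha> \<in> Z. \<xi> < p \<alpha>}" using that(2) by (auto simp: not_le)
    then show ?thesis using diff[OF that(1) p_small[of \<xi>]] by simp
  qed
  \<comment> \<open>This bound is used twice: \<open>\<mu> < p \<alpha>\<close> makes the root
    exactly the part of the tree below \<open>p \<alpha>\<close>, and later \<open>\<mu>\<close> is
    the lower bound demanded of rho, so that rho dominates the heights of root nodes.\<close>
  obtain \<mu> where \<mu>: "\<And>h. h \<in> H0 \<Longrightarrow> h < \<mu>"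
    using countable_bounded_omega1[OF countable_finite[OF finH0]] by blast
  define Z3 where "Z3 = {\<alpha> \<in> Z2. \<mu> < p \<alpha>}"
  have Z3: "uncountable Z3" using p_large[of Z2 \<mu>] Z2 by (simp add: Z3_def Z2_def)
  define root where "root \<alpha> = {v \<in> fst (T \<alpha>). ht v \<in> H0}" for \<alpha>
  have root: "{v \<in> fst (T \<alpha>). ht v < p \<alpha>} = root \<alpha>" if "\<alpha> \<in> Z3" for \<alpha>
  proof -
    have "ht v < p \<alpha> \<longleftrightarrow> ht v \<in> H0" if "v \<in> fst (T \<alpha>)" for v
    proof -
      have "ht v \<in> Ht \<alpha>" using that by (simp add: Ht_def)
      then show ?thesis using p(2)[of \<alpha> "ht v"] \<mu>[of "ht v"] \<open>\<alpha> \<in> Z3\<close> by (auto simp: Z3_def not_le[symmetric])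
    qed
    then show ?thesis unfolding root_def by blast
  qed
  have fin_root: "finite (root \<alpha>)" for \<alpha> using condition.finite_tree[OF conds] by (simp add: root_def)
  have "countable (root ` Z3)"
  proof (rule countable_subset)
    show "root ` Z3 \<subseteq> {X. finite X \<and> X \<subseteq> {\<gamma>. ht \<gamma> \<in> H0}}" using fin_root by (auto simp: root_def)
    show "countable {X. finite X \<and> X \<subseteq> {\<gamma>. ht \<gamma> \<in> H0}}"
      by (intro countable_Collect_finite_subset countable_ht_vimage countable_finite finH0)
  qed
  then obtain R where R: "uncountable {\<alpha> \<in> Z3. root \<alpha> = R}" by (rule uncountable_pigeonhole[OF Z3])
  obtain Z4 A where Z4: "Z4 \<subseteq> {\<alpha> \<in> Z3. root \<alpha> = R}" "uncountable Z4" "\<And>\<alpha>. \<alpha> \<in> Z4 \<Longrightarrow> A \<subseteq> dom (F \<alpha>)"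
    "\<And>\<alpha> \<beta>. \<alpha> \<in> Z4 \<Longrightarrow> \<beta> \<in> Z4 \<Longrightarrow> \<alpha> \<noteq> \<beta> \<Longrightarrow> dom (F \<alpha>) \<inter> dom (F \<beta>) = A"
    by (rule delta_system[where D = "\<lambda>\<alpha>. dom (F \<alpha>)", OF R condition.finite_dom[OF conds]]) auto
  have "Z4 \<noteq> {}" using Z4(2) by force
  then have finA: "finite A" using Z4(3) condition.finite_dom[OF conds] finite_subset by blast
  have finR: "finite R" using \<open>Z4 \<noteq> {}\<close> Z4(1) fin_root by blast
  have "\<exists>l. distinct l \<and> set l = level (T \<alpha>) (p \<alpha>)" for \<alpha>
    using finite_distinct_list[OF condition.finite_level[OF conds]] by blast
  then obtain l where l: "\<And>\<alpha>. distinct (l \<alpha>)" "\<And>\<alpha>. set (l \<alpha>) = level (T \<alpha>) (p \<alpha>)" by metis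
  have "\<exists>k<length (l \<alpha>). l \<alpha> ! k = x \<alpha> \<or> (l \<alpha> ! k, x \<alpha>) \<in> snd (T \<alpha>)" if "\<alpha> \<in> Z4" for \<alpha>
  proof -
    have \<alpha>: "\<alpha> \<in> Z2" using that Z4(1) by (auto simp: Z3_def)
    have "ht (x \<alpha>) \<in> Ht \<alpha> - H0" using \<alpha> x(1) by (auto simp: Z2_def Ht_def)
    then have le: "p \<alpha> \<le> ht (x \<alpha>)" using p(2)[OF \<alpha>] by blast
    have "\<exists>b. b \<in> level (T \<alpha>) (p \<alpha>) \<and> (b = x \<alpha> \<or> (b, x \<alpha>) \<in> snd (T \<alpha>))"
    proof (cases "p \<alpha> = ht (x \<alpha>)")
      case True
      then show ?thesis using x(1) by (auto simp: level_def)
    next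
      case False
      then have "p \<alpha> < ht (x \<alpha>)" using le by simp
      then obtain b where "(b, x \<alpha>) \<in> snd (T \<alpha>)" "ht b = p \<alpha>"
        using condition.below[OF conds x(1)] p(1)[OF \<alpha>] unfolding Ht_def by blast
      then show ?thesis using condition.ltD[OF conds] by (auto simp: level_def)
    qed
    then show ?thesis using l(2) by (metis in_set_conv_nth)
  qed
  then obtain k where k: "\<And>\<alpha>. \<alpha> \<in> Z4 \<Longrightarrow> k \<alpha> < length (l \<alpha>)"
    "\<And>\<alpha>. \<alpha> \<in> Z4 \<Longrightarrow> l \<alpha> ! k \<alpha> = x \<alpha> \<or> (l \<alpha> ! k \<alpha>, x \<alpha>) \<in> snd (T \<alpha>)" by metis
  \<comment> \<open>The type records the order and the functions on the root and on the first
    non-root level, the latter up to positions in \<open>l \<alpha>\<close>. It ranges over a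
    countable set because \<open>R\<close> and \<open>A\<close> are finite.\<close>
  define t1 where "t1 \<alpha> = snd (T \<alpha>) \<inter> R \<times> R" for \<alpha>
  define t2 where "t2 \<alpha> = {(u, i). u \<in> R \<and> i < length (l \<alpha>) \<and> (u, l \<alpha> ! i) \<in> snd (T \<alpha>)}" for \<alpha>
  define t3 where "t3 \<alpha> = {(\<gamma>, i, j). \<gamma> \<in> A \<and> i < length (l \<alpha>) \<and> j < length (l \<alpha>) \<and>
    the (F \<alpha> \<gamma>) (l \<alpha> ! i) = Some (l \<alpha> ! j)}" for \<alpha>
  define t4 where "t4 \<alpha> = {(\<gamma>, u, v). \<gamma> \<in> A \<and> u \<in> R \<and> v \<in> R \<and> the (F \<alpha> \<gamma>) u = Some v}" for \<alpha>
  \<comment> \<open>The restrictions of all functions to the root, with their indices forgotten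
    because the domains differ outside \<open>A\<close>. Equality of these sets yields the parallel
    arrows of \<open>F\<close> required by \<open>root_type\<close>.\<close>
  define t5 where "t5 \<alpha> = (\<lambda>\<zeta>. {(u, v). u \<in> R \<and> v \<in> R \<and> the (F \<alpha> \<zeta>) u = Some v}) ` dom (F \<alpha>)" for \<alpha>
  define type where "type \<alpha> = (t1 \<alpha>, t2 \<alpha>, t3 \<alpha>, t4 \<alpha>, t5 \<alpha>, length (l \<alpha>), k \<alpha>)" for \<alpha>
  have "countable (type ` Z4)"
  proof (rule countable_subset)
    let ?S = "Pow (R \<times> R) \<times> {X. finite X \<and> X \<subseteq> R \<times> (UNIV :: nat set)} \<times>
      {X. finite X \<and> X \<subseteq> A \<times> (UNIV :: nat set) \<times> (UNIV :: nat set)} \<times>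
      Pow (A \<times> R \<times> R) \<times> Pow (Pow (R \<times> R)) \<times> (UNIV :: nat set) \<times> (UNIV :: nat set)"
    have "finite (t2 \<alpha>)" for \<alpha>
      by (rule finite_subset[of _ "R \<times> {..<length (l \<alpha>)}"]) (use finR in \<open>auto simp: t2_def\<close>)
    moreover have "finite (t3 \<alpha>)" for \<alpha>
      by (rule finite_subset[of _ "A \<times> {..<length (l \<alpha>)} \<times> {..<length (l \<alpha>)}"])
        (use finA in \<open>auto simp: t3_def\<close>)
    ultimately show "type ` Z4 \<subseteq> ?S"
      by (auto simp: type_def t1_def t2_def t3_def t4_def t5_def)
    have cR: "countable R" "countable A" using finR finA by (auto intro: countable_finite)
    show "countable ?S"
      by (intro countable_SIGMA countable_Collect_finite_subset countable_finite[of "Pow _"] cR)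
        (use finR finA in auto)
  qed
  then obtain ty where ty: "uncountable {\<alpha> \<in> Z4. type \<alpha> = ty}" by (rule uncountable_pigeonhole[OF Z4(2)])
  obtain Z5 where Z5: "Z5 \<subseteq> {\<alpha> \<in> Z4. type \<alpha> = ty}" "uncountable Z5" and
    rho: "\<And>\<alpha> \<beta> \<tau> \<zeta>. \<alpha> \<in> Z5 \<Longrightarrow> \<beta> \<in> Z5 \<Longrightarrow> \<tau> \<in> dom (F \<alpha>) - dom (F \<beta>) \<Longrightarrow> \<zeta> \<in> dom (F \<beta>) - dom (F \<alpha>) \<Longrightarrow>
      \<mu> \<le> \<rho> \<tau> \<zeta> \<and> (\<forall>\<gamma>\<in>dom (F \<alpha>) \<inter> dom (F \<beta>). min (\<rho> \<tau> \<gamma>) (\<rho> \<zeta> \<gamma>) \<le> \<rho> \<tau> \<zeta>)"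
    by (rule rho_function_thin[where D = "\<lambda>\<alpha>. dom (F \<alpha>)" and \<mu> = \<mu>,
          OF assms(2) ty condition.finite_dom[OF conds]]) auto
  \<comment> \<open>Only finitely many values of rho occur on \<open>A\<close>, so they lie below
    \<open>p \<alpha>\<close> for uncountably many indices; this is what excludes parallel labels in
    \<open>A\<close> above the root.\<close>
  have "countable ((\<lambda>(\<tau>, \<zeta>). \<rho> \<tau> \<zeta>) ` (A \<times> A))" using finA by (intro countable_finite) simp
  from countable_bounded_omega1[OF this]
  obtain \<nu> where "\<forall>s\<in>(\<lambda>(\<tau>, \<zeta>). \<rho> \<tau> \<zeta>) ` (A \<times> A). s < \<nu>" ..
  then have \<nu>: "\<rho> \<tau> \<zeta> < \<nu>" if "\<tau> \<in> A" "\<zeta> \<in> A" for \<tau> \<zeta>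
    using that by auto
  define Z6 where "Z6 = {\<alpha> \<in> Z5. \<nu> < p \<alpha>}"
  have sub2: "Z5 \<subseteq> Z2" using Z5(1) Z4(1) by (auto simp: Z3_def)
  have Z6: "uncountable Z6" using p_large[OF Z5(2) sub2] by (simp add: Z6_def)
  \<comment> \<open>The heights of one tree are bounded, and \<open>p \<beta>\<close> passes the
    bound for all but countably many \<beta>. The sparse subset then puts the whole tree of \<alpha>
    below the first non-root height of each later \<beta>.\<close>
  have "countable {\<beta> \<in> Z6. \<not> (\<forall>h\<in>Ht \<alpha>. h < p \<beta>)}" for \<alpha>
  proof -
    obtain b where "\<forall>h\<in>Ht \<alpha>. h < b" using countable_bounded_omega1[OF countable_finite[OF finHt]] by blast
    then have "{\<beta> \<in> Z6. \<not> (\<forall>h\<in>Ht \<alpha>. h < p \<beta>)} \<subseteq> {\<beta> \<in> Z2. p \<beta> \<le> b}"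
      using sub2 unfolding Z6_def by (force simp: not_less)
    then show ?thesis using p_small countable_subset by blast
  qed
  note sparse = this
  obtain Z where Z: "Z \<subseteq> Z6" "uncountable Z"
    "\<And>\<alpha> \<beta>. \<alpha> \<in> Z \<Longrightarrow> \<beta> \<in> Z \<Longrightarrow> \<alpha> < \<beta> \<Longrightarrow> \<forall>h\<in>Ht \<alpha>. h < p \<beta>"
    by (rule uncountable_sparse_subset[where Q = "\<lambda>\<alpha> \<beta>. \<forall>h\<in>Ht \<alpha>. h < p \<beta>", OF Z6 sparse]) auto
  have "\<exists>W H. (W, H) \<in> forcing_P \<rho> \<and> stronger (W, H) (T \<alpha>, F \<alpha>) \<and> stronger (W, H) (T \<beta>, F \<beta>) \<and>
      (x \<alpha>, x \<beta>) \<in> snd W" if \<alpha>\<beta>: "\<alpha> \<in> Z" "\<beta> \<in> Z" "\<alpha> < \<beta>" for \<alpha> \<beta>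
  proof -
    have mem: "\<alpha> \<in> Z5" "\<beta> \<in> Z5" "\<alpha> \<in> Z4" "\<beta> \<in> Z4" "\<alpha> \<in> Z3" "\<beta> \<in> Z3" "\<alpha> \<in> Z2" "\<beta> \<in> Z2"
      "root \<alpha> = R" "root \<beta> = R" "type \<alpha> = ty" "type \<beta> = ty" "\<nu> < p \<alpha>"
      using \<alpha>\<beta>(1,2) Z(1) Z5(1) Z4(1) sub2 by (auto simp: Z6_def)
    have type_eq: "t1 \<alpha> = t1 \<beta>" "t2 \<alpha> = t2 \<beta>" "t3 \<alpha> = t3 \<beta>" "t4 \<alpha> = t4 \<beta>" "t5 \<alpha> = t5 \<beta>"
      "length (l \<alpha>) = length (l \<beta>)" "k \<alpha> = k \<beta>"
      using mem(11,12) by (auto simp: type_def)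
    have dom: "dom (F \<alpha>) \<inter> dom (F \<beta>) = A" using Z4(4) mem(3,4) \<alpha>\<beta>(3) by blast
    have heights: "p \<gamma> \<in> heights (T \<gamma>)" if "\<gamma> \<in> Z2" for \<gamma>
      using p(1)[OF that] \<open>0 \<in> H0\<close> by (auto simp: heights_def Ht_def)
    show ?thesis
    proof (rule ex_amalgam_of_equal_type[OF conds conds assms(2) heights[OF mem(7)] heights[OF mem(8)] _ _ _ _ dom
        l(1) l(2) l(1) l(2) type_eq(6)])
      show "ht v < p \<beta>" if "v \<in> fst (T \<alpha>)" for v
        using Z(3)[OF \<alpha>\<beta>] that by (simp add: Ht_def)
      show "{v \<in> fst (T \<alpha>). ht v < p \<alpha>} = R" "{v \<in> fst (T \<beta>). ht v < p \<beta>} = R"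
        using root mem(5,6,9,10) by simp_all
      show "snd (T \<alpha>) \<inter> R \<times> R = snd (T \<beta>) \<inter> R \<times> R" using type_eq(1) by (simp add: t1_def)
      show "(u, l \<alpha> ! i) \<in> snd (T \<alpha>) \<longleftrightarrow> (u, l \<beta> ! i) \<in> snd (T \<beta>)" if "u \<in> R" "i < length (l \<alpha>)" for u i
        using that type_eq(6) eqset_imp_iff[OF type_eq(2), of "(u, i)"] by (simp add: t2_def)
      show "the (F \<alpha> \<gamma>) (l \<alpha> ! i) = Some (l \<alpha> ! j) \<longleftrightarrow> the (F \<beta> \<gamma>) (l \<beta> ! i) = Some (l \<beta> ! j)"
        if "\<gamma> \<in> A" "i < length (l \<alpha>)" "j < length (l \<alpha>)" for \<gamma> i j
        using that type_eq(6) eqset_imp_iff[OF type_eq(3), of "(\<gamma>, i, j)"] by (simp add: t3_def)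
      show "the (F \<alpha> \<gamma>) u = Some v \<longleftrightarrow> the (F \<beta> \<gamma>) u = Some v" if "\<gamma> \<in> A" "u \<in> R" "v \<in> R" for \<gamma> u v
        using that eqset_imp_iff[OF type_eq(4), of "(\<gamma>, u, v)"] by (simp add: t4_def)
      show "\<exists>\<zeta>'\<in>dom (F \<alpha>). \<forall>u\<in>R. \<forall>v\<in>R. the (F \<beta> \<zeta>) u = Some v \<longrightarrow> the (F \<alpha> \<zeta>') u = Some v"
        if "\<zeta> \<in> dom (F \<beta>)" for \<zeta>
      proof -
        have "{(u, v). u \<in> R \<and> v \<in> R \<and> the (F \<beta> \<zeta>) u = Some v} \<in> t5 \<beta>"
          unfolding t5_def by (rule imageI[OF that])
        then obtain \<zeta>' where \<zeta>': "\<zeta>' \<in> dom (F \<alpha>)" "{(u, v). u \<in> R \<and> v \<in> R \<and> the (F \<beta> \<zeta>) u = Some v} =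
            {(u, v). u \<in> R \<and> v \<in> R \<and> the (F \<alpha> \<zeta>') u = Some v}"
          unfolding type_eq(5)[symmetric] by (auto simp: t5_def)
        have "the (F \<alpha> \<zeta>') u = Some v" if "u \<in> R" "v \<in> R" "the (F \<beta> \<zeta>) u = Some v" for u v
          using eqset_imp_iff[OF \<zeta>'(2), of "(u, v)"] that by simp
        then show ?thesis using \<zeta>'(1) by blast
      qed
      show "k \<alpha> < length (l \<alpha>)" "l \<alpha> ! k \<alpha> = x \<alpha> \<or> (l \<alpha> ! k \<alpha>, x \<alpha>) \<in> snd (T \<alpha>)"
        using k mem(3) by blast+
      show "l \<beta> ! k \<alpha> = x \<beta> \<or> (l \<beta> ! k \<alpha>, x \<beta>) \<in> snd (T \<beta>)" using k(2)[OF mem(4)] type_eq(7) by simp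
      show "x \<alpha> \<in> fst (T \<alpha>)" by (rule x(1))
      show "\<rho> \<tau> \<zeta> < p \<alpha>" if "\<tau> \<in> A" "\<zeta> \<in> A" for \<tau> \<zeta> using \<nu>[OF that] mem(13) by (rule less_trans)
      show "(\<forall>u\<in>R. ht u \<le> \<rho> \<tau> \<zeta>) \<and> (\<forall>\<gamma>\<in>A. min (\<rho> \<tau> \<gamma>) (\<rho> \<zeta> \<gamma>) \<le> \<rho> \<tau> \<zeta>)"
        if "\<tau> \<in> dom (F \<alpha>) - dom (F \<beta>)" "\<zeta> \<in> dom (F \<beta>) - dom (F \<alpha>)" for \<tau> \<zeta>
      proof -
        have "ht u \<le> \<mu>" if "u \<in> R" for u using that mem(9) \<mu>[of "ht u"] by (auto simp: root_def)
        then show ?thesis using rho[OF mem(1,2) that] dom by (meson order_trans)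
      qed
    qed
  qed
  then show ?thesis using Z(2) by blast
qed

end
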